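(* Let $\mathbf{C}$ be an abelian category with enough injectives, and let $F$ be a left exact functor from $\mathbf{C}$ to the category of abelian groups. For $i\geq 0$, let $R^iF$ denote the $i$-th right derived functor of $F$. Let $N$ be an object of $\mathbf{C}$, and let $m>0$ be an integer such that the multiplication-by-$m$ map $[m]:N\to N$ is an epimorphism. Then for all $i>0$ the short exact sequence of abelian groups induced by $[m]$ on cohomology $$0 \longrightarrow R^{i-1}F(N)/m \longrightarrow R^iF(N[m]) \longrightarrow R^iF(N)[m] \longrightarrow 0$$ splits.
   Context: For an object $M$ of an abelian category (for instance an abelian group) and an integer $m>0$, $[m]:M\to M$ denotes multiplication by $m$, $M[m]$ its kernel, $mM$ its image, and $M/m$ its cokernel. Since $[m]:N\to N$ is an epimorphism, there is a short exact sequence $0\to N[m]\to N\xrightarrow{[m]} N\to 0$ in $\mathbf{C}$. The short exact sequence of the claim (the "Kummer" exact sequence) is extracted from the associated long exact sequence of right derived functors: the map $R^{i-1}F(N)/m\to R^iF(N[m])$ is induced by the connecting homomorphism $R^{i-1}F(N)\to R^iF(N[m])$, and the map $R^iF(N[m])\to R^iF(N)[m]$ is induced by the inclusion $N[m]\hookrightarrow N$. *)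

theory Defs
  imports "HOL-Algebra.Coset"
begin

section \<open>Categories enriched in abelian groups\<close>

record ('o, 'm) ab_category =
  Ob :: "'o set"
  Arr :: "'m set"
  Dom :: "'m \<Rightarrow> 'o"
  Cod :: "'m \<Rightarrow> 'o"
  Idt :: "'o \<Rightarrow> 'm"
  Comp :: "'m \<Rightarrow> 'm \<Rightarrow> 'm"  (infixl \<open>\<bullet>\<index>\<close> 70)
  Zer :: "'o \<Rightarrow> 'o \<Rightarrow> 'm"
  Plus :: "'m \<Rightarrow> 'm \<Rightarrow> 'm"

definition Hom :: "('o, 'm) ab_category \<Rightarrow> 'o \<Rightarrow> 'o \<Rightarrow> 'm set"
  where "Hom C A B = {f \<in> Arr C. Dom C f = A \<and> Cod C f = B}"

text \<open>The abelian group structure on a hom-set. Like all groups of HOL-Algebra it is written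
  multiplicatively, so that \<open>x [^] m\<close> is the \<open>m\<close>-fold sum of \<open>x\<close>.\<close>

definition hom_group :: "('o, 'm) ab_category \<Rightarrow> 'o \<Rightarrow> 'o \<Rightarrow> 'm monoid"
  where "hom_group C A B = \<lparr>carrier = Hom C A B, mult = Plus C, one = Zer C A B\<rparr>"

locale preadditive_category =
  fixes C :: "('o, 'm) ab_category" (structure)
  assumes dom_in: "f \<in> Arr C \<Longrightarrow> Dom C f \<in> Ob C"
    and cod_in: "f \<in> Arr C \<Longrightarrow> Cod C f \<in> Ob C"
    and id_in: "A \<in> Ob C \<Longrightarrow> Idt C A \<in> Hom C A A"
    and comp_in: "\<lbrakk>f \<in> Hom C A B; g \<in> Hom C B D\<rbrakk> \<Longrightarrow> g \<bullet> f \<in> Hom C A D"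
    and comp_assoc: "\<lbrakk>f \<in> Hom C A B; g \<in> Hom C B D; h \<in> Hom C D E\<rbrakk>
          \<Longrightarrow> h \<bullet> (g \<bullet> f) = (h \<bullet> g) \<bullet> f"
    and id_left: "f \<in> Hom C A B \<Longrightarrow> Idt C B \<bullet> f = f"
    and id_right: "f \<in> Hom C A B \<Longrightarrow> f \<bullet> Idt C A = f"
    and hom_comm_group: "\<lbrakk>A \<in> Ob C; B \<in> Ob C\<rbrakk> \<Longrightarrow> comm_group (hom_group C A B)"
    and comp_plus_right: "\<lbrakk>f \<in> Hom C A B; f' \<in> Hom C A B; g \<in> Hom C B D\<rbrakk>
          \<Longrightarrow> g \<bullet> Plus C f f' = Plus C (g \<bullet> f) (g \<bullet> f')"
    and comp_plus_left: "\<lbrakk>f \<in> Hom C A B; g \<in> Hom C B D; g' \<in> Hom C B D\<rbrakk>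
          \<Longrightarrow> Plus C g g' \<bullet> f = Plus C (g \<bullet> f) (g' \<bullet> f)"

definition mult_by :: "('o, 'm) ab_category \<Rightarrow> nat \<Rightarrow> 'o \<Rightarrow> 'm"
  where "mult_by C m A = Idt C A [^]\<^bsub>hom_group C A A\<^esub> m"


section \<open>Abelian categories\<close>

definition monic :: "('o, 'm) ab_category \<Rightarrow> 'm \<Rightarrow> bool"
  where "monic C f \<longleftrightarrow> f \<in> Arr C \<and>
    (\<forall>X. \<forall>g \<in> Hom C X (Dom C f). \<forall>h \<in> Hom C X (Dom C f).
       f \<bullet>\<^bsub>C\<^esub> g = f \<bullet>\<^bsub>C\<^esub> h \<longrightarrow> g = h)"

definition epic :: "('o, 'm) ab_category \<Rightarrow> 'm \<Rightarrow> bool"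
  where "epic C f \<longleftrightarrow> f \<in> Arr C \<and>
    (\<forall>X. \<forall>g \<in> Hom C (Cod C f) X. \<forall>h \<in> Hom C (Cod C f) X.
       g \<bullet>\<^bsub>C\<^esub> f = h \<bullet>\<^bsub>C\<^esub> f \<longrightarrow> g = h)"

definition is_zero_object :: "('o, 'm) ab_category \<Rightarrow> 'o \<Rightarrow> bool"
  where "is_zero_object C Z \<longleftrightarrow> Z \<in> Ob C \<and>
    (\<forall>A \<in> Ob C. (\<exists>!f. f \<in> Hom C A Z) \<and> (\<exists>!f. f \<in> Hom C Z A))"

definition is_product :: "('o, 'm) ab_category \<Rightarrow> 'o \<Rightarrow> 'o \<Rightarrow> 'm \<Rightarrow> 'm \<Rightarrow> bool"
  where "is_product C A B p q \<longleftrightarrow> (\<exists>P. p \<in> Hom C P A \<and> q \<in> Hom C P B \<and>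
    (\<forall>X. \<forall>f \<in> Hom C X A. \<forall>g \<in> Hom C X B.
       \<exists>!u. u \<in> Hom C X P \<and> p \<bullet>\<^bsub>C\<^esub> u = f \<and> q \<bullet>\<^bsub>C\<^esub> u = g))"

text \<open>\<open>is_kernel C k f\<close>: the arrow \<open>k\<close> is a kernel of \<open>f\<close>, the kernel object being \<open>Dom C k\<close>;
  dually for cokernels.\<close>

definition is_kernel :: "('o, 'm) ab_category \<Rightarrow> 'm \<Rightarrow> 'm \<Rightarrow> bool"
  where "is_kernel C k f \<longleftrightarrow> f \<in> Arr C \<and> k \<in> Arr C \<and> Cod C k = Dom C f \<and>
    f \<bullet>\<^bsub>C\<^esub> k = Zer C (Dom C k) (Cod C f) \<and>
    (\<forall>X. \<forall>g \<in> Hom C X (Dom C f). f \<bullet>\<^bsub>C\<^esub> g = Zer C X (Cod C f) \<longrightarrow>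
       (\<exists>!u. u \<in> Hom C X (Dom C k) \<and> k \<bullet>\<^bsub>C\<^esub> u = g))"

definition is_cokernel :: "('o, 'm) ab_category \<Rightarrow> 'm \<Rightarrow> 'm \<Rightarrow> bool"
  where "is_cokernel C c f \<longleftrightarrow> f \<in> Arr C \<and> c \<in> Arr C \<and> Dom C c = Cod C f \<and>
    c \<bullet>\<^bsub>C\<^esub> f = Zer C (Dom C f) (Cod C c) \<and>
    (\<forall>X. \<forall>g \<in> Hom C (Cod C f) X. g \<bullet>\<^bsub>C\<^esub> f = Zer C (Dom C f) X \<longrightarrow>
       (\<exists>!u. u \<in> Hom C (Cod C c) X \<and> u \<bullet>\<^bsub>C\<^esub> c = g))"

locale abelian_category = preadditive_category +
  assumes zero_object: "\<exists>Z. is_zero_object C Z"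
    and products: "\<lbrakk>A \<in> Ob C; B \<in> Ob C\<rbrakk> \<Longrightarrow> \<exists>p q. is_product C A B p q"
    and kernels: "f \<in> Arr C \<Longrightarrow> \<exists>k. is_kernel C k f"
    and cokernels: "f \<in> Arr C \<Longrightarrow> \<exists>c. is_cokernel C c f"
    and monic_normal: "\<lbrakk>monic C f; is_cokernel C c f\<rbrakk> \<Longrightarrow> is_kernel C f c"
    and epic_normal: "\<lbrakk>epic C f; is_kernel C k f\<rbrakk> \<Longrightarrow> is_cokernel C f k"

text \<open>Exactness of \<open>A \<rightarrow> B \<rightarrow> D\<close> at \<open>B\<close>: the image of \<open>f\<close>, i.e. the kernel of its cokernel, and the
  kernel of \<open>g\<close> are the same subobject of \<open>B\<close>.\<close>

definition is_image :: "('o, 'm) ab_category \<Rightarrow> 'm \<Rightarrow> 'm \<Rightarrow> bool"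
  where "is_image C k f \<longleftrightarrow> (\<exists>c. is_cokernel C c f \<and> is_kernel C k c)"

definition exact_at :: "('o, 'm) ab_category \<Rightarrow> 'm \<Rightarrow> 'm \<Rightarrow> bool"
  where "exact_at C f g \<longleftrightarrow> (\<exists>k. is_image C k f \<and> is_kernel C k g)"

definition short_exact :: "('o, 'm) ab_category \<Rightarrow> 'm \<Rightarrow> 'm \<Rightarrow> bool"
  where "short_exact C f g \<longleftrightarrow> monic C f \<and> exact_at C f g \<and> epic C g"

definition injective_object :: "('o, 'm) ab_category \<Rightarrow> 'o \<Rightarrow> bool"
  where "injective_object C I \<longleftrightarrow> I \<in> Ob C \<and>
    (\<forall>f g. monic C f \<and> g \<in> Hom C (Dom C f) I \<longrightarrow>
       (\<exists>h \<in> Hom C (Cod C f) I. h \<bullet>\<^bsub>C\<^esub> f = g))"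

definition enough_injectives :: "('o, 'm) ab_category \<Rightarrow> bool"
  where "enough_injectives C \<longleftrightarrow>
    (\<forall>A \<in> Ob C. \<exists>f. monic C f \<and> Dom C f = A \<and> injective_object C (Cod C f))"


section \<open>Injective resolutions\<close>

text \<open>An augmented cochain complex \<open>A \<rightarrow> I\<^sup>0 \<rightarrow> I\<^sup>1 \<rightarrow> \<dots>\<close>\<close>

record ('o, 'm) resolution =
  robj :: "nat \<Rightarrow> 'o"
  rdiff :: "nat \<Rightarrow> 'm"
  raug :: 'm

definition injective_resolution ::
  "('o, 'm) ab_category \<Rightarrow> 'o \<Rightarrow> ('o, 'm) resolution \<Rightarrow> bool"
  where "injective_resolution C A I \<longleftrightarrow>
    (\<forall>n. injective_object C (robj I n)) \<and>
    raug I \<in> Hom C A (robj I 0) \<and>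
    (\<forall>n. rdiff I n \<in> Hom C (robj I n) (robj I (Suc n))) \<and>
    monic C (raug I) \<and>
    exact_at C (raug I) (rdiff I 0) \<and>
    (\<forall>n. exact_at C (rdiff I n) (rdiff I (Suc n)))"

definition is_lift :: "('o, 'm) ab_category \<Rightarrow> ('o, 'm) resolution \<Rightarrow> ('o, 'm) resolution \<Rightarrow>
    'm \<Rightarrow> (nat \<Rightarrow> 'm) \<Rightarrow> bool"
  where "is_lift C I J f \<phi> \<longleftrightarrow>
    (\<forall>n. \<phi> n \<in> Hom C (robj I n) (robj J n)) \<and>
    \<phi> 0 \<bullet>\<^bsub>C\<^esub> raug I = raug J \<bullet>\<^bsub>C\<^esub> f \<and>
    (\<forall>n. \<phi> (Suc n) \<bullet>\<^bsub>C\<^esub> rdiff I n = rdiff J n \<bullet>\<^bsub>C\<^esub> \<phi> n)"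

text \<open>A choice of an injective resolution of every object. The right derived functors below are
  computed with respect to such a choice, on which they depend only up to canonical isomorphism.\<close>

definition resolution_choice ::
  "('o, 'm) ab_category \<Rightarrow> ('o \<Rightarrow> ('o, 'm) resolution) \<Rightarrow> bool"
  where "resolution_choice C R \<longleftrightarrow> (\<forall>A \<in> Ob C. injective_resolution C A (R A))"

context abelian_category
begin

lemma HomI: "f \<in> Arr C \<Longrightarrow> f \<in> Hom C (Dom C f) (Cod C f)"
  by (simp add: Hom_def)

lemma comp_zero:
  assumes "A \<in> Ob C" "g \<in> Hom C B D"
  shows "g \<bullet> Zer C A B = Zer C A D"
proof -
  have B: "B \<in> Ob C" and D: "D \<in> Ob C"
    using assms dom_in cod_in by (auto simp: Hom_def)
  interpret AB: comm_group "hom_group C A B" using hom_comm_group assms(1) B .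
  interpret AD: comm_group "hom_group C A D" using hom_comm_group assms(1) D .
  have z: "Zer C A B \<in> Hom C A B" "Plus C (Zer C A B) (Zer C A B) = Zer C A B"
    using AB.one_closed AB.l_one[OF AB.one_closed] by (simp_all add: hom_group_def)
  have "g \<bullet> Zer C A B \<in> carrier (hom_group C A D)"
    using comp_in[OF z(1) assms(2)] by (simp add: hom_group_def)
  moreover have "(g \<bullet> Zer C A B) \<otimes>\<^bsub>hom_group C A D\<^esub> (g \<bullet> Zer C A B) = g \<bullet> Zer C A B"
    using comp_plus_right[OF z(1) z(1) assms(2)] z(2) by (simp add: hom_group_def)
  ultimately have "g \<bullet> Zer C A B = \<one>\<^bsub>hom_group C A D\<^esub>"
    using AD.l_cancel_one by blast
  then show ?thesis by (simp add: hom_group_def)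
qed

lemma exists_next:
  assumes p: "p \<in> Arr C" and enough: "enough_injectives C"
  shows "\<exists>q \<in> Arr C. Dom C q = Cod C p \<and> injective_object C (Cod C q) \<and> exact_at C p q"
proof -
  obtain c where c: "is_cokernel C c p" using cokernels p by blast
  then have cA: "c \<in> Arr C" and cd: "Dom C c = Cod C p" by (auto simp: is_cokernel_def)
  obtain j where j: "monic C j" "Dom C j = Cod C c" "injective_object C (Cod C j)"
    using enough cod_in[OF cA] by (auto simp: enough_injectives_def)
  have jH: "j \<in> Hom C (Cod C c) (Cod C j)" using j by (auto simp: monic_def Hom_def)
  have cH: "c \<in> Hom C (Cod C p) (Cod C c)" using cA cd by (simp add: Hom_def)
  have q: "j \<bullet> c \<in> Hom C (Cod C p) (Cod C j)" using comp_in[OF cH jH] .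
  obtain k where k: "is_kernel C k c" using kernels cA by blast
  have kH: "k \<in> Hom C (Dom C k) (Cod C p)" using k cd by (auto simp: is_kernel_def Hom_def)
  have zero_iff: "c \<bullet> g = Zer C X (Cod C c) \<longleftrightarrow> j \<bullet> c \<bullet> g = Zer C X (Cod C j)"
    if g: "g \<in> Hom C X (Cod C p)" for g X
  proof -
    have X: "X \<in> Ob C" using g dom_in by (auto simp: Hom_def)
    have z: "Zer C X (Cod C c) \<in> Hom C X (Cod C c)"
      using comm_group.axioms(2)[OF hom_comm_group[OF X cod_in[OF cA]]]
      group.is_monoid monoid.one_closed by (fastforce simp: hom_group_def)
    have "j \<bullet> c \<bullet> g = j \<bullet> (c \<bullet> g)" using comp_assoc[OF g cH jH] by simp
    moreover have "j \<bullet> Zer C X (Cod C c) = Zer C X (Cod C j)" using comp_zero[OF X jH] .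
    ultimately show ?thesis
      using j(1,2) comp_in[OF g cH] z unfolding monic_def by metis
  qed
  have "is_kernel C k (j \<bullet> c)"
    using k q cd zero_iff[OF kH] zero_iff unfolding is_kernel_def by (auto simp: Hom_def)
  then show ?thesis
    using c k q j(3) unfolding exact_at_def is_image_def Hom_def
    by (intro bexI[of _ "j \<bullet> c"]) auto
qed

lemma injective_resolution_exists:
  assumes A: "A \<in> Ob C" and enough: "enough_injectives C"
  shows "\<exists>I. injective_resolution C A I"
proof -
  obtain e where e: "monic C e" "Dom C e = A" "injective_object C (Cod C e)"
    using enough A by (auto simp: enough_injectives_def)
  let ?P = "\<lambda>n p. p \<in> Arr C \<and> injective_object C (Cod C p) \<and> (n = (0::nat) \<longrightarrow> p = e)"
  let ?Q = "\<lambda>n::nat. \<lambda>p q. Dom C q = Cod C p \<and> exact_at C p q"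
  have 1: "\<exists>p. ?P 0 p" using e by (auto simp: monic_def)
  have 2: "\<exists>q. ?P (Suc n) q \<and> ?Q n p q" if "?P n p" for n p
    using exists_next[of p] that enough by auto
  have "\<exists>p. \<forall>n. ?P n (p n) \<and> ?Q n (p n) (p (Suc n))"
    using dependent_nat_choice[of ?P ?Q, OF 1 2] by simp
  then obtain p where p: "\<And>n. ?P n (p n)" "\<And>n. ?Q n (p n) (p (Suc n))"
    by blast
  have "injective_resolution C A
      \<lparr>robj = (\<lambda>n. Cod C (p n)), rdiff = (\<lambda>n. p (Suc n)), raug = p 0\<rparr>"
    using p p(1)[of 0] p(2)[of 0] e by (auto simp: injective_resolution_def Hom_def)
  then show ?thesis ..
qed

lemma resolution_choice_exists: "enough_injectives C \<Longrightarrow> \<exists>R. resolution_choice C R"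
  unfolding resolution_choice_def using injective_resolution_exists by (intro bchoice) blast

end


section \<open>Left exact functors to abelian groups\<close>

text \<open>Objects are sent to HOL-Algebra groups (over a common type \<open>'g\<close>), arrows to maps that matter
  only on the carriers.\<close>

record ('o, 'm, 'g) ab_functor =
  Fob :: "'o \<Rightarrow> 'g monoid"
  Fmap :: "'m \<Rightarrow> 'g \<Rightarrow> 'g"

text \<open>As usual for functors between abelian categories, additivity is part of the definition; it
  is in fact a consequence of \<open>left_exact\<close>.\<close>

locale left_exact_functor = abelian_category C
  for C :: "('o, 'm) ab_category" (structure) +
  fixes F :: "('o, 'm, 'g) ab_functor"
  assumes Fob_comm_group: "A \<in> Ob C \<Longrightarrow> comm_group (Fob F A)"
    and Fmap_hom: "f \<in> Hom C A B \<Longrightarrow> Fmap F f \<in> hom (Fob F A) (Fob F B)"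
    and Fmap_id: "\<lbrakk>A \<in> Ob C; x \<in> carrier (Fob F A)\<rbrakk> \<Longrightarrow> Fmap F (Idt C A) x = x"
    and Fmap_comp: "\<lbrakk>f \<in> Hom C A B; g \<in> Hom C B D; x \<in> carrier (Fob F A)\<rbrakk>
          \<Longrightarrow> Fmap F (g \<bullet> f) x = Fmap F g (Fmap F f x)"
    and Fmap_plus: "\<lbrakk>f \<in> Hom C A B; g \<in> Hom C A B; x \<in> carrier (Fob F A)\<rbrakk>
          \<Longrightarrow> Fmap F (Plus C f g) x = Fmap F f x \<otimes>\<^bsub>Fob F B\<^esub> Fmap F g x"
    and left_exact: "\<lbrakk>f \<in> Hom C A B; g \<in> Hom C B D; short_exact C f g\<rbrakk>
          \<Longrightarrow> inj_on (Fmap F f) (carrier (Fob F A)) \<and>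
              Fmap F f ` carrier (Fob F A) = kernel (Fob F B) (Fob F D) (Fmap F g)"


section \<open>Cohomology of cochain complexes of abelian groups\<close>

record 'g cochain =
  grp :: "nat \<Rightarrow> 'g monoid"
  dif :: "nat \<Rightarrow> 'g \<Rightarrow> 'g"

definition cocycles :: "'g cochain \<Rightarrow> nat \<Rightarrow> 'g set"
  where "cocycles K n = kernel (grp K n) (grp K (Suc n)) (dif K n)"

definition coboundaries :: "'g cochain \<Rightarrow> nat \<Rightarrow> 'g set"
  where "coboundaries K n =
    (case n of 0 \<Rightarrow> {\<one>\<^bsub>grp K 0\<^esub>} | Suc k \<Rightarrow> dif K k ` carrier (grp K k))"

definition cohomology :: "'g cochain \<Rightarrow> nat \<Rightarrow> 'g set monoid"
  where "cohomology K n = (grp K n)\<lparr>carrier := cocycles K n\<rparr> Mod coboundaries K n"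

definition coh_class :: "'g cochain \<Rightarrow> nat \<Rightarrow> 'g \<Rightarrow> 'g set"
  where "coh_class K n x = coboundaries K n #>\<^bsub>grp K n\<^esub> x"

text \<open>Elements of \<open>cohomology K n\<close> are cosets \<open>c\<close>; maps out of it are given on representatives.\<close>

definition coh_map :: "'g cochain \<Rightarrow> (nat \<Rightarrow> 'g \<Rightarrow> 'g) \<Rightarrow> nat \<Rightarrow> 'g set \<Rightarrow> 'g set"
  where "coh_map L \<phi> n c = the_elem ((\<lambda>x. coh_class L n (\<phi> n x)) ` c)"

text \<open>The connecting map \<open>H\<^sup>n(M) \<rightarrow> H\<^sup>n\<^sup>+\<^sup>1(K)\<close> of a short exact sequence \<open>0 \<rightarrow> K \<rightarrow> L \<rightarrow> M \<rightarrow> 0\<close> with maps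
  \<open>u\<close> and \<open>v\<close>: a cocycle \<open>z = v y\<close> goes to the class of the \<open>x\<close> with \<open>u x = d y\<close>.\<close>

definition snake :: "'g cochain \<Rightarrow> 'g cochain \<Rightarrow> (nat \<Rightarrow> 'g \<Rightarrow> 'g) \<Rightarrow> (nat \<Rightarrow> 'g \<Rightarrow> 'g) \<Rightarrow>
    nat \<Rightarrow> 'g set \<Rightarrow> 'g set"
  where "snake K L u v n c = the_elem {coh_class K (Suc n) x | x y.
    y \<in> carrier (grp L n) \<and> v n y \<in> c \<and>
    x \<in> carrier (grp K (Suc n)) \<and> u (Suc n) x = dif L n y}"


section \<open>Right derived functors\<close>

definition apply_functor ::
  "('o, 'm, 'g) ab_functor \<Rightarrow> ('o, 'm) resolution \<Rightarrow> 'g cochain"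
  where "apply_functor F I =
    \<lparr>grp = (\<lambda>n. Fob F (robj I n)), dif = (\<lambda>n. Fmap F (rdiff I n))\<rparr>"

definition derived_ob :: "('o \<Rightarrow> ('o, 'm) resolution) \<Rightarrow> ('o, 'm, 'g) ab_functor \<Rightarrow>
    nat \<Rightarrow> 'o \<Rightarrow> 'g set monoid"
  where "derived_ob R F i A = cohomology (apply_functor F (R A)) i"

text \<open>The choice of the lift does not matter, any two being homotopic.\<close>

definition derived_map :: "('o, 'm) ab_category \<Rightarrow> ('o \<Rightarrow> ('o, 'm) resolution) \<Rightarrow>
    ('o, 'm, 'g) ab_functor \<Rightarrow> nat \<Rightarrow> 'm \<Rightarrow> 'g set \<Rightarrow> 'g set"
  where "derived_map C R F i f =
    (let \<phi> = (SOME \<phi>. is_lift C (R (Dom C f)) (R (Cod C f)) f \<phi>)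
     in coh_map (apply_functor F (R (Cod C f))) (\<lambda>n. Fmap F (\<phi> n)) i)"

text \<open>An exact sequence \<open>0 \<rightarrow> A \<rightarrow> B \<rightarrow> D \<rightarrow> 0\<close> with maps \<open>f\<close>, \<open>g\<close> is lifted to a degreewise exact sequence
  \<open>0 \<rightarrow> R A \<rightarrow> J \<rightarrow> R D \<rightarrow> 0\<close> with the chosen resolutions at both ends and some injective resolution
  \<open>J\<close> of \<open>B\<close> in the middle (horseshoe lemma).\<close>

definition is_resolution_ses :: "('o, 'm) ab_category \<Rightarrow> ('o \<Rightarrow> ('o, 'm) resolution) \<Rightarrow>
    'm \<Rightarrow> 'm \<Rightarrow> ('o, 'm) resolution \<Rightarrow> (nat \<Rightarrow> 'm) \<Rightarrow> (nat \<Rightarrow> 'm) \<Rightarrow> bool"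
  where "is_resolution_ses C R f g J u v \<longleftrightarrow>
    injective_resolution C (Cod C f) J \<and>
    is_lift C (R (Dom C f)) J f u \<and>
    is_lift C J (R (Cod C g)) g v \<and>
    (\<forall>n. short_exact C (u n) (v n))"

text \<open>The connecting homomorphism \<open>R\<^sup>nF(D) \<rightarrow> R\<^sup>n\<^sup>+\<^sup>1F(A)\<close> of the long exact sequence. It does not depend
  on the choice of \<open>J\<close>, \<open>u\<close>, \<open>v\<close>.\<close>

definition connecting :: "('o, 'm) ab_category \<Rightarrow> ('o \<Rightarrow> ('o, 'm) resolution) \<Rightarrow>
    ('o, 'm, 'g) ab_functor \<Rightarrow> 'm \<Rightarrow> 'm \<Rightarrow> nat \<Rightarrow> 'g set \<Rightarrow> 'g set"
  where "connecting C R F f g n =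
    (let (J, u, v) = (SOME (J, u, v). is_resolution_ses C R f g J u v)
     in snake (apply_functor F (R (Dom C f))) (apply_functor F J)
          (\<lambda>k. Fmap F (u k)) (\<lambda>k. Fmap F (v k)) n)"


section \<open>Split short exact sequences of abelian groups and the Kummer sequence\<close>

definition torsion :: "'g monoid \<Rightarrow> nat \<Rightarrow> 'g monoid"
  where "torsion G m = G\<lparr>carrier := kernel G G (\<lambda>x. x [^]\<^bsub>G\<^esub> m)\<rparr>"

definition quot_by :: "'g monoid \<Rightarrow> nat \<Rightarrow> 'g set monoid"
  where "quot_by G m = G Mod ((\<lambda>x. x [^]\<^bsub>G\<^esub> m) ` carrier G)"

text \<open>The groups may live over different types here, which the exact sequences of HOL-Algebra do
  not allow.\<close>

definition short_exact_groups ::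
  "'a monoid \<Rightarrow> 'b monoid \<Rightarrow> 'c monoid \<Rightarrow> ('a \<Rightarrow> 'b) \<Rightarrow> ('b \<Rightarrow> 'c) \<Rightarrow> bool"
  where "short_exact_groups A B D \<alpha> \<beta> \<longleftrightarrow>
    comm_group A \<and> comm_group B \<and> comm_group D \<and> \<alpha> \<in> hom A B \<and> \<beta> \<in> hom B D \<and>
    inj_on \<alpha> (carrier A) \<and> \<alpha> ` carrier A = kernel B D \<beta> \<and> \<beta> ` carrier B = carrier D"

definition split_short_exact_groups ::
  "'a monoid \<Rightarrow> 'b monoid \<Rightarrow> 'c monoid \<Rightarrow> ('a \<Rightarrow> 'b) \<Rightarrow> ('b \<Rightarrow> 'c) \<Rightarrow> bool"
  where "split_short_exact_groups A B D \<alpha> \<beta> \<longleftrightarrow>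
    short_exact_groups A B D \<alpha> \<beta> \<and> (\<exists>\<sigma> \<in> hom D B. \<forall>y \<in> carrier D. \<beta> (\<sigma> y) = y)"

text \<open>For a kernel \<open>\<iota> : N[m] \<rightarrow> N\<close> of \<open>[m]\<close>: the map \<open>R\<^sup>nF(N)/m \<rightarrow> R\<^sup>n\<^sup>+\<^sup>1F(N[m])\<close> induced on cosets by the
  connecting homomorphism of \<open>0 \<rightarrow> N[m] \<rightarrow> N \<rightarrow> N \<rightarrow> 0\<close>.\<close>

definition kummer_left :: "('o, 'm) ab_category \<Rightarrow> ('o \<Rightarrow> ('o, 'm) resolution) \<Rightarrow>
    ('o, 'm, 'g) ab_functor \<Rightarrow> nat \<Rightarrow> 'm \<Rightarrow> nat \<Rightarrow> 'g set set \<Rightarrow> 'g set"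
  where "kummer_left C R F m \<iota> n c =
    the_elem (connecting C R F \<iota> (mult_by C m (Cod C \<iota>)) n ` c)"

end

theory Submission
  imports Defs "HOL-Algebra.Free_Abelian_Groups" Complex_Main
begin

text \<open>The idea is that \<open>RF(N[m])\<close> is the fibre of multiplication by \<open>m\<close> on the complex \<open>RF(N)\<close>, and that the
  sequence splits for every complex \<open>M\<close> of abelian groups in place of \<open>RF(N)\<close>, because abelian groups have
  injective dimension one. The splitting is obtained in an elementary way, as a retraction of
  \<open>H\<^sup>n(M)/m \<rightarrow> H\<^sup>n\<^sup>+\<^sup>1(K)\<close> for the fibre \<open>K\<close>. A class in \<open>H\<^sup>n\<^sup>+\<^sup>1(K)\<close> is given by a pair of \<open>z \<in> M\<^sup>n\<^sup>+\<^sup>1\<close> and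
  \<open>y \<in> M\<^sup>n\<close> with \<open>m z = d y\<close>. Embed \<open>H\<^sup>n(M)\<close> into a divisible group \<open>E\<close>. Divisible groups are injective
  and their quotients are divisible, so that the projection of the cocycles to \<open>H\<^sup>n(M)\<close> extends to
  \<open>g : M\<^sup>n \<rightarrow> E\<close>, and then the induced map on coboundaries extends to \<open>h : M\<^sup>n\<^sup>+\<^sup>1 \<rightarrow> E / H\<^sup>n(M)\<close>. For a lift \<open>e\<close>
  of \<open>h z\<close> to \<open>E\<close>, the element \<open>m e - g y\<close> lies in \<open>H\<^sup>n(M)\<close> and is well defined modulo \<open>m H\<^sup>n(M)\<close>;
  up to sign this is the retraction (\<open>hereditary_retraction\<close>).

  To apply this, the derived functors are computed with a horseshoe \<open>0 \<rightarrow> R(N[m]) \<rightarrow> J \<rightarrow> R(N) \<rightarrow> 0\<close> over the exact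
  sequence \<open>0 \<rightarrow> N[m] \<rightarrow> N \<rightarrow> N \<rightarrow> 0\<close>. As \<open>J\<close> and \<open>R(N)\<close> both resolve \<open>N\<close>, there is a homotopy equivalence
  \<open>w : J \<rightarrow> R(N)\<close>, and the right hand map \<open>v\<close> of the horseshoe is homotopic to \<open>m w\<close>, both being lifts of
  multiplication by \<open>m\<close>. The homotopy turns a cocycle of \<open>F(R(N[m]))\<close> into a pair as above, and
  \<open>w\<close> turns the long exact sequence into the asserted one (\<open>kummer_split_complexes\<close>). What this
  needs from homological algebra are lifts between resolutions, homotopies between them, and the horseshoe lemma
  (\<open>lift_exists\<close>, \<open>lift_homotopy\<close>, \<open>horseshoe\<close>). They are proved without elements by testing exactness
  with arrows into injective objects.\<close>

section \<open>Divisible abelian groups\<close>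

definition divisible :: "('a, 'b) monoid_scheme \<Rightarrow> bool"
  where "divisible D \<longleftrightarrow> comm_group D \<and>
    (\<forall>x \<in> carrier D. \<forall>n::nat. n > 0 \<longrightarrow> (\<exists>y \<in> carrier D. y [^]\<^bsub>D\<^esub> n = x))"

lemma (in group) subgroup_int_powers:
  assumes "a \<in> carrier G"
  shows "subgroup (range (\<lambda>k::int. a [^] k)) G"
proof
  show "range (\<lambda>k::int. a [^] k) \<subseteq> carrier G" using assms by auto
  show "x \<otimes> y \<in> range (\<lambda>k::int. a [^] k)"
    if "x \<in> range (\<lambda>k::int. a [^] k)" "y \<in> range (\<lambda>k::int. a [^] k)" for x y
    using that assms by (auto simp flip: int_pow_mult)
  show "\<one> \<in> range (\<lambda>k::int. a [^] k)" by (rule range_eqI[of _ _ 0]) simp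
  show "inv x \<in> range (\<lambda>k::int. a [^] k)" if "x \<in> range (\<lambda>k::int. a [^] k)" for x
    using that assms by (auto simp flip: int_pow_neg)
qed

lemma (in group) subgroup_Union_chain:
  assumes "\<C> \<noteq> {}" "subset.chain {H. subgroup H G} \<C>"
  shows "subgroup (\<Union>\<C>) G"
proof
  have sub: "subgroup H G" if "H \<in> \<C>" for H using that assms(2) by (auto simp: subset_chain_def)
  show "\<Union>\<C> \<subseteq> carrier G" using sub subgroup.subset by blast
  show "x \<otimes> y \<in> \<Union>\<C>" if xy: "x \<in> \<Union>\<C>" "y \<in> \<Union>\<C>" for x y
  proof -
    obtain H K where HK: "H \<in> \<C>" "K \<in> \<C>" "x \<in> H" "y \<in> K" using xy by blast
    then have "H \<subseteq> K \<or> K \<subseteq> H" using assms(2) by (auto simp: subset_chain_def)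
    then obtain L where "L \<in> \<C>" "x \<in> L" "y \<in> L" using HK by blast
    then show ?thesis using subgroup.m_closed[OF sub] by blast
  qed
  show "\<one> \<in> \<Union>\<C>" using assms(1) subgroup.one_closed[OF sub] by blast
  show "inv x \<in> \<Union>\<C>" if "x \<in> \<Union>\<C>" for x using that subgroup.m_inv_closed[OF sub] by blast
qed

lemma int_pow_DirProd:
  assumes "group G" "group H" "a \<in> carrier G" "b \<in> carrier H"
  shows "(a, b) [^]\<^bsub>G \<times>\<times> H\<^esub> (k::int) = (a [^]\<^bsub>G\<^esub> k, b [^]\<^bsub>H\<^esub> k)"
proof -
  have GH: "group (G \<times>\<times> H)" using assms DirProd_group by blast
  have "fst \<in> hom (G \<times>\<times> H) G" "snd \<in> hom (G \<times>\<times> H) H" by (auto simp: hom_def)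
  then have "fst ((a, b) [^]\<^bsub>G \<times>\<times> H\<^esub> k) = a [^]\<^bsub>G\<^esub> k" "snd ((a, b) [^]\<^bsub>G \<times>\<times> H\<^esub> k) = b [^]\<^bsub>H\<^esub> k"
    using hom_int_pow[of fst "G \<times>\<times> H" G "(a, b)" k] hom_int_pow[of snd "G \<times>\<times> H" H "(a, b)" k] GH assms
    by auto
  then show ?thesis by (metis prod.collapse)
qed

text \<open>Partial homomorphisms \<open>Q \<rightarrow> D\<close> are handled through their graphs, the subgroups of \<open>Q \<times>\<times> D\<close> that
  meet \<open>1 \<times> D\<close> trivially; extending a homomorphism then is enlarging a set.\<close>

lemma functional_subgroup_unique:
  assumes "group Q" "group D" and \<Gamma>: "subgroup \<Gamma> (Q \<times>\<times> D)"
    and fun\<Gamma>: "\<And>e. (\<one>\<^bsub>Q\<^esub>, e) \<in> \<Gamma> \<Longrightarrow> e = \<one>\<^bsub>D\<^esub>"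
    and "(x, c) \<in> \<Gamma>" "(x, c') \<in> \<Gamma>"
  shows "c = c'"
proof -
  interpret Q: group Q by fact
  interpret D: group D by fact
  interpret S: subgroup \<Gamma> "Q \<times>\<times> D" by fact
  have carr: "x \<in> carrier Q" "c \<in> carrier D" "c' \<in> carrier D"
    using assms(5,6) S.subset by auto
  have "(x, c) \<otimes>\<^bsub>Q \<times>\<times> D\<^esub> inv\<^bsub>Q \<times>\<times> D\<^esub> (x, c') \<in> \<Gamma>" using assms(5,6) by blast
  then have "(\<one>\<^bsub>Q\<^esub>, c \<otimes>\<^bsub>D\<^esub> inv\<^bsub>D\<^esub> c') \<in> \<Gamma>"
    using carr by (simp add: Q.group_axioms D.group_axioms)
  then show ?thesis using fun\<Gamma> carr by (metis D.inv_solve_right' D.l_one D.one_closed)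
qed

text \<open>The one step where divisibility enters: a new argument \<open>b\<close> can be given a value. If no
  \<open>b\<^sup>k\<close> with \<open>k \<noteq> 0\<close> lies in the domain, any value will do. Otherwise the exponents \<open>k\<close> with
  \<open>b\<^sup>k\<close> in the domain are the multiples of the least positive one, \<open>n\<close>, and the value has to be an
  \<open>n\<close>-th root of the value prescribed at \<open>b\<^sup>n\<close>.\<close>

lemma divisible_graph_value:
  assumes Q: "comm_group Q" and D: "divisible D"
    and \<Gamma>: "subgroup \<Gamma> (Q \<times>\<times> D)" and b: "b \<in> carrier Q"
    and fun\<Gamma>: "\<And>e. (\<one>\<^bsub>Q\<^esub>, e) \<in> \<Gamma> \<Longrightarrow> e = \<one>\<^bsub>D\<^esub>"
  obtains e where "e \<in> carrier D"
    "\<And>(k::int) c. (b [^]\<^bsub>Q\<^esub> k, c) \<in> \<Gamma> \<Longrightarrow> c = e [^]\<^bsub>D\<^esub> k"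
proof -
  interpret Q: comm_group Q by fact
  interpret D: comm_group D using D by (simp add: divisible_def)
  interpret X: group "Q \<times>\<times> D" by (intro DirProd_group Q.group_axioms D.group_axioms)
  interpret S: subgroup \<Gamma> "Q \<times>\<times> D" by fact
  have carr: "x \<in> carrier Q \<and> y \<in> carrier D" if "(x, y) \<in> \<Gamma>" for x y
    using that S.subset by auto
  have unique: "c = c'" if "(x, c) \<in> \<Gamma>" "(x, c') \<in> \<Gamma>" for x c c'
    by (rule functional_subgroup_unique[OF Q.group_axioms D.group_axioms \<Gamma> _ that]) (rule fun\<Gamma>)
  have pow: "(b [^]\<^bsub>Q\<^esub> (k * l), c [^]\<^bsub>D\<^esub> l) \<in> \<Gamma>" if "(b [^]\<^bsub>Q\<^esub> k, c) \<in> \<Gamma>" for k l :: int and c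
  proof -
    have "(b [^]\<^bsub>Q\<^esub> k, c) [^]\<^bsub>Q \<times>\<times> D\<^esub> l \<in> \<Gamma>"
      using that X.int_pow_consistent[OF S.subgroup_axioms that] 
        group.int_pow_closed[OF S.subgroup_is_group[OF X.group_axioms]] by simp
    then show ?thesis using carr[OF that] b
      by (simp add: int_pow_DirProd Q.group_axioms D.group_axioms Q.int_pow_pow)
  qed
  show thesis
  proof (cases "\<exists>n>0. \<exists>c. (b [^]\<^bsub>Q\<^esub> int n, c) \<in> \<Gamma>")
    case True
    define n where "n = (LEAST n. 0 < n \<and> (\<exists>c. (b [^]\<^bsub>Q\<^esub> int n, c) \<in> \<Gamma>))"
    have n: "0 < n" "\<exists>c. (b [^]\<^bsub>Q\<^esub> int n, c) \<in> \<Gamma>"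
      using LeastI_ex[of "\<lambda>n. 0 < n \<and> (\<exists>c. (b [^]\<^bsub>Q\<^esub> int n, c) \<in> \<Gamma>)"] True unfolding n_def by blast+
    have least: "n \<le> j" if "0 < j" "(b [^]\<^bsub>Q\<^esub> int j, c) \<in> \<Gamma>" for j c
      unfolding n_def using that by (intro Least_le) blast
    obtain c where c: "(b [^]\<^bsub>Q\<^esub> int n, c) \<in> \<Gamma>" using n by blast
    obtain e where e: "e \<in> carrier D" "e [^]\<^bsub>D\<^esub> n = c"
      using D carr[OF c] n(1) unfolding divisible_def by blast
    show thesis
    proof (rule that[OF e(1)])
      fix k :: int and c' assume k: "(b [^]\<^bsub>Q\<^esub> k, c') \<in> \<Gamma>"
      define r l where "r = k mod int n" and "l = k div int n"
      have kl: "k = int n * l + r" by (simp add: r_def l_def)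
      have "(b [^]\<^bsub>Q\<^esub> k, c') \<otimes>\<^bsub>Q \<times>\<times> D\<^esub> inv\<^bsub>Q \<times>\<times> D\<^esub> (b [^]\<^bsub>Q\<^esub> (int n * l), c [^]\<^bsub>D\<^esub> l) \<in> \<Gamma>"
        using k pow[OF c] by blast
      then have "(b [^]\<^bsub>Q\<^esub> r, c' \<otimes>\<^bsub>D\<^esub> inv\<^bsub>D\<^esub> (c [^]\<^bsub>D\<^esub> l)) \<in> \<Gamma>"
        using carr[OF k] carr[OF c] b
        by (simp add: inv_DirProd Q.group_axioms D.group_axioms kl flip: Q.int_pow_diff)
      moreover have "0 \<le> r" "r < int n" using n(1) by (auto simp: r_def)
      ultimately have "r = 0" using least[of "nat r"] by fastforce
      then have "(b [^]\<^bsub>Q\<^esub> k, c [^]\<^bsub>D\<^esub> l) \<in> \<Gamma>" using pow[OF c] kl by simp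
      then have "c' = c [^]\<^bsub>D\<^esub> l" using unique k by blast
      also have "\<dots> = e [^]\<^bsub>D\<^esub> k"
        using e kl \<open>r = 0\<close> by (auto simp: D.int_pow_pow int_pow_int simp flip: int_pow_int)
      finally show "c' = e [^]\<^bsub>D\<^esub> k" .
    qed
  next
    case False
    show thesis
    proof (rule that[OF D.one_closed])
      fix k :: int and c assume k: "(b [^]\<^bsub>Q\<^esub> k, c) \<in> \<Gamma>"
      have "k * sgn k = int (nat \<bar>k\<bar>)" by (simp only: int_nat_eq abs_ge_zero if_True flip: abs_sgn)
      then have k': "(b [^]\<^bsub>Q\<^esub> int (nat \<bar>k\<bar>), c [^]\<^bsub>D\<^esub> sgn k) \<in> \<Gamma>"
        using pow[OF k, of "sgn k"] by (simp only:)
      have "k = 0"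
      proof (rule ccontr)
        assume "k \<noteq> 0"
        then have "0 < nat \<bar>k\<bar>" by simp
        then have "\<exists>n>0. \<exists>c. (b [^]\<^bsub>Q\<^esub> int n, c) \<in> \<Gamma>"
          using k' by (intro exI conjI)
        with False show False by (rule notE)
      qed
      have "c = \<one>\<^bsub>D\<^esub>"
        by (rule fun\<Gamma>) (use k \<open>k = 0\<close> in \<open>simp only: int_pow_0\<close>)
      then show "c = \<one>\<^bsub>D\<^esub> [^]\<^bsub>D\<^esub> k" by (simp only: D.int_pow_one)
    qed
  qed
qed

text \<open>Baer's criterion. By Zorn's lemma the graph of \<open>d x \<mapsto> g x\<close> lies in a maximal functional
  subgroup \<open>\<Gamma>\<close>, and a maximal one is defined everywhere, since otherwise the preceding lemma provides
  a proper enlargement. Stating it for an arbitrary \<open>d\<close> instead of a subgroup inclusion also covers maps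
  defined on an image \<open>d P\<close>.\<close>

lemma divisible_extension:
  assumes P: "group P" and Q: "comm_group Q" and D: "divisible D"
    and d: "d \<in> hom P Q" and g: "g \<in> hom P D"
    and ker: "\<And>x. x \<in> carrier P \<Longrightarrow> d x = \<one>\<^bsub>Q\<^esub> \<Longrightarrow> g x = \<one>\<^bsub>D\<^esub>"
  obtains h where "h \<in> hom Q D" "\<And>x. x \<in> carrier P \<Longrightarrow> h (d x) = g x"
proof -
  interpret Q: comm_group Q by fact
  interpret D: comm_group D using D by (simp add: divisible_def)
  interpret X: group "Q \<times>\<times> D" by (intro DirProd_group Q.group_axioms D.group_axioms)
  interpret X: comm_group "Q \<times>\<times> D"
    by (intro X.group_comm_groupI) (auto simp: Q.m_comm D.m_comm)
  define \<Gamma>\<^sub>0 where "\<Gamma>\<^sub>0 = (\<lambda>x. (d x, g x)) ` carrier P"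
  define \<G> where "\<G> = {\<Gamma>. subgroup \<Gamma> (Q \<times>\<times> D) \<and> (\<forall>e. (\<one>\<^bsub>Q\<^esub>, e) \<in> \<Gamma> \<longrightarrow> e = \<one>\<^bsub>D\<^esub>) \<and> \<Gamma>\<^sub>0 \<subseteq> \<Gamma>}"
  have "(\<lambda>x. (d x, g x)) \<in> hom P (Q \<times>\<times> D)" using d g by (simp add: hom_paired)
  then have "subgroup \<Gamma>\<^sub>0 (Q \<times>\<times> D)"
    unfolding \<Gamma>\<^sub>0_def using P X.group_axioms
    by (intro group_hom.img_is_subgroup) (auto simp: group_hom_def group_hom_axioms_def)
  then have "\<Gamma>\<^sub>0 \<in> \<G>" using ker unfolding \<G>_def \<Gamma>\<^sub>0_def by auto
  have "\<exists>\<Gamma>\<in>\<G>. \<forall>\<Delta>\<in>\<G>. \<Gamma> \<subseteq> \<Delta> \<longrightarrow> \<Delta> = \<Gamma>"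
  proof (rule subset_Zorn_nonempty)
    show "\<G> \<noteq> {}" using \<open>\<Gamma>\<^sub>0 \<in> \<G>\<close> by blast
    fix \<C> assume \<C>: "\<C> \<noteq> {}" "subset.chain \<G> \<C>"
    then have "subset.chain {H. subgroup H (Q \<times>\<times> D)} \<C>"
      by (auto simp: subset_chain_def \<G>_def)
    then have "subgroup (\<Union>\<C>) (Q \<times>\<times> D)" using X.subgroup_Union_chain \<C>(1) by blast
    then show "\<Union>\<C> \<in> \<G>" using \<C> unfolding \<G>_def subset_chain_def by blast
  qed
  then obtain \<Gamma> where \<Gamma>: "\<Gamma> \<in> \<G>" and max: "\<And>\<Delta>. \<Delta> \<in> \<G> \<Longrightarrow> \<Gamma> \<subseteq> \<Delta> \<Longrightarrow> \<Delta> = \<Gamma>" by blast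
  have \<Gamma>s: "subgroup \<Gamma> (Q \<times>\<times> D)" and fun\<Gamma>: "\<And>e. (\<one>\<^bsub>Q\<^esub>, e) \<in> \<Gamma> \<Longrightarrow> e = \<one>\<^bsub>D\<^esub>" and "\<Gamma>\<^sub>0 \<subseteq> \<Gamma>"
    using \<Gamma> by (auto simp: \<G>_def)
  interpret S: subgroup \<Gamma> "Q \<times>\<times> D" by fact
  have carr: "x \<in> carrier Q \<and> y \<in> carrier D" if "(x, y) \<in> \<Gamma>" for x y
    using that S.subset by auto
  have total: "\<exists>e. (b, e) \<in> \<Gamma>" if b: "b \<in> carrier Q" for b
  proof -
    obtain e where e: "e \<in> carrier D" "\<And>(k::int) c. (b [^]\<^bsub>Q\<^esub> k, c) \<in> \<Gamma> \<Longrightarrow> c = e [^]\<^bsub>D\<^esub> k"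
      using divisible_graph_value[OF Q D \<Gamma>s b fun\<Gamma>] by metis
    let ?Z = "range (\<lambda>k::int. (b, e) [^]\<^bsub>Q \<times>\<times> D\<^esub> k)"
    have Z: "?Z = range (\<lambda>k::int. (b [^]\<^bsub>Q\<^esub> k, e [^]\<^bsub>D\<^esub> k))"
      using b e(1) by (simp add: int_pow_DirProd Q.group_axioms D.group_axioms)
    have Zs: "subgroup ?Z (Q \<times>\<times> D)" using b e(1) by (intro X.subgroup_int_powers) simp
    let ?\<Delta> = "\<Gamma> <#>\<^bsub>Q \<times>\<times> D\<^esub> ?Z"
    have "subgroup ?\<Delta> (Q \<times>\<times> D)" using X.mult_subgroups[OF \<Gamma>s Zs] .
    moreover have "f = \<one>\<^bsub>D\<^esub>" if f: "(\<one>\<^bsub>Q\<^esub>, f) \<in> ?\<Delta>" for f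
    proof -
      obtain s t and k :: int where st: "(s, t) \<in> \<Gamma>"
        "\<one>\<^bsub>Q\<^esub> = s \<otimes>\<^bsub>Q\<^esub> b [^]\<^bsub>Q\<^esub> k" "f = t \<otimes>\<^bsub>D\<^esub> e [^]\<^bsub>D\<^esub> k"
        using f unfolding Z set_mult_def by (auto simp: mult_DirProd)
      have "inv\<^bsub>Q \<times>\<times> D\<^esub> (s, t) \<in> \<Gamma>" using st(1) by blast
      then have "(inv\<^bsub>Q\<^esub> s, inv\<^bsub>D\<^esub> t) \<in> \<Gamma>"
        using carr[OF st(1)] by (simp add: inv_DirProd Q.group_axioms D.group_axioms)
      moreover have "inv\<^bsub>Q\<^esub> s = b [^]\<^bsub>Q\<^esub> k"
        using st(2) carr[OF st(1)] b by (metis Q.int_pow_closed Q.inv_equality Q.inv_inv Q.m_comm)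
      ultimately have "inv\<^bsub>D\<^esub> t = e [^]\<^bsub>D\<^esub> k" using e(2) by simp
      then show ?thesis using st(3) carr[OF st(1)] by (metis D.r_inv)
    qed
    moreover have "\<Gamma> \<subseteq> ?\<Delta>"
    proof
      fix x assume x: "x \<in> \<Gamma>"
      have "\<one>\<^bsub>Q \<times>\<times> D\<^esub> \<in> ?Z" using subgroup.one_closed[OF Zs] .
      then have "x \<otimes>\<^bsub>Q \<times>\<times> D\<^esub> \<one>\<^bsub>Q \<times>\<times> D\<^esub> \<in> ?\<Delta>" using x unfolding set_mult_def by blast
      then show "x \<in> ?\<Delta>" using x S.mem_carrier X.r_one by metis
    qed
    ultimately have "?\<Delta> = \<Gamma>" using max \<open>\<Gamma>\<^sub>0 \<subseteq> \<Gamma>\<close> unfolding \<G>_def by blast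
    moreover have "(b, e) \<in> ?\<Delta>"
    proof -
      have "(b, e) \<in> ?Z" by (rule range_eqI[of _ _ 1]) (use b e in simp)
      then have "\<one>\<^bsub>Q \<times>\<times> D\<^esub> \<otimes>\<^bsub>Q \<times>\<times> D\<^esub> (b, e) \<in> ?\<Delta>" using S.one_closed unfolding set_mult_def by blast
      then show ?thesis using b e by simp
    qed
    ultimately show ?thesis by blast
  qed
  have unique: "c = c'" if "(x, c) \<in> \<Gamma>" "(x, c') \<in> \<Gamma>" for x c c'
    by (rule functional_subgroup_unique[OF Q.group_axioms D.group_axioms \<Gamma>s _ that]) (rule fun\<Gamma>)
  define h where "h b = (SOME e. (b, e) \<in> \<Gamma>)" for b
  have h: "(b, h b) \<in> \<Gamma>" if "b \<in> carrier Q" for b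
    unfolding h_def using total[OF that] by (rule someI_ex)
  show thesis
  proof
    show "h \<in> hom Q D"
    proof (rule homI)
      show "h x \<in> carrier D" if "x \<in> carrier Q" for x using carr[OF h[OF that]] by simp
      show "h (x \<otimes>\<^bsub>Q\<^esub> y) = h x \<otimes>\<^bsub>D\<^esub> h y" if "x \<in> carrier Q" "y \<in> carrier Q" for x y
      proof -
        have "(x, h x) \<otimes>\<^bsub>Q \<times>\<times> D\<^esub> (y, h y) \<in> \<Gamma>" using h that by blast
        then show ?thesis using unique[OF h] that by simp
      qed
    qed
    show "h (d x) = g x" if x: "x \<in> carrier P" for x
    proof -
      have "(d x, g x) \<in> \<Gamma>" using x \<open>\<Gamma>\<^sub>0 \<subseteq> \<Gamma>\<close> by (auto simp: \<Gamma>\<^sub>0_def)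
      then show ?thesis using unique[OF h] hom_in_carrier[OF d x] by blast
    qed
  qed
qed

lemma divisible_quotient:
  assumes D: "divisible D" and N: "subgroup N D"
  shows "divisible (D Mod N)"
proof -
  interpret D: comm_group D using D by (simp add: divisible_def)
  have nN: "N \<lhd> D" using N by (simp add: D.normal_iff_subgroup)
  show ?thesis
    unfolding divisible_def
  proof (intro conjI ballI allI impI)
    show "comm_group (D Mod N)" using D.abelian_FactGroup[OF N] .
    fix X and n :: nat assume "X \<in> carrier (D Mod N)" "n > 0"
    then obtain x where x: "x \<in> carrier D" "X = N #>\<^bsub>D\<^esub> x" by (auto simp: carrier_FactGroup)
    obtain y where y: "y \<in> carrier D" "y [^]\<^bsub>D\<^esub> n = x"
      using D x(1) \<open>n > 0\<close> unfolding divisible_def by blast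
    then show "\<exists>Y\<in>carrier (D Mod N). Y [^]\<^bsub>D Mod N\<^esub> n = X"
      using normal.FactGroup_pow[OF nN y(1), of n] x by (auto simp: carrier_FactGroup)
  qed
qed

text \<open>An abelian group is a quotient of the group of finitely supported integer valued functions on
  it. These sit in the divisible group of all rational valued functions, and dividing both groups by the
  same relations embeds the one quotient into the other.\<close>

lemma (in comm_group) divisible_embedding:
  obtains E :: "('a \<Rightarrow> rat) set monoid" and j
  where "divisible E" "j \<in> hom G E" "inj_on j (carrier G)"
proof -
  define V :: "('a \<Rightarrow> rat) monoid"
    where "V = \<lparr>carrier = UNIV, mult = (\<lambda>f g x. f x + g x), one = (\<lambda>x. 0)\<rparr>"
  have V_simps [simp]: "carrier V = UNIV" "\<one>\<^bsub>V\<^esub> = (\<lambda>x. 0)" "f \<otimes>\<^bsub>V\<^esub> g = (\<lambda>x. f x + g x)" for f g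
    by (simp_all add: V_def)
  interpret V: group V
    proof (rule groupI)
    show "\<exists>g\<in>carrier V. g \<otimes>\<^bsub>V\<^esub> f = \<one>\<^bsub>V\<^esub>" for f
      by (intro bexI[of _ "\<lambda>x. - f x"]) auto
  qed (auto simp: add.assoc)
  interpret V: comm_group V
    by (rule V.group_comm_groupI) (auto simp: add.commute)
  have pow: "f [^]\<^bsub>V\<^esub> n = (\<lambda>x. of_nat n * f x)" for f and n :: nat
    by (induction n) (auto simp: algebra_simps)
  have divV: "divisible V"
    unfolding divisible_def
  proof (intro conjI ballI allI impI)
    show "comm_group V" by unfold_locales
    show "\<exists>y\<in>carrier V. y [^]\<^bsub>V\<^esub> n = f" if "n > 0" for f and n :: nat
      using that by (intro bexI[of _ "\<lambda>x. f x / of_nat n"]) (auto simp: pow)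
  qed
  let ?Z = "free_Abelian_group (carrier G)"
  obtain h where h: "h \<in> hom ?Z G" "\<And>x. x \<in> carrier G \<Longrightarrow> h (frag_of x) = x"
    using free_Abelian_group_universal[of "\<lambda>x. x" "carrier G"] by auto
  interpret h: group_hom ?Z G h
    using h(1) group_free_Abelian_group group_axioms by (simp add: group_hom_def group_hom_axioms_def)
  define r where "r c = (\<lambda>x. of_int (Poly_Mapping.lookup c x) :: rat)" for c :: "'a \<Rightarrow>\<^sub>0 int"
  have r: "r \<in> hom ?Z V" by (auto simp: hom_def r_def lookup_add)
  interpret r: group_hom ?Z V r
    using r group_free_Abelian_group V.group_axioms by (simp add: group_hom_def group_hom_axioms_def)
  have r_inj: "c = c'" if "r c = r c'" for c c'
    using that by (auto simp: r_def fun_eq_iff intro!: poly_mapping_eqI)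
  define N where "N = r ` kernel ?Z G h"
  have N: "subgroup N V" unfolding N_def
    using r.subgroup_img_is_subgroup[OF h.subgroup_kernel] .
  have nN: "N \<lhd> V" using N by (simp add: V.normal_iff_subgroup)
  define j where "j x = N #>\<^bsub>V\<^esub> r (frag_of x)" for x
  have j_eq: "j' = N #>\<^bsub>V\<^esub> r c'" if "c \<in> carrier ?Z" "c' \<in> carrier ?Z" "h c = h c'" "j' = N #>\<^bsub>V\<^esub> r c" for c c' j'
  proof -
    have "c \<otimes>\<^bsub>?Z\<^esub> inv\<^bsub>?Z\<^esub> c' \<in> kernel ?Z G h"
    proof -
      have "h (c \<otimes>\<^bsub>?Z\<^esub> inv\<^bsub>?Z\<^esub> c') = h c \<otimes> inv h c'"
        using that(1,2) h.hom_mult h.hom_inv h.G.inv_closed by metis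
      then show ?thesis
        using that(1-3) h.G.m_closed h.G.inv_closed unfolding kernel_def by (simp only: mem_Collect_eq r_inv h.hom_closed)
    qed
    then have "r c \<otimes>\<^bsub>V\<^esub> inv\<^bsub>V\<^esub> r c' \<in> N"
      unfolding N_def using that(1,2) r.hom_mult r.hom_inv by (metis h.G.inv_closed imageI)
    then show ?thesis using that(4) V.repr_independence[OF _ _ N] subgroup.rcos_module[OF N V.group_axioms]
      by (metis UNIV_I V_simps(1))
  qed
  show thesis
  proof
    show "divisible (V Mod N)" using divisible_quotient[OF divV N] .
    show "j \<in> hom G (V Mod N)"
    proof (rule homI)
      show "j x \<in> carrier (V Mod N)" if "x \<in> carrier G" for x
        unfolding j_def carrier_FactGroup by simp
      fix x y assume xy: "x \<in> carrier G" "y \<in> carrier G"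
      have "j (x \<otimes> y) = N #>\<^bsub>V\<^esub> r (frag_of x + frag_of y)"
      proof (rule j_eq[of "frag_of (x \<otimes> y)"])
        show "h (frag_of (x \<otimes> y)) = h (frag_of x + frag_of y)"
          using h.hom_mult[of "frag_of x" "frag_of y"] h(2) xy by simp
        show "frag_of x + frag_of y \<in> carrier ?Z"
          using xy h.G.m_closed[of "frag_of x" "frag_of y"] by simp
      qed (use xy in \<open>auto simp: j_def\<close>)
      also have "\<dots> = N #>\<^bsub>V\<^esub> (r (frag_of x) \<otimes>\<^bsub>V\<^esub> r (frag_of y))"
        using r.hom_mult[of "frag_of x" "frag_of y"] xy by simp
      also have "\<dots> = j x \<otimes>\<^bsub>V Mod N\<^esub> j y"
        unfolding j_def mult_FactGroup using normal.rcos_sum[OF nN] by simp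
      finally show "j (x \<otimes> y) = j x \<otimes>\<^bsub>V Mod N\<^esub> j y" .
    qed
    show "inj_on j (carrier G)"
    proof (rule inj_onI)
      fix x y assume xy: "x \<in> carrier G" "y \<in> carrier G" "j x = j y"
      have "r (frag_of x) \<in> N #>\<^bsub>V\<^esub> r (frag_of y)"
        using V.rcos_self[OF _ N, of "r (frag_of x)"] xy(3) unfolding j_def by simp
      then obtain c where c: "c \<in> kernel ?Z G h" "r (frag_of x) = r c \<otimes>\<^bsub>V\<^esub> r (frag_of y)"
        unfolding N_def r_coset_def by blast
      have cZ: "c \<in> carrier ?Z" using c(1) by (simp add: kernel_def)
      have "r (frag_of x) = r (c \<otimes>\<^bsub>?Z\<^esub> frag_of y)"
        using c(2) r.hom_mult[OF cZ, of "frag_of y"] xy(2) by simp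
      then have "frag_of x = c \<otimes>\<^bsub>?Z\<^esub> frag_of y" using r_inj by blast
      then have "h (frag_of x) = h c \<otimes> h (frag_of y)" using h.hom_mult[OF cZ, of "frag_of y"] xy(2) by simp
      then show "x = y" using h(2) xy(1,2) c(1) by (simp add: kernel_def)
    qed
  qed
qed

section \<open>A retraction from injective dimension one\<close>

lemma (in comm_group) subgroup_pow_image: "subgroup ((\<lambda>x. x [^] (n::nat)) ` carrier G) G"
proof -
  have "(\<lambda>x. x [^] n) \<in> hom G G" by (auto simp: hom_def nat_pow_distrib)
  then show ?thesis
    using group_hom.img_is_subgroup[of G G "\<lambda>x. x [^] n"] group_axioms
    by (simp add: group_hom_def group_hom_axioms_def)
qed

lemma comm_group_quot_by: "comm_group G \<Longrightarrow> comm_group (quot_by G n)"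
  unfolding quot_by_def by (rule comm_group.abelian_FactGroup[OF _ comm_group.subgroup_pow_image])

text \<open>The elements related to one \<open>t\<close> lie in a single coset: if \<open>a\<close> and \<open>b\<close> are among them, and the
  inverse of \<open>t\<close> is related to \<open>c\<close>, then the unit is related to \<open>a c\<close> and \<open>b c\<close>, which therefore both lie in \<open>N\<close>.\<close>

lemma relation_mod_homomorphism:
  assumes T: "group T" and H: "comm_group H" and N: "subgroup N H"
    and total: "\<And>t. t \<in> carrier T \<Longrightarrow> \<exists>a. r t a"
    and carr: "\<And>t a. t \<in> carrier T \<Longrightarrow> r t a \<Longrightarrow> a \<in> carrier H"
    and mult: "\<And>s t a b. \<lbrakk>s \<in> carrier T; t \<in> carrier T; r s a; r t b\<rbrakk> \<Longrightarrow> r (s \<otimes>\<^bsub>T\<^esub> t) (a \<otimes>\<^bsub>H\<^esub> b)"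
    and unit: "\<And>a. r \<one>\<^bsub>T\<^esub> a \<Longrightarrow> a \<in> N"
  obtains \<rho> where "\<rho> \<in> hom T (H Mod N)"
    "\<And>t a. t \<in> carrier T \<Longrightarrow> r t a \<Longrightarrow> \<rho> t = N #>\<^bsub>H\<^esub> a"
proof -
  interpret T: group T by fact
  interpret H: comm_group H by fact
  have nN: "N \<lhd> H" using N by (simp add: H.normal_iff_subgroup)
  have unique: "N #>\<^bsub>H\<^esub> a = N #>\<^bsub>H\<^esub> b" if t: "t \<in> carrier T" "r t a" "r t b" for t a b
  proof -
    obtain c where c: "r (inv\<^bsub>T\<^esub> t) c" using total[OF T.inv_closed[OF t(1)]] by blast
    have ab: "a \<in> carrier H" "b \<in> carrier H" "c \<in> carrier H"
      using carr that c T.inv_closed by metis+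
    have 1: "b \<otimes>\<^bsub>H\<^esub> c \<in> N" "a \<otimes>\<^bsub>H\<^esub> c \<in> N"
      using unit mult[of t "inv\<^bsub>T\<^esub> t" _ c] that c by auto
    have "a \<otimes>\<^bsub>H\<^esub> inv\<^bsub>H\<^esub> b = (a \<otimes>\<^bsub>H\<^esub> c) \<otimes>\<^bsub>H\<^esub> inv\<^bsub>H\<^esub> (b \<otimes>\<^bsub>H\<^esub> c)"
      using ab by (simp add: H.inv_mult H.m_ac)
    also have "\<dots> \<in> N" using 1 subgroup.m_closed[OF N] subgroup.m_inv_closed[OF N] by metis
    finally have "a \<in> N #>\<^bsub>H\<^esub> b" using subgroup.rcos_module_rev[OF N H.group_axioms] ab by blast
    then show ?thesis using H.repr_independence[OF _ ab(2) N] by simp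
  qed
  define \<rho> where "\<rho> t = N #>\<^bsub>H\<^esub> (SOME a. r t a)" for t
  have \<rho>: "\<rho> t = N #>\<^bsub>H\<^esub> a" if "t \<in> carrier T" "r t a" for t a
    unfolding \<rho>_def using unique[OF that(1) _ that(2)] someI[of "r t", OF that(2)] by blast
  show thesis
  proof
    show "\<rho> \<in> hom T (H Mod N)"
    proof (rule homI)
      fix t assume t: "t \<in> carrier T"
      then show "\<rho> t \<in> carrier (H Mod N)"
        using total[OF t] carr[OF t] \<rho>[OF t] unfolding carrier_FactGroup by auto
    next
      fix s t assume st: "s \<in> carrier T" "t \<in> carrier T"
      obtain a b where ab: "r s a" "r t b" using total st by blast
      have "\<rho> (s \<otimes>\<^bsub>T\<^esub> t) = N #>\<^bsub>H\<^esub> (a \<otimes>\<^bsub>H\<^esub> b)" using \<rho> mult[OF st ab] st by simp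
      then show "\<rho> (s \<otimes>\<^bsub>T\<^esub> t) = \<rho> s \<otimes>\<^bsub>H Mod N\<^esub> \<rho> t"
        using normal.rcos_sum[OF nN] carr st ab \<rho> by simp
    qed
  qed (rule \<rho>)
qed

text \<open>This is where the splitting comes from. Think of \<open>d : P \<rightarrow> Q\<close> as two consecutive terms of a
  complex, of \<open>H\<close> as its cohomology at \<open>P\<close> and of \<open>T\<close> as the cocycles of the fibre of multiplication by
  \<open>m\<close>. On elements \<open>(0, y)\<close> with \<open>d y = 0\<close> the value is forced to be the class of \<open>y\<close>, up to sign, and
  the question is how to extend it to all of \<open>T\<close>.

  Embed \<open>H\<close> into a divisible group \<open>E\<close>. Both \<open>E\<close> and its quotient \<open>E / H\<close> are injective, so that \<open>q\<close>
  extends to a map \<open>g : P \<rightarrow> E\<close>, and the map \<open>d P \<rightarrow> E / H\<close> induced by \<open>g\<close> extends to \<open>h : Q \<rightarrow> E / H\<close>.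
  For \<open>(z, y)\<close> in \<open>T\<close> let \<open>e\<close> be a lift of \<open>h z\<close> to \<open>E\<close>. Then \<open>m e\<close> and \<open>g y\<close> both lift
  \<open>h (m z) = h (d y)\<close>, whence \<open>m e - g y\<close> lies in \<open>H\<close>. As \<open>e\<close> is determined up to \<open>H\<close>, this
  element is well defined modulo \<open>m H\<close>; it is the value at \<open>(z, y)\<close>. Adding the coboundary \<open>(d w, m w)\<close> of
  the fibre does not change it, so on \<open>(d w, y)\<close> it is the value on \<open>(0, y - m w) = (0, - z)\<close>. That two
  successive extension problems suffice expresses that abelian groups have injective dimension one.\<close>

lemma hereditary_retraction:
  fixes m :: nat and P :: "'p monoid" and Q :: "'q monoid" and H :: "'h monoid"
  assumes P: "comm_group P" and Q: "comm_group Q" and H: "comm_group H"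
    and d: "d \<in> hom P Q"
    and q: "q \<in> hom (P\<lparr>carrier := kernel P Q d\<rparr>) H"
  defines "T \<equiv> (Q \<times>\<times> P)\<lparr>carrier := {(z, y). z \<in> carrier Q \<and> y \<in> carrier P \<and> z [^]\<^bsub>Q\<^esub> m = d y}\<rparr>"
  obtains \<rho> where "\<rho> \<in> hom T (quot_by H m)"
    "\<And>w y z. \<lbrakk>w \<in> carrier P; y \<in> carrier P; z \<in> kernel P Q d; w [^]\<^bsub>P\<^esub> m = z \<otimes>\<^bsub>P\<^esub> y\<rbrakk>
       \<Longrightarrow> \<rho> (d w, y) = ((\<lambda>x. x [^]\<^bsub>H\<^esub> m) ` carrier H) #>\<^bsub>H\<^esub> q z"
proof -
  interpret P: comm_group P by fact
  interpret Q: comm_group Q by fact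
  interpret H: comm_group H by fact
  interpret d: group_hom P Q d
    using d P.group_axioms Q.group_axioms by (simp add: group_hom_def group_hom_axioms_def)
  let ?Z = "P\<lparr>carrier := kernel P Q d\<rparr>"
  have Z: "group ?Z" using subgroup.subgroup_is_group[OF d.subgroup_kernel P.group_axioms] .
  have Z_in: "z \<in> carrier P" if "z \<in> kernel P Q d" for z using that by (simp add: kernel_def)
  obtain E :: "('h \<Rightarrow> rat) set monoid" and j
    where E: "divisible E" and j: "j \<in> hom H E" "inj_on j (carrier H)"
    using H.divisible_embedding by metis
  interpret E: comm_group E using E by (simp add: divisible_def)
  interpret j: group_hom H E j
    using j H.group_axioms E.group_axioms by (simp add: group_hom_def group_hom_axioms_def)
  have jq: "(\<lambda>z. j (q z)) \<in> hom ?Z E" using q j(1) by (auto simp: hom_def Pi_def)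
  obtain g where g: "g \<in> hom P E" "\<And>z. z \<in> kernel P Q d \<Longrightarrow> g z = j (q z)"
  proof (rule divisible_extension[OF Z P E _ jq])
    show "(\<lambda>z. z) \<in> hom ?Z P" using Z_in by (auto simp: hom_def)
    show "j (q z) = \<one>\<^bsub>E\<^esub>" if "z \<in> carrier ?Z" "z = \<one>\<^bsub>P\<^esub>" for z
      using hom_one[OF jq Z E.group_axioms] that by simp
  qed (use that in auto)
  interpret g: group_hom P E g
    using g P.group_axioms E.group_axioms by (simp add: group_hom_def group_hom_axioms_def)
  define J where "J = j ` carrier H"
  have J: "subgroup J E" unfolding J_def by (rule j.img_is_subgroup)
  then have nJ: "J \<lhd> E" by (simp add: E.normal_iff_subgroup)
  have coset_one: "J #>\<^bsub>E\<^esub> e = J \<longleftrightarrow> e \<in> J" if "e \<in> carrier E" for e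
    using E.coset_join1[OF _ that J] E.coset_join2[OF that J] by blast
  have gJ: "(\<lambda>y. J #>\<^bsub>E\<^esub> g y) \<in> hom P (E Mod J)"
    using hom_compose[OF g(1) normal.r_coset_hom_Mod[OF nJ]] by (simp add: comp_def)
  obtain h where h: "h \<in> hom Q (E Mod J)" "\<And>y. y \<in> carrier P \<Longrightarrow> h (d y) = J #>\<^bsub>E\<^esub> g y"
  proof (rule divisible_extension[OF P.group_axioms Q divisible_quotient[OF E J] d gJ])
    fix y assume "y \<in> carrier P" "d y = \<one>\<^bsub>Q\<^esub>"
    then have y: "y \<in> kernel P Q d" by (simp add: kernel_def)
    then have "g y \<in> J" using g(2) hom_in_carrier[OF q, of y] by (auto simp: J_def)
    then show "J #>\<^bsub>E\<^esub> g y = \<one>\<^bsub>E Mod J\<^esub>" using coset_one subgroup.mem_carrier[OF J] by simp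
  qed (use that in auto)
  interpret h: group_hom Q "E Mod J" h
    using h Q.group_axioms normal.factorgroup_is_group[OF nJ] by (simp add: group_hom_def group_hom_axioms_def)
  have T_sub: "subgroup {(z, y). z \<in> carrier Q \<and> y \<in> carrier P \<and> z [^]\<^bsub>Q\<^esub> m = d y} (Q \<times>\<times> P)"
    by unfold_locales
      (auto simp: Q.nat_pow_distrib Q.nat_pow_inv P.group_axioms Q.group_axioms)
  then have T: "group T"
    unfolding T_def using subgroup.subgroup_is_group DirProd_group P.group_axioms Q.group_axioms by blast
  have T_carr: "(z, y) \<in> carrier T \<longleftrightarrow> z \<in> carrier Q \<and> y \<in> carrier P \<and> z [^]\<^bsub>Q\<^esub> m = d y" for z y
    by (simp add: T_def)
  \<comment> \<open>\<open>r (z, y) a\<close> says that \<open>a = m e - g y\<close> for some lift \<open>e\<close> of \<open>h z\<close>.\<close>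
  define r where "r = (\<lambda>(z, y) a. a \<in> carrier H \<and>
      (\<exists>e \<in> carrier E. J #>\<^bsub>E\<^esub> e = h z \<and> e [^]\<^bsub>E\<^esub> m = j a \<otimes>\<^bsub>E\<^esub> g y))"
  let ?N = "(\<lambda>x. x [^]\<^bsub>H\<^esub> m) ` carrier H"
  obtain \<rho> where \<rho>: "\<rho> \<in> hom T (H Mod ?N)" "\<And>t a. t \<in> carrier T \<Longrightarrow> r t a \<Longrightarrow> \<rho> t = ?N #>\<^bsub>H\<^esub> a"
  proof (rule relation_mod_homomorphism[OF T H H.subgroup_pow_image[of m], of r])
    fix t assume t: "t \<in> carrier T"
    obtain z y where zy: "t = (z, y)" by force
    have zyT: "z \<in> carrier Q" "y \<in> carrier P" "z [^]\<^bsub>Q\<^esub> m = d y" using t T_carr zy by auto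
    obtain e where e: "e \<in> carrier E" "J #>\<^bsub>E\<^esub> e = h z"
      using h.hom_closed[OF zyT(1)] unfolding carrier_FactGroup by auto
    have "J #>\<^bsub>E\<^esub> (e [^]\<^bsub>E\<^esub> m) = h z [^]\<^bsub>E Mod J\<^esub> m"
      using normal.FactGroup_pow[OF nJ e(1)] e(2) by metis
    also have "\<dots> = J #>\<^bsub>E\<^esub> g y" using h.hom_nat_pow[OF zyT(1)] zyT h(2) by metis
    finally have "e [^]\<^bsub>E\<^esub> m \<in> J #>\<^bsub>E\<^esub> g y" using E.rcos_self[OF _ J] e(1) by (metis E.nat_pow_closed)
    then obtain a where "a \<in> carrier H" "e [^]\<^bsub>E\<^esub> m = j a \<otimes>\<^bsub>E\<^esub> g y"
      unfolding J_def r_coset_def by blast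
    then show "\<exists>a. r t a" using e unfolding r_def zy by auto
  next
    show "a \<in> carrier H" if "r t a" for t a using that by (auto simp: r_def)
  next
    fix s t a b assume st: "s \<in> carrier T" "t \<in> carrier T" "r s a" "r t b"
    obtain z y where zy: "s = (z, y)" by force
    obtain z' y' where zy': "t = (z', y')" by force
    obtain e where e: "e \<in> carrier E" "J #>\<^bsub>E\<^esub> e = h z" "e [^]\<^bsub>E\<^esub> m = j a \<otimes>\<^bsub>E\<^esub> g y" "a \<in> carrier H"
      using st(3) by (auto simp: r_def zy)
    obtain f where f: "f \<in> carrier E" "J #>\<^bsub>E\<^esub> f = h z'" "f [^]\<^bsub>E\<^esub> m = j b \<otimes>\<^bsub>E\<^esub> g y'" "b \<in> carrier H"
      using st(4) by (auto simp: r_def zy')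
    have c: "z \<in> carrier Q" "y \<in> carrier P" "z' \<in> carrier Q" "y' \<in> carrier P"
      using st(1,2) T_carr zy zy' by auto
    have "J #>\<^bsub>E\<^esub> (e \<otimes>\<^bsub>E\<^esub> f) = h (z \<otimes>\<^bsub>Q\<^esub> z')"
      using normal.rcos_sum[OF nJ e(1) f(1)] e(2) f(2) h.hom_mult[OF c(1,3)] by simp
    moreover have "(e \<otimes>\<^bsub>E\<^esub> f) [^]\<^bsub>E\<^esub> m = j (a \<otimes>\<^bsub>H\<^esub> b) \<otimes>\<^bsub>E\<^esub> g (y \<otimes>\<^bsub>P\<^esub> y')"
      using e f c by (simp add: E.nat_pow_distrib E.m_ac)
    ultimately show "r (s \<otimes>\<^bsub>T\<^esub> t) (a \<otimes>\<^bsub>H\<^esub> b)"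
      using e(1,4) f(1,4) by (auto simp: r_def zy zy' T_def intro!: bexI[of _ "e \<otimes>\<^bsub>E\<^esub> f"])
  next
    fix a assume "r \<one>\<^bsub>T\<^esub> a"
    then obtain e where e: "e \<in> carrier E" "J #>\<^bsub>E\<^esub> e = h \<one>\<^bsub>Q\<^esub>" "e [^]\<^bsub>E\<^esub> m = j a \<otimes>\<^bsub>E\<^esub> g \<one>\<^bsub>P\<^esub>" "a \<in> carrier H"
      by (auto simp: r_def T_def)
    then have "e \<in> J" using coset_one by simp
    then obtain b where b: "b \<in> carrier H" "e = j b" by (auto simp: J_def)
    then have "j (b [^]\<^bsub>H\<^esub> m) = j a" using e j.hom_nat_pow[OF b(1)] by simp
    then show "a \<in> ?N" using j(2) b(1) e(4) by (metis H.nat_pow_closed image_eqI inj_onD)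
  qed (rule that)
  show thesis
  proof
    show "\<rho> \<in> hom T (quot_by H m)" using \<rho>(1) by (simp add: quot_by_def)
    fix w y z assume w: "w \<in> carrier P" and y: "y \<in> carrier P" and z: "z \<in> kernel P Q d"
      and eq: "w [^]\<^bsub>P\<^esub> m = z \<otimes>\<^bsub>P\<^esub> y"
    have "(d w) [^]\<^bsub>Q\<^esub> m = d z \<otimes>\<^bsub>Q\<^esub> d y"
      using d.hom_nat_pow[OF w, of m] eq Z_in[OF z] y by simp
    then have 1: "(d w, y) \<in> carrier T" using w y z by (simp add: T_carr kernel_def)
    have "g w [^]\<^bsub>E\<^esub> m = j (q z) \<otimes>\<^bsub>E\<^esub> g y"
      using g.hom_nat_pow[OF w, of m] eq Z_in[OF z] y g(2)[OF z] by simp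
    then have "r (d w, y) (q z)"
      using hom_in_carrier[OF q, of z] z w h(2)[OF w] by (auto simp: r_def intro!: bexI[of _ "g w"])
    then show "\<rho> (d w, y) = ?N #>\<^bsub>H\<^esub> q z" using \<rho>(2)[OF 1] by simp
  qed
qed

section \<open>Cohomology of cochain complexes\<close>

locale cochain_complex =
  fixes K :: "'g cochain"
  assumes grp_comm: "comm_group (grp K n)"
    and dif_hom: "dif K n \<in> hom (grp K n) (grp K (Suc n))"
    and dif_dif: "x \<in> carrier (grp K n) \<Longrightarrow> dif K (Suc n) (dif K n x) = \<one>\<^bsub>grp K (Suc (Suc n))\<^esub>"
begin

sublocale grp: comm_group "grp K n" for n by (rule grp_comm)

sublocale dif: group_hom "grp K n" "grp K (Suc n)" "dif K n" for n
  using dif_hom grp.group_axioms by (simp add: group_hom_def group_hom_axioms_def)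

lemma cocycle_carrier: "x \<in> cocycles K n \<Longrightarrow> x \<in> carrier (grp K n)"
  and cocycle_dif: "x \<in> cocycles K n \<Longrightarrow> dif K n x = \<one>\<^bsub>grp K (Suc n)\<^esub>"
  and cocycleI: "x \<in> carrier (grp K n) \<Longrightarrow> dif K n x = \<one>\<^bsub>grp K (Suc n)\<^esub> \<Longrightarrow> x \<in> cocycles K n"
  by (auto simp: cocycles_def kernel_def)

lemma subgroup_cocycles: "subgroup (cocycles K n) (grp K n)"
  unfolding cocycles_def by (rule dif.subgroup_kernel)

lemma subgroup_coboundaries: "subgroup (coboundaries K n) (grp K n)"
  using grp.triv_subgroup dif.img_is_subgroup by (auto simp: coboundaries_def split: nat.split)

lemma coboundaries_cocycles: "coboundaries K n \<subseteq> cocycles K n"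
  by (auto simp: coboundaries_def dif_dif split: nat.splits intro!: cocycleI)

lemma dif_coboundary: "x \<in> carrier (grp K n) \<Longrightarrow> dif K n x \<in> coboundaries K (Suc n)"
  by (auto simp: coboundaries_def)

lemma comm_group_cocycles: "comm_group ((grp K n)\<lparr>carrier := cocycles K n\<rparr>)"
  by (rule group.group_comm_groupI[OF grp.subgroup_imp_group[OF subgroup_cocycles]])
    (simp add: cocycle_carrier grp.m_comm)

lemma comm_group_cohomology: "comm_group (cohomology K n)"
  unfolding cohomology_def
  using comm_group.abelian_FactGroup[OF comm_group_cocycles]
    grp.subgroup_incl[OF subgroup_coboundaries subgroup_cocycles coboundaries_cocycles] by blast

lemma carrier_cohomology: "carrier (cohomology K n) = coh_class K n ` cocycles K n"
  by (simp add: cohomology_def carrier_FactGroup coh_class_def)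

lemma coh_class_in: "x \<in> cocycles K n \<Longrightarrow> coh_class K n x \<in> carrier (cohomology K n)"
  by (simp add: carrier_cohomology)

lemma coh_class_mult:
  assumes "x \<in> cocycles K n" "y \<in> cocycles K n"
  shows "coh_class K n (x \<otimes>\<^bsub>grp K n\<^esub> y) = coh_class K n x \<otimes>\<^bsub>cohomology K n\<^esub> coh_class K n y"
  using assms normal.rcos_sum[of "coboundaries K n" "grp K n" x y] subgroup_coboundaries
  by (simp add: cohomology_def coh_class_def grp.normal_iff_subgroup cocycle_carrier)

lemma coh_class_hom: "coh_class K n \<in> hom ((grp K n)\<lparr>carrier := cocycles K n\<rparr>) (cohomology K n)"
  by (rule homI) (simp_all add: coh_class_in coh_class_mult)

lemma coh_class_pow:
  assumes "x \<in> cocycles K n"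
  shows "coh_class K n (x [^]\<^bsub>grp K n\<^esub> (m::nat)) = coh_class K n x [^]\<^bsub>cohomology K n\<^esub> m"
proof -
  have "coh_class K n (x [^]\<^bsub>(grp K n)\<lparr>carrier := cocycles K n\<rparr>\<^esub> m) = coh_class K n x [^]\<^bsub>cohomology K n\<^esub> m"
    using hom_nat_pow[OF coh_class_hom] assms comm_group.axioms(2)[OF comm_group_cocycles]
      comm_group.axioms(2)[OF comm_group_cohomology] by simp
  then show ?thesis using grp.nat_pow_consistent by metis
qed

lemma mem_coh_class: "x \<in> cocycles K n \<Longrightarrow> x \<in> coh_class K n x"
  unfolding coh_class_def using grp.rcos_self[OF _ subgroup_coboundaries] cocycle_carrier by blast

lemma coh_class_eqI:
  assumes "x \<in> cocycles K n" "b \<in> coboundaries K n" "y = b \<otimes>\<^bsub>grp K n\<^esub> x"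
  shows "coh_class K n y = coh_class K n x"
  using grp.repr_independence[OF _ cocycle_carrier[OF assms(1)] subgroup_coboundaries, of y] assms(2,3)
  unfolding coh_class_def by (auto simp: r_coset_def)

lemma coh_class_eqD:
  assumes "y \<in> coh_class K n x" "x \<in> cocycles K n"
  shows "y \<in> cocycles K n" "coh_class K n y = coh_class K n x"
    "\<exists>b \<in> coboundaries K n. y = b \<otimes>\<^bsub>grp K n\<^esub> x"
proof -
  show b: "\<exists>b \<in> coboundaries K n. y = b \<otimes>\<^bsub>grp K n\<^esub> x"
    using assms by (auto simp: coh_class_def r_coset_def)
  then show "y \<in> cocycles K n"
    using coboundaries_cocycles assms(2) subgroup.m_closed[OF subgroup_cocycles] by blast
  show "coh_class K n y = coh_class K n x" using b coh_class_eqI assms(2) by blast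
qed

lemma coh_class_coboundary_mult:
  assumes "x \<in> cocycles K (Suc n)" "a \<in> carrier (grp K n)"
  shows "coh_class K (Suc n) (x \<otimes>\<^bsub>grp K (Suc n)\<^esub> dif K n a) = coh_class K (Suc n) x"
  by (rule coh_class_eqI[OF assms(1) dif_coboundary[OF assms(2)]])
    (use assms grp.m_comm cocycle_carrier in auto)

lemma one_cohomology: "\<one>\<^bsub>cohomology K n\<^esub> = coboundaries K n"
  by (simp add: cohomology_def)

lemma coh_class_eq_one_iff:
  assumes "x \<in> cocycles K n"
  shows "coh_class K n x = \<one>\<^bsub>cohomology K n\<^esub> \<longleftrightarrow> x \<in> coboundaries K n"
  unfolding one_cohomology coh_class_def
  using grp.coset_join1 grp.coset_join2 subgroup_coboundaries assms cocycle_carrier by metis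

lemma the_elem_coh_class:
  assumes "x \<in> cocycles K n" "\<And>y. y \<in> coh_class K n x \<Longrightarrow> f y = f x"
  shows "the_elem (f ` coh_class K n x) = f x"
proof -
  have "f ` coh_class K n x = {f x}" using assms mem_coh_class by blast
  then show ?thesis by simp
qed

end

locale cochain_map = K: cochain_complex K + L: cochain_complex L
  for K L :: "'g cochain" +
  fixes \<phi> :: "nat \<Rightarrow> 'g \<Rightarrow> 'g"
  assumes map_hom: "\<phi> n \<in> hom (grp K n) (grp L n)"
    and map_dif: "x \<in> carrier (grp K n) \<Longrightarrow> \<phi> (Suc n) (dif K n x) = dif L n (\<phi> n x)"
begin

sublocale map: group_hom "grp K n" "grp L n" "\<phi> n" for n
  using map_hom K.grp.group_axioms L.grp.group_axioms by (simp add: group_hom_def group_hom_axioms_def)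

lemma map_cocycle: "x \<in> cocycles K n \<Longrightarrow> \<phi> n x \<in> cocycles L n"
  using map_dif[of x n] K.cocycle_dif K.cocycle_carrier by (auto intro!: L.cocycleI)

lemma map_coboundary: "x \<in> coboundaries K n \<Longrightarrow> \<phi> n x \<in> coboundaries L n"
  by (cases n) (auto simp: coboundaries_def map_dif)

lemma coh_map_class:
  assumes "x \<in> cocycles K n"
  shows "coh_map L \<phi> n (coh_class K n x) = coh_class L n (\<phi> n x)"
  unfolding coh_map_def
proof (rule K.the_elem_coh_class[OF assms])
  fix y assume y: "y \<in> coh_class K n x"
  obtain b where b: "b \<in> coboundaries K n" "y = b \<otimes>\<^bsub>grp K n\<^esub> x" using K.coh_class_eqD(3)[OF y assms] by blast
  have "\<phi> n y = \<phi> n b \<otimes>\<^bsub>grp L n\<^esub> \<phi> n x"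
    unfolding b(2) by (rule map.hom_mult)
      (use b(1) assms K.cocycle_carrier K.coboundaries_cocycles in blast)+
  then show "coh_class L n (\<phi> n y) = coh_class L n (\<phi> n x)"
    using L.coh_class_eqI[OF map_cocycle[OF assms] map_coboundary[OF b(1)]] by blast
qed

lemma coh_map_hom: "coh_map L \<phi> n \<in> hom (cohomology K n) (cohomology L n)"
proof (rule homI)
  fix c assume "c \<in> carrier (cohomology K n)"
  then show "coh_map L \<phi> n c \<in> carrier (cohomology L n)"
    using coh_map_class map_cocycle by (auto simp: K.carrier_cohomology L.coh_class_in)
next
  fix c c' assume "c \<in> carrier (cohomology K n)" "c' \<in> carrier (cohomology K n)"
  then obtain x x' where x: "x \<in> cocycles K n" "x' \<in> cocycles K n" "c = coh_class K n x" "c' = coh_class K n x'"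
    by (auto simp: K.carrier_cohomology)
  have "x \<otimes>\<^bsub>grp K n\<^esub> x' \<in> cocycles K n" using x subgroup.m_closed[OF K.subgroup_cocycles] by blast
  then show "coh_map L \<phi> n (c \<otimes>\<^bsub>cohomology K n\<^esub> c') = coh_map L \<phi> n c \<otimes>\<^bsub>cohomology L n\<^esub> coh_map L \<phi> n c'"
    using x by (simp add: coh_map_class map_cocycle K.cocycle_carrier L.coh_class_mult flip: K.coh_class_mult)
qed

end

section \<open>The long exact cohomology sequence\<close>

locale cochain_ses = K: cochain_complex K + L: cochain_complex L + M: cochain_complex M +
  u: cochain_map K L u + v: cochain_map L M v
  for K L M :: "'g cochain" and u v +
  assumes u_inj: "inj_on (u n) (carrier (grp K n))"
    and exact: "u n ` carrier (grp K n) = kernel (grp L n) (grp M n) (v n)"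
    and v_surj: "v n ` carrier (grp L n) = carrier (grp M n)"
begin

lemma v_u:
  assumes "x \<in> carrier (grp K n)"
  shows "v n (u n x) = \<one>\<^bsub>grp M n\<^esub>"
proof -
  have "u n x \<in> kernel (grp L n) (grp M n) (v n)" unfolding exact[symmetric] using assms by (rule imageI)
  then show ?thesis by (simp add: kernel_def)
qed

lemma kernel_v:
  assumes "y \<in> carrier (grp L n)" "v n y = \<one>\<^bsub>grp M n\<^esub>"
  shows "\<exists>x \<in> carrier (grp K n). y = u n x"
proof -
  have "y \<in> u n ` carrier (grp K n)" unfolding exact using assms by (simp add: kernel_def)
  then show ?thesis by (auto elim: imageE)
qed

lemma snake_lift:
  assumes "z \<in> cocycles M n"
  obtains y x where "y \<in> carrier (grp L n)" "v n y = z" "x \<in> cocycles K (Suc n)" "u (Suc n) x = dif L n y"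
proof -
  obtain y where y: "y \<in> carrier (grp L n)" "v n y = z"
    using v_surj[of n] M.cocycle_carrier[OF assms] by (metis imageE)
  have "v (Suc n) (dif L n y) = \<one>\<^bsub>grp M (Suc n)\<^esub>"
    using v.map_dif[OF y(1)] y(2) M.cocycle_dif[OF assms] by simp
  then obtain x where x: "x \<in> carrier (grp K (Suc n))" "u (Suc n) x = dif L n y"
    using kernel_v L.dif.hom_closed[OF y(1)] by metis
  have "u (Suc (Suc n)) (dif K (Suc n) x) = \<one>\<^bsub>grp L (Suc (Suc n))\<^esub>"
    using u.map_dif[OF x(1)] x(2) L.dif_dif[OF y(1)] by simp
  then have "dif K (Suc n) x = \<one>\<^bsub>grp K (Suc (Suc n))\<^esub>"
    using u_inj[of "Suc (Suc n)"] u.map.hom_one K.dif.hom_closed[OF x(1)]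
    by (metis inj_onD K.grp.one_closed)
  then show thesis using that[OF y K.cocycleI[OF x(1)] x(2)] by blast
qed

text \<open>The class of \<open>x\<close> depends neither on the lift \<open>y\<close> nor on the cocycle representing the given class,
  which is what makes the set in the definition of \<^const>\<open>snake\<close> a singleton.\<close>

lemma snake_unique:
  assumes "y \<in> carrier (grp L n)" "y' \<in> carrier (grp L n)"
    "v n y \<in> cocycles M n" "v n y' \<in> coh_class M n (v n y)"
    "x \<in> cocycles K (Suc n)" "u (Suc n) x = dif L n y"
    "x' \<in> carrier (grp K (Suc n))" "u (Suc n) x' = dif L n y'"
  shows "coh_class K (Suc n) x' = coh_class K (Suc n) x"
proof -
  obtain b where b: "b \<in> coboundaries M n" "v n y' = b \<otimes>\<^bsub>grp M n\<^esub> v n y"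
    using M.coh_class_eqD(3) assms(3,4) by blast
  \<comment> \<open>The two lifts \<open>y'\<close> and \<open>y\<close> differ by a cocycle \<open>c\<close> over \<open>b\<close> and by an element from \<open>K\<close>, whose coboundary
    is the difference of \<open>x'\<close> and \<open>x\<close>. In degree zero \<open>b\<close> is trivial, hence the case distinction.\<close>
  have "\<exists>c \<in> carrier (grp L n). v n c = b \<and> dif L n c = \<one>\<^bsub>grp L (Suc n)\<^esub>"
  proof (cases n)
    case 0
    then show ?thesis using b(1) by (intro bexI[of _ "\<one>\<^bsub>grp L n\<^esub>"]) (auto simp: coboundaries_def)
  next
    case (Suc k)
    obtain a where a: "a \<in> carrier (grp M k)" "b = dif M k a" using b(1) Suc by (auto simp: coboundaries_def)
    then obtain a' where a': "a' \<in> carrier (grp L k)" "v k a' = a" using v_surj[of k] by (metis imageE)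
    show ?thesis
      by (rule bexI[of _ "dif L k a'"]) (use a a' Suc v.map_dif L.dif_dif in auto)
  qed
  then obtain c where c: "c \<in> carrier (grp L n)" "v n c = b" "dif L n c = \<one>\<^bsub>grp L (Suc n)\<^esub>" by blast
  let ?e = "y' \<otimes>\<^bsub>grp L n\<^esub> inv\<^bsub>grp L n\<^esub> (c \<otimes>\<^bsub>grp L n\<^esub> y)"
  have e: "?e \<in> carrier (grp L n)" using assms(1,2) c(1) by simp
  have "b \<in> carrier (grp M n)" using b(1) M.coboundaries_cocycles M.cocycle_carrier by blast
  then have "v n ?e = \<one>\<^bsub>grp M n\<^esub>" using assms(1,2) c b(2) by simp
  then obtain k where k: "k \<in> carrier (grp K n)" "?e = u n k" using kernel_v[OF e] by blast
  have "y' = u n k \<otimes>\<^bsub>grp L n\<^esub> (c \<otimes>\<^bsub>grp L n\<^esub> y)"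
    using k(2)[symmetric] assms(1,2) c(1) by (simp add: L.grp.m_assoc)
  then have "dif L n y' = dif L n (u n k) \<otimes>\<^bsub>grp L (Suc n)\<^esub> dif L n y"
    using k(1) c assms(1) by simp
  then have "u (Suc n) x' = u (Suc n) (dif K n k \<otimes>\<^bsub>grp K (Suc n)\<^esub> x)"
    using assms(5-8) u.map_dif[OF k(1)] k(1) K.cocycle_carrier[OF assms(5)] by simp
  then have "x' = dif K n k \<otimes>\<^bsub>grp K (Suc n)\<^esub> x"
    using u_inj[of "Suc n"] assms(7) k(1) K.cocycle_carrier[OF assms(5)]
    by (meson inj_onD K.dif.hom_closed K.grp.m_closed)
  then show ?thesis using K.coh_class_eqI[OF assms(5) K.dif_coboundary[OF k(1)]] by blast
qed

lemma snake_class: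
  assumes y: "y \<in> carrier (grp L n)" "v n y \<in> cocycles M n"
    and x: "x \<in> cocycles K (Suc n)" "u (Suc n) x = dif L n y"
  shows "snake K L u v n (coh_class M n (v n y)) = coh_class K (Suc n) x"
proof -
  have "{coh_class K (Suc n) x' | x' y'. y' \<in> carrier (grp L n) \<and> v n y' \<in> coh_class M n (v n y) \<and>
    x' \<in> carrier (grp K (Suc n)) \<and> u (Suc n) x' = dif L n y'} = {coh_class K (Suc n) x}"
  proof (intro equalityI subsetI; clarify)
    fix x' y' assume "y' \<in> carrier (grp L n)" "v n y' \<in> coh_class M n (v n y)"
    "x' \<in> carrier (grp K (Suc n))" "u (Suc n) x' = dif L n y'"
    then show "coh_class K (Suc n) x' = coh_class K (Suc n) x"
      using snake_unique y x by blast
  next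
    show "\<exists>x' y'. coh_class K (Suc n) x = coh_class K (Suc n) x' \<and> y' \<in> carrier (grp L n) \<and>
      v n y' \<in> coh_class M n (v n y) \<and> x' \<in> carrier (grp K (Suc n)) \<and> u (Suc n) x' = dif L n y'"
      using y x M.mem_coh_class K.cocycle_carrier by blast
  qed
  then show ?thesis by (simp add: snake_def)
qed

lemma snake_hom: "snake K L u v n \<in> hom (cohomology M n) (cohomology K (Suc n))"
proof (rule homI)
  fix c assume "c \<in> carrier (cohomology M n)"
  then obtain z where z: "z \<in> cocycles M n" "c = coh_class M n z" by (auto simp: M.carrier_cohomology)
  then obtain y x where y: "y \<in> carrier (grp L n)" "v n y = z" "x \<in> cocycles K (Suc n)" "u (Suc n) x = dif L n y"
    using snake_lift by metis
  then have "snake K L u v n c = coh_class K (Suc n) x" using snake_class z by metis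
  then show "snake K L u v n c \<in> carrier (cohomology K (Suc n))"
    using K.coh_class_in[OF y(3)] by simp
next
  fix c c' assume "c \<in> carrier (cohomology M n)" "c' \<in> carrier (cohomology M n)"
  then obtain z z' where z: "z \<in> cocycles M n" "c = coh_class M n z" "z' \<in> cocycles M n" "c' = coh_class M n z'"
    by (auto simp: M.carrier_cohomology)
  obtain y x where y: "y \<in> carrier (grp L n)" "v n y = z" "x \<in> cocycles K (Suc n)" "u (Suc n) x = dif L n y"
    using snake_lift[OF z(1)] by metis
  obtain y' x' where y': "y' \<in> carrier (grp L n)" "v n y' = z'" "x' \<in> cocycles K (Suc n)" "u (Suc n) x' = dif L n y'"
    using snake_lift[OF z(3)] by metis
  have vy: "v n (y \<otimes>\<^bsub>grp L n\<^esub> y') = z \<otimes>\<^bsub>grp M n\<^esub> z'" using y y' by simp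
  have 1: "z \<otimes>\<^bsub>grp M n\<^esub> z' \<in> cocycles M n" "x \<otimes>\<^bsub>grp K (Suc n)\<^esub> x' \<in> cocycles K (Suc n)"
    using z y y' subgroup.m_closed[OF M.subgroup_cocycles] subgroup.m_closed[OF K.subgroup_cocycles] by blast+
  have "u (Suc n) (x \<otimes>\<^bsub>grp K (Suc n)\<^esub> x') = dif L n (y \<otimes>\<^bsub>grp L n\<^esub> y')"
    using y y' K.cocycle_carrier by simp
  then have "snake K L u v n (coh_class M n (v n (y \<otimes>\<^bsub>grp L n\<^esub> y'))) = coh_class K (Suc n) (x \<otimes>\<^bsub>grp K (Suc n)\<^esub> x')"
    using snake_class y(1) y'(1) 1 vy by (metis L.grp.m_closed)
  moreover have "snake K L u v n c = coh_class K (Suc n) x" "snake K L u v n c' = coh_class K (Suc n) x'"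
    using snake_class y y' z by metis+
  ultimately show "snake K L u v n (c \<otimes>\<^bsub>cohomology M n\<^esub> c')
      = snake K L u v n c \<otimes>\<^bsub>cohomology K (Suc n)\<^esub> snake K L u v n c'"
    using z y y' vy by (simp flip: K.coh_class_mult M.coh_class_mult)
qed

lemma kernel_snake:
  "kernel (cohomology M n) (cohomology K (Suc n)) (snake K L u v n) = coh_map M v n ` carrier (cohomology L n)"
proof (intro equalityI subsetI)
  fix c assume "c \<in> kernel (cohomology M n) (cohomology K (Suc n)) (snake K L u v n)"
  then have c: "c \<in> carrier (cohomology M n)" "snake K L u v n c = \<one>\<^bsub>cohomology K (Suc n)\<^esub>" by (auto simp: kernel_def)
  then obtain z where z: "z \<in> cocycles M n" "c = coh_class M n z" by (auto simp: M.carrier_cohomology)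
  then obtain y x where y: "y \<in> carrier (grp L n)" "v n y = z" "x \<in> cocycles K (Suc n)" "u (Suc n) x = dif L n y"
    using snake_lift by metis
  then have "coh_class K (Suc n) x = \<one>\<^bsub>cohomology K (Suc n)\<^esub>" using snake_class z c by metis
  then obtain k where k: "k \<in> carrier (grp K n)" "x = dif K n k"
    using K.coh_class_eq_one_iff y(3) by (auto simp: coboundaries_def)
  let ?y = "y \<otimes>\<^bsub>grp L n\<^esub> inv\<^bsub>grp L n\<^esub> u n k"
  have "dif L n ?y = \<one>\<^bsub>grp L (Suc n)\<^esub>" using y k u.map_dif[OF k(1)] by simp
  then have y': "?y \<in> cocycles L n" using y(1) k(1) by (intro L.cocycleI) auto
  have "v n ?y = z" using y(1,2) v_u[OF k(1)] k(1) M.cocycle_carrier[OF z(1)] by simp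
  then have "c = coh_map M v n (coh_class L n ?y)" using v.coh_map_class[OF y'] z by simp
  then show "c \<in> coh_map M v n ` carrier (cohomology L n)" using y' L.coh_class_in by blast
next
  fix c assume "c \<in> coh_map M v n ` carrier (cohomology L n)"
  then obtain y where y: "y \<in> cocycles L n" "c = coh_class M n (v n y)"
    using v.coh_map_class by (auto simp: L.carrier_cohomology)
  have 1: "\<one>\<^bsub>grp K (Suc n)\<^esub> \<in> cocycles K (Suc n)" by (rule subgroup.one_closed[OF K.subgroup_cocycles])
  have "snake K L u v n c = coh_class K (Suc n) \<one>\<^bsub>grp K (Suc n)\<^esub>"
    unfolding y(2) by (rule snake_class) (use y(1) L.cocycle_carrier L.cocycle_dif v.map_cocycle 1 in auto)
  also have "\<dots> = \<one>\<^bsub>cohomology K (Suc n)\<^esub>"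
    using K.coh_class_eq_one_iff[OF 1] subgroup.one_closed[OF K.subgroup_coboundaries] by simp
  finally show "c \<in> kernel (cohomology M n) (cohomology K (Suc n)) (snake K L u v n)"
    using y v.map_cocycle M.coh_class_in by (simp add: kernel_def)
qed

lemma image_snake:
  "snake K L u v n ` carrier (cohomology M n) = kernel (cohomology K (Suc n)) (cohomology L (Suc n)) (coh_map L u (Suc n))"
proof (intro equalityI subsetI)
  fix c assume "c \<in> snake K L u v n ` carrier (cohomology M n)"
  then obtain z where z: "z \<in> cocycles M n" "c = snake K L u v n (coh_class M n z)" by (auto simp: M.carrier_cohomology)
  then obtain y x where y: "y \<in> carrier (grp L n)" "v n y = z" "x \<in> cocycles K (Suc n)" "u (Suc n) x = dif L n y"
    using snake_lift by metis
  then have c: "c = coh_class K (Suc n) x" using snake_class z by metis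
  have "coh_map L u (Suc n) c = coh_class L (Suc n) (dif L n y)"
    unfolding c using u.coh_map_class[OF y(3)] y(4) by simp
  also have "\<dots> = \<one>\<^bsub>cohomology L (Suc n)\<^esub>"
    using L.coh_class_eq_one_iff[of "dif L n y" "Suc n"] L.dif_coboundary[OF y(1)] L.coboundaries_cocycles by blast
  finally show "c \<in> kernel (cohomology K (Suc n)) (cohomology L (Suc n)) (coh_map L u (Suc n))"
    using c K.coh_class_in[OF y(3)] by (simp add: kernel_def)
next
  fix c assume "c \<in> kernel (cohomology K (Suc n)) (cohomology L (Suc n)) (coh_map L u (Suc n))"
  then obtain x where x: "x \<in> cocycles K (Suc n)" "c = coh_class K (Suc n) x"
    "coh_class L (Suc n) (u (Suc n) x) = \<one>\<^bsub>cohomology L (Suc n)\<^esub>"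
    using u.coh_map_class by (auto simp: kernel_def K.carrier_cohomology)
  then obtain y where y: "y \<in> carrier (grp L n)" "u (Suc n) x = dif L n y"
    using L.coh_class_eq_one_iff[OF u.map_cocycle[OF x(1)]] by (auto simp: coboundaries_def)
  have "dif M n (v n y) = v (Suc n) (u (Suc n) x)" using v.map_dif[OF y(1)] y(2) by simp
  also have "\<dots> = \<one>\<^bsub>grp M (Suc n)\<^esub>" using v_u K.cocycle_carrier[OF x(1)] .
  finally have vy: "v n y \<in> cocycles M n" using y(1) by (intro M.cocycleI) simp
  then have "c = snake K L u v n (coh_class M n (v n y))" using snake_class[OF y(1) vy x(1) y(2)] x(2) by simp
  then show "c \<in> snake K L u v n ` carrier (cohomology M n)" using vy M.coh_class_in by blast
qed

lemma image_coh_map: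
  "coh_map L u n ` carrier (cohomology K n) = kernel (cohomology L n) (cohomology M n) (coh_map M v n)"
proof (intro equalityI subsetI)
  fix c assume "c \<in> coh_map L u n ` carrier (cohomology K n)"
  then obtain x where x: "x \<in> cocycles K n" "c = coh_class L n (u n x)"
    using u.coh_map_class by (auto simp: K.carrier_cohomology)
  have "coh_map M v n c = coh_class M n \<one>\<^bsub>grp M n\<^esub>"
    using x v.coh_map_class[OF u.map_cocycle[OF x(1)]] v_u K.cocycle_carrier by simp
  also have "\<dots> = \<one>\<^bsub>cohomology M n\<^esub>"
    using M.coh_class_eq_one_iff subgroup.one_closed[OF M.subgroup_coboundaries]
      subgroup.one_closed[OF M.subgroup_cocycles] by blast
  finally show "c \<in> kernel (cohomology L n) (cohomology M n) (coh_map M v n)"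
    using x L.coh_class_in[OF u.map_cocycle] by (simp add: kernel_def)
next
  fix c assume "c \<in> kernel (cohomology L n) (cohomology M n) (coh_map M v n)"
  then obtain y where y: "y \<in> cocycles L n" "c = coh_class L n y" "coh_class M n (v n y) = \<one>\<^bsub>cohomology M n\<^esub>"
    using v.coh_map_class by (auto simp: kernel_def L.carrier_cohomology)
  then have b: "v n y \<in> coboundaries M n" using M.coh_class_eq_one_iff[OF v.map_cocycle[OF y(1)]] by simp
  have "\<exists>b' \<in> coboundaries L n. v n b' = v n y"
  proof (cases n)
    case 0
    then show ?thesis using b by (intro bexI[of _ "\<one>\<^bsub>grp L n\<^esub>"]) (auto simp: coboundaries_def)
  next
    case (Suc k)
    then obtain a where a: "a \<in> carrier (grp M k)" "v n y = dif M k a" using b by (auto simp: coboundaries_def)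
    then obtain a' where a': "a' \<in> carrier (grp L k)" "v k a' = a" using v_surj[of k] by (metis imageE)
    then show ?thesis using Suc a v.map_dif[OF a'(1)] L.dif_coboundary[OF a'(1)] by auto
  qed
  then obtain b' where b': "b' \<in> coboundaries L n" "v n b' = v n y" by blast
  have b'Z: "b' \<in> cocycles L n" using b' L.coboundaries_cocycles by blast
  let ?y = "inv\<^bsub>grp L n\<^esub> b' \<otimes>\<^bsub>grp L n\<^esub> y"
  have y': "?y \<in> cocycles L n"
    using subgroup.m_closed[OF L.subgroup_cocycles] subgroup.m_inv_closed[OF L.subgroup_cocycles] b'Z y(1) by blast
  have carr: "y \<in> carrier (grp L n)" "b' \<in> carrier (grp L n)" using y(1) b'Z L.cocycle_carrier by auto
  have "v n ?y = \<one>\<^bsub>grp M n\<^esub>" using carr b'(2) by simp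
  then obtain x where x: "x \<in> carrier (grp K n)" "?y = u n x" using kernel_v L.cocycle_carrier[OF y'] by blast
  have "u (Suc n) (dif K n x) = \<one>\<^bsub>grp L (Suc n)\<^esub>" using u.map_dif[OF x(1)] x(2) L.cocycle_dif[OF y'] by simp
  then have "dif K n x = \<one>\<^bsub>grp K (Suc n)\<^esub>"
    using u_inj[of "Suc n"] u.map.hom_one K.dif.hom_closed[OF x(1)] by (metis inj_onD K.grp.one_closed)
  then have xZ: "x \<in> cocycles K n" using x(1) K.cocycleI by blast
  have "coh_class L n (u n x) = coh_class L n y"
    unfolding x(2)[symmetric] by (rule L.coh_class_eqI[OF y(1) subgroup.m_inv_closed[OF L.subgroup_coboundaries b'(1)]]) simp
  then have "c = coh_map L u n (coh_class K n x)" using y(2) u.coh_map_class[OF xZ] by simp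
  then show "c \<in> coh_map L u n ` carrier (cohomology K n)" using K.coh_class_in[OF xZ] by blast
qed

end

section \<open>The Kummer sequence of a complex of abelian groups\<close>

text \<open>Dividing by its kernel \<open>m G\<close> turns \<open>\<delta>\<close> into an injection \<open>\<alpha>\<close>, of which \<open>\<rho>\<close> is a
  retraction. The map \<open>\<tau> b = b - \<alpha> (\<rho> b)\<close> kills the kernel of \<open>\<beta>\<close>, so it factors through \<open>\<beta>\<close>,
  and the factor is a section.\<close>

lemma kummer_split_group:
  fixes G :: "'g monoid" and B :: "'b monoid" and D :: "'d monoid" and m :: nat
  assumes G: "comm_group G" and B: "comm_group B" and D: "comm_group D"
    and \<delta>: "\<delta> \<in> hom G B" "kernel G B \<delta> = (\<lambda>x. x [^]\<^bsub>G\<^esub> m) ` carrier G"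
    and \<beta>: "\<beta> \<in> hom B D" "\<delta> ` carrier G = kernel B D \<beta>" "\<beta> ` carrier B = kernel D D (\<lambda>x. x [^]\<^bsub>D\<^esub> m)"
    and \<rho>: "\<rho> \<in> hom B (quot_by G m)"
      "\<And>g. g \<in> carrier G \<Longrightarrow> \<rho> (\<delta> g) = (\<lambda>x. x [^]\<^bsub>G\<^esub> m) ` carrier G #>\<^bsub>G\<^esub> g"
  shows "split_short_exact_groups (quot_by G m) B (torsion D m) (\<lambda>c. the_elem (\<delta> ` c)) \<beta>"
proof -
  interpret G: comm_group G by fact
  interpret B: comm_group B by fact
  interpret D: comm_group D by fact
  interpret \<delta>: group_hom G B \<delta>
    using \<delta>(1) G.group_axioms B.group_axioms by (simp add: group_hom_def group_hom_axioms_def)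
  interpret \<beta>: group_hom B D \<beta>
    using \<beta>(1) D.group_axioms B.group_axioms by (simp add: group_hom_def group_hom_axioms_def)
  interpret Q: comm_group "quot_by G m" using comm_group_quot_by[OF G] .
  interpret \<rho>: group_hom B "quot_by G m" \<rho>
    using \<rho>(1) Q.group_axioms B.group_axioms by (simp add: group_hom_def group_hom_axioms_def)
  have Q_eq: "quot_by G m = G Mod kernel G B \<delta>" by (simp add: quot_by_def \<delta>(2))
  define \<alpha> where "\<alpha> c = the_elem (\<delta> ` c)" for c
  have \<alpha>_hom: "\<alpha> \<in> hom (quot_by G m) B" unfolding Q_eq \<alpha>_def by (rule \<delta>.FactGroup_hom)
  have \<alpha>_inj: "inj_on \<alpha> (carrier (quot_by G m))" unfolding Q_eq \<alpha>_def by (rule \<delta>.FactGroup_inj_on)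
  interpret \<alpha>: group_hom "quot_by G m" B \<alpha>
    using \<alpha>_hom Q.group_axioms B.group_axioms by (simp add: group_hom_def group_hom_axioms_def)
  have Q_carr: "carrier (quot_by G m) = (\<lambda>g. kernel G B \<delta> #>\<^bsub>G\<^esub> g) ` carrier G"
    by (simp add: Q_eq carrier_FactGroup)
  have \<alpha>_coset: "\<alpha> (kernel G B \<delta> #>\<^bsub>G\<^esub> g) = \<delta> g" if g: "g \<in> carrier G" for g
  proof -
    have "\<delta> ` (kernel G B \<delta> #>\<^bsub>G\<^esub> g) = {\<delta> g}"
      using g G.rcos_self[OF g \<delta>.subgroup_kernel] by (auto simp: r_coset_def kernel_def)
    then show ?thesis by (simp add: \<alpha>_def)
  qed
  have \<alpha>_img: "\<alpha> ` carrier (quot_by G m) = kernel B D \<beta>"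
  proof -
    have "\<alpha> ` carrier (quot_by G m) = \<delta> ` carrier G" unfolding Q_carr image_image using \<alpha>_coset by (intro image_cong) auto
    then show ?thesis using \<beta>(2) by simp
  qed
  have \<rho>\<alpha>: "\<rho> (\<alpha> c) = c" if c: "c \<in> carrier (quot_by G m)" for c
    using c \<alpha>_coset \<rho>(2) unfolding Q_carr by (auto simp: \<delta>(2))
  let ?T = "torsion D m"
  have T_sub: "subgroup (kernel D D (\<lambda>x. x [^]\<^bsub>D\<^esub> m)) D"
    unfolding \<beta>(3)[symmetric] by (rule \<beta>.img_is_subgroup)
  have T: "comm_group ?T"
    unfolding torsion_def using D.subgroup_imp_group[OF T_sub] subgroup.mem_carrier[OF T_sub]
    by (intro group.group_comm_groupI) (auto simp: D.m_comm)
  have T_simps: "carrier ?T = \<beta> ` carrier B" "\<one>\<^bsub>?T\<^esub> = \<one>\<^bsub>D\<^esub>" "mult ?T = mult D"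
    by (simp_all add: torsion_def \<beta>(3))
  have \<beta>T: "\<beta> \<in> hom B ?T" by (rule homI) (simp_all add: T_simps)
  have ses: "short_exact_groups (quot_by G m) B ?T \<alpha> \<beta>"
    unfolding short_exact_groups_def
    using Q.comm_group_axioms B T \<alpha>_hom \<beta>T \<alpha>_inj \<alpha>_img by (simp add: T_simps kernel_def)
  define \<tau> where "\<tau> b = b \<otimes>\<^bsub>B\<^esub> inv\<^bsub>B\<^esub> \<alpha> (\<rho> b)" for b
  have \<tau>_carr: "\<tau> b \<in> carrier B" if "b \<in> carrier B" for b using that by (simp add: \<tau>_def)
  have \<tau>_mult: "\<tau> (a \<otimes>\<^bsub>B\<^esub> b) = \<tau> a \<otimes>\<^bsub>B\<^esub> \<tau> b" if "a \<in> carrier B" "b \<in> carrier B" for a b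
    using that by (simp add: \<tau>_def B.inv_mult B.m_ac)
  have \<beta>\<tau>: "\<beta> (\<tau> b) = \<beta> b" if b: "b \<in> carrier B" for b
  proof -
    have "\<alpha> (\<rho> b) \<in> kernel B D \<beta>" unfolding \<alpha>_img[symmetric] using b by simp
    then have "\<beta> (\<alpha> (\<rho> b)) = \<one>\<^bsub>D\<^esub>" by (simp add: kernel_def)
    then show ?thesis using b by (simp add: \<tau>_def)
  qed
  have \<tau>_kernel: "\<tau> b = \<one>\<^bsub>B\<^esub>" if b: "b \<in> kernel B D \<beta>" for b
  proof -
    obtain c where "c \<in> carrier (quot_by G m)" "b = \<alpha> c" using b unfolding \<alpha>_img[symmetric] by blast
    then show ?thesis using \<rho>\<alpha> by (simp add: \<tau>_def)
  qed
  have \<tau>_cong: "\<tau> a = \<tau> b" if "a \<in> carrier B" "b \<in> carrier B" "\<beta> a = \<beta> b" for a b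
  proof -
    have "a \<otimes>\<^bsub>B\<^esub> inv\<^bsub>B\<^esub> b \<in> kernel B D \<beta>" using that by (simp add: kernel_def)
    then have "\<tau> (a \<otimes>\<^bsub>B\<^esub> inv\<^bsub>B\<^esub> b) = \<one>\<^bsub>B\<^esub>" by (rule \<tau>_kernel)
    moreover have "a = (a \<otimes>\<^bsub>B\<^esub> inv\<^bsub>B\<^esub> b) \<otimes>\<^bsub>B\<^esub> b" using that by (simp add: B.m_assoc)
    ultimately show ?thesis using \<tau>_mult[of "a \<otimes>\<^bsub>B\<^esub> inv\<^bsub>B\<^esub> b" b] that \<tau>_carr[of b] by simp
  qed
  define \<sigma> where "\<sigma> y = \<tau> (SOME b. b \<in> carrier B \<and> \<beta> b = y)" for y
  have \<sigma>: "\<sigma> (\<beta> b) = \<tau> b" if b: "b \<in> carrier B" for b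
  proof -
    have "(SOME a. a \<in> carrier B \<and> \<beta> a = \<beta> b) \<in> carrier B \<and> \<beta> (SOME a. a \<in> carrier B \<and> \<beta> a = \<beta> b) = \<beta> b"
      by (rule someI[of _ b]) (use b in simp)
    then show ?thesis unfolding \<sigma>_def using b by (intro \<tau>_cong) auto
  qed
  have "\<sigma> \<in> hom ?T B"
  proof (rule homI)
    show "\<sigma> y \<in> carrier B" if "y \<in> carrier ?T" for y using that \<sigma> \<tau>_carr by (auto simp: T_simps)
    fix y y' assume "y \<in> carrier ?T" "y' \<in> carrier ?T"
    then obtain b b' where "b \<in> carrier B" "y = \<beta> b" "b' \<in> carrier B" "y' = \<beta> b'" by (auto simp: T_simps)
    then show "\<sigma> (y \<otimes>\<^bsub>?T\<^esub> y') = \<sigma> y \<otimes>\<^bsub>B\<^esub> \<sigma> y'"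
      using \<sigma>[of "b \<otimes>\<^bsub>B\<^esub> b'"] by (simp add: T_simps \<sigma> \<tau>_mult)
  qed
  moreover have "\<forall>y \<in> carrier ?T. \<beta> (\<sigma> y) = y" using \<sigma> \<beta>\<tau> by (auto simp: T_simps)
  ultimately show ?thesis
    using ses unfolding split_short_exact_groups_def \<alpha>_def[abs_def] by blast
qed

text \<open>The contribution of degree \<open>-1\<close> is absent in degree zero, which therefore needs an equation of
  its own. Writing \<open>\<phi> = \<psi> + s d + d s\<close> with sums instead of a difference avoids inverses.\<close>

definition cochain_homotopy ::
  "'g cochain \<Rightarrow> 'g cochain \<Rightarrow> (nat \<Rightarrow> 'g \<Rightarrow> 'g) \<Rightarrow> (nat \<Rightarrow> 'g \<Rightarrow> 'g) \<Rightarrow> (nat \<Rightarrow> 'g \<Rightarrow> 'g) \<Rightarrow> bool"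
  where "cochain_homotopy K L \<phi> \<psi> s \<longleftrightarrow> (\<forall>n. s n \<in> hom (grp K (Suc n)) (grp L n)) \<and>
    (\<forall>x \<in> carrier (grp K 0). \<phi> 0 x = \<psi> 0 x \<otimes>\<^bsub>grp L 0\<^esub> s 0 (dif K 0 x)) \<and>
    (\<forall>n. \<forall>x \<in> carrier (grp K (Suc n)). \<phi> (Suc n) x =
       \<psi> (Suc n) x \<otimes>\<^bsub>grp L (Suc n)\<^esub> (s (Suc n) (dif K (Suc n) x) \<otimes>\<^bsub>grp L (Suc n)\<^esub> dif L n (s n x)))"

lemma homotopy_cocycle:
  assumes \<phi>: "cochain_map K L \<phi>" and \<psi>: "cochain_map K L \<psi>" and s: "cochain_homotopy K L \<phi> \<psi> s"
    and x: "x \<in> cocycles K n"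
  shows "coh_class L n (\<phi> n x) = coh_class L n (\<psi> n x)"
proof -
  interpret \<phi>: cochain_map K L \<phi> by fact
  interpret \<psi>: cochain_map K L \<psi> by fact
  have s_hom: "s k \<in> hom (grp K (Suc k)) (grp L k)" for k using s by (simp add: cochain_homotopy_def)
  have s_one: "s k (\<one>\<^bsub>grp K (Suc k)\<^esub>) = \<one>\<^bsub>grp L k\<^esub>" for k
    using hom_one[OF s_hom] \<phi>.K.grp.group_axioms \<phi>.L.grp.group_axioms by blast
  note xs = \<phi>.K.cocycle_carrier[OF x] \<phi>.K.cocycle_dif[OF x]
  show ?thesis
  proof (cases n)
    case 0
    then show ?thesis using s xs s_one \<psi>.map.hom_closed[of x 0] by (simp add: cochain_homotopy_def)
  next
    case (Suc k)
    have sx: "s k x \<in> carrier (grp L k)" using hom_in_carrier[OF s_hom] xs(1) Suc by blast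
    have "\<phi> n x = \<psi> n x \<otimes>\<^bsub>grp L n\<^esub> (s n (dif K n x) \<otimes>\<^bsub>grp L n\<^esub> dif L k (s k x))"
      using s xs(1) unfolding cochain_homotopy_def Suc by blast
    also have "\<dots> = \<psi> n x \<otimes>\<^bsub>grp L n\<^esub> dif L k (s k x)"
      using s_one xs(2) \<phi>.L.dif.hom_closed[OF sx] Suc by simp
    finally show ?thesis
      using \<phi>.L.coh_class_coboundary_mult[of "\<psi> n x" k "s k x"] \<psi>.map_cocycle[OF x] sx Suc by simp
  qed
qed

lemma homotopic_coh_map:
  assumes \<phi>: "cochain_map K L \<phi>" and \<psi>: "cochain_map K L \<psi>" and s: "cochain_homotopy K L \<phi> \<psi> s"
    and c: "c \<in> carrier (cohomology K n)"
  shows "coh_map L \<phi> n c = coh_map L \<psi> n c"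
proof -
  interpret \<phi>: cochain_map K L \<phi> by fact
  interpret \<psi>: cochain_map K L \<psi> by fact
  obtain x where "x \<in> cocycles K n" "c = coh_class K n x" using c by (auto simp: \<phi>.K.carrier_cohomology)
  then show ?thesis using homotopy_cocycle[OF \<phi> \<psi> s] \<phi>.coh_map_class \<psi>.coh_map_class by simp
qed

lemma cochain_map_comp:
  assumes "cochain_map K L \<phi>" "cochain_map L M \<psi>"
  shows "cochain_map K M (\<lambda>n x. \<psi> n (\<phi> n x))"
proof -
  interpret \<phi>: cochain_map K L \<phi> by fact
  interpret \<psi>: cochain_map L M \<psi> by fact
  show ?thesis
    by unfold_locales (auto simp: \<phi>.map_dif \<psi>.map_dif intro!: homI)
qed

lemma coh_map_comp:
  assumes "cochain_map K L \<phi>" "cochain_map L M \<psi>" "c \<in> carrier (cohomology K n)"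
  shows "coh_map M (\<lambda>n x. \<psi> n (\<phi> n x)) n c = coh_map M \<psi> n (coh_map L \<phi> n c)"
proof -
  interpret \<phi>: cochain_map K L \<phi> by fact
  interpret \<psi>: cochain_map L M \<psi> by fact
  interpret \<psi>\<phi>: cochain_map K M "\<lambda>n x. \<psi> n (\<phi> n x)" using cochain_map_comp assms(1,2) .
  obtain x where "x \<in> cocycles K n" "c = coh_class K n x" using assms(3) by (auto simp: \<phi>.K.carrier_cohomology)
  then show ?thesis using \<psi>\<phi>.coh_map_class \<psi>.coh_map_class[OF \<phi>.map_cocycle] \<phi>.coh_map_class by simp
qed

lemma (in cochain_complex) coh_map_id:
  assumes "cochain_map K K \<phi>" "\<And>n x. x \<in> carrier (grp K n) \<Longrightarrow> \<phi> n x = x" "c \<in> carrier (cohomology K n)"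
  shows "coh_map K \<phi> n c = c"
  using assms cochain_map.coh_map_class[OF assms(1)] cocycle_carrier by (auto simp: carrier_cohomology)

lemma homotopy_equivalence_bij:
  assumes w: "cochain_map L M w" and w': "cochain_map M L w'"
    and s: "cochain_homotopy L L (\<lambda>n x. w' n (w n x)) (\<lambda>n x. x) s"
    and t: "cochain_homotopy M M (\<lambda>n x. w n (w' n x)) (\<lambda>n x. x) t"
  shows "bij_betw (coh_map M w n) (carrier (cohomology L n)) (carrier (cohomology M n))"
proof -
  interpret w: cochain_map L M w by fact
  interpret w': cochain_map M L w' by fact
  have idL: "cochain_map L L (\<lambda>n x. x)" and idM: "cochain_map M M (\<lambda>n x. x)"
    by unfold_locales (auto simp: hom_def)
  show ?thesis
  proof (rule bij_betwI[of _ _ _ "coh_map L w' n"])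
    show "coh_map M w n \<in> carrier (cohomology L n) \<rightarrow> carrier (cohomology M n)"
      "coh_map L w' n \<in> carrier (cohomology M n) \<rightarrow> carrier (cohomology L n)"
      using w.coh_map_hom w'.coh_map_hom by (auto simp: hom_def)
    show "coh_map L w' n (coh_map M w n c) = c" if "c \<in> carrier (cohomology L n)" for c
      using homotopic_coh_map[OF cochain_map_comp[OF w w'] idL s that] coh_map_comp[OF w w' that]
        w.K.coh_map_id[OF idL _ that] by simp
    show "coh_map M w n (coh_map L w' n c) = c" if "c \<in> carrier (cohomology M n)" for c
      using homotopic_coh_map[OF cochain_map_comp[OF w' w] idM t that] coh_map_comp[OF w' w that]
        w.L.coh_map_id[OF idM _ that] by simp
  qed
qed

text \<open>\<open>L\<close> and \<open>M\<close> are two models of the same complex, identified by \<open>w\<close>, such that \<open>v\<close> corresponds to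
  multiplication by \<open>m\<close> up to a homotopy \<open>s\<close>. So \<open>K\<close> is a fibre of multiplication by \<open>m\<close> on \<open>M\<close>, and
  exactness is the long exact sequence, with the cohomology of \<open>L\<close> replaced by that of \<open>M\<close>.

  For the splitting, a cocycle \<open>x\<close> of \<open>K\<close> gives the pair \<open>(w (u x), s (u x))\<close>. It satisfies
  \<open>m (w (u x)) = d (s (u x))\<close>, as \<open>v (u x)\<close> and \<open>d (u x)\<close> vanish, and so \<open>hereditary_retraction\<close> applies to it.
  If \<open>u x = d y\<close>, then \<open>x\<close> represents the image of the class of \<open>v y\<close> under the connecting map; the pair
  becomes \<open>(d (w y), s (d y))\<close>, and since \<open>m (w y)\<close> is \<open>v y + s (d y)\<close> up to a coboundary, the
  value there is the class of \<open>v y\<close>. This shows both that the value depends on the class of \<open>x\<close> only and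
  that it is a retraction.\<close>

theorem kummer_split_complexes:
  fixes m :: nat
  assumes ses: "cochain_ses K L M u v" and w: "cochain_map L M w"
    and s: "cochain_homotopy L M (\<lambda>n y. w n y [^]\<^bsub>grp M n\<^esub> m) v s"
    and bij: "\<And>n. bij_betw (coh_map M w n) (carrier (cohomology L n)) (carrier (cohomology M n))"
    and \<beta>: "\<beta> \<in> hom (cohomology K (Suc n)) (cohomology M (Suc n))"
      "\<And>c. c \<in> carrier (cohomology K (Suc n)) \<Longrightarrow> \<beta> c = coh_map M w (Suc n) (coh_map L u (Suc n) c)"
  shows "split_short_exact_groups (quot_by (cohomology M n) m) (cohomology K (Suc n))
    (torsion (cohomology M (Suc n)) m) (\<lambda>c. the_elem (snake K L u v n ` c)) \<beta>"
proof -
  interpret cochain_ses K L M u v by fact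
  interpret w: cochain_map L M w by fact
  let ?N = "(\<lambda>x. x [^]\<^bsub>cohomology M n\<^esub> m) ` carrier (cohomology M n)"
  let ?mw = "\<lambda>n y. w n y [^]\<^bsub>grp M n\<^esub> m"
  interpret mw: cochain_map L M ?mw
    by unfold_locales (auto simp: w.map_dif M.grp.nat_pow_distrib M.dif.hom_nat_pow intro!: homI)
  interpret HG: comm_group "cohomology M k" for k by (rule M.comm_group_cohomology)
  interpret HL: comm_group "cohomology L k" for k by (rule L.comm_group_cohomology)
  interpret HK: comm_group "cohomology K k" for k by (rule K.comm_group_cohomology)
  interpret Hw: group_hom "cohomology L k" "cohomology M k" "coh_map M w k" for k
    using w.coh_map_hom HG.group_axioms HL.group_axioms by (simp add: group_hom_def group_hom_axioms_def)
  have Hv: "coh_map M v k c = coh_map M w k c [^]\<^bsub>cohomology M k\<^esub> m" if c: "c \<in> carrier (cohomology L k)" for k c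
  proof -
    obtain y where y: "y \<in> cocycles L k" "c = coh_class L k y" using c by (auto simp: L.carrier_cohomology)
    have "coh_map M v k c = coh_map M ?mw k c"
      using homotopic_coh_map[OF mw.cochain_map_axioms v.cochain_map_axioms s c] by simp
    then show ?thesis using y mw.coh_map_class w.coh_map_class M.coh_class_pow[OF w.map_cocycle] by simp
  qed
  have w_img: "coh_map M w k ` carrier (cohomology L k) = carrier (cohomology M k)" for k
    using bij by (rule bij_betw_imp_surj_on)
  have w_inj: "inj_on (coh_map M w k) (carrier (cohomology L k))" for k using bij by (rule bij_betw_imp_inj_on)
  have w_one: "coh_map M w k c = \<one>\<^bsub>cohomology M k\<^esub> \<longleftrightarrow> c = \<one>\<^bsub>cohomology L k\<^esub>"
    if "c \<in> carrier (cohomology L k)" for k c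
    using Hw.inj_on_one_iff w_inj that by auto
  have u_carr: "coh_map L u k c \<in> carrier (cohomology L k)" if "c \<in> carrier (cohomology K k)" for k c
    using hom_in_carrier[OF u.coh_map_hom that] .
  have s_hom: "s k \<in> hom (grp L (Suc k)) (grp M k)" for k using s by (simp add: cochain_homotopy_def)
  \<comment> \<open>\<open>\<rho>0\<close> is the retraction on pairs, \<open>\<rho>1\<close> on cocycles of \<open>K\<close> and \<open>\<rho>\<close> on their classes.\<close>
  obtain \<rho>0 where \<rho>0: "\<rho>0 \<in> hom ((grp M (Suc n) \<times>\<times> grp M n)\<lparr>carrier := {(z, y). z \<in> carrier (grp M (Suc n)) \<and>
      y \<in> carrier (grp M n) \<and> z [^]\<^bsub>grp M (Suc n)\<^esub> m = dif M n y}\<rparr>) (quot_by (cohomology M n) m)"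
    "\<And>a y z. \<lbrakk>a \<in> carrier (grp M n); y \<in> carrier (grp M n); z \<in> cocycles M n; a [^]\<^bsub>grp M n\<^esub> m = z \<otimes>\<^bsub>grp M n\<^esub> y\<rbrakk>
       \<Longrightarrow> \<rho>0 (dif M n a, y) = ?N #>\<^bsub>cohomology M n\<^esub> coh_class M n z"
    by (rule hereditary_retraction[where m = m, OF M.grp_comm[of n] M.grp_comm M.comm_group_cohomology M.dif_hom
          M.coh_class_hom[unfolded cocycles_def], folded cocycles_def]) (rule that)
  let ?pr = "\<lambda>x. (w (Suc n) (u (Suc n) x), s n (u (Suc n) x))"
  define \<rho>1 where "\<rho>1 x = \<rho>0 (?pr x)" for x
  have wu_s: "w (Suc n) (u (Suc n) x) [^]\<^bsub>grp M (Suc n)\<^esub> m = dif M n (s n (u (Suc n) x))"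
    "w (Suc n) (u (Suc n) x) \<in> carrier (grp M (Suc n))" "s n (u (Suc n) x) \<in> carrier (grp M n)"
    if x: "x \<in> cocycles K (Suc n)" for x
  proof -
    have xc: "x \<in> carrier (grp K (Suc n))" using K.cocycle_carrier[OF x] .
    have ux: "u (Suc n) x \<in> carrier (grp L (Suc n))" using xc by simp
    show 1: "w (Suc n) (u (Suc n) x) \<in> carrier (grp M (Suc n))" using ux by simp
    show 2: "s n (u (Suc n) x) \<in> carrier (grp M n)" using hom_in_carrier[OF s_hom ux] .
    have s1: "s (Suc n) \<one>\<^bsub>grp L (Suc (Suc n))\<^esub> = \<one>\<^bsub>grp M (Suc n)\<^esub>"
      using hom_one[OF s_hom] L.grp.group_axioms M.grp.group_axioms by blast
    have "w (Suc n) (u (Suc n) x) [^]\<^bsub>grp M (Suc n)\<^esub> m = v (Suc n) (u (Suc n) x) \<otimes>\<^bsub>grp M (Suc n)\<^esub>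
      (s (Suc n) (dif L (Suc n) (u (Suc n) x)) \<otimes>\<^bsub>grp M (Suc n)\<^esub> dif M n (s n (u (Suc n) x)))"
      using s ux unfolding cochain_homotopy_def by blast
    also have "\<dots> = dif M n (s n (u (Suc n) x))"
      using v_u[OF xc] L.cocycle_dif[OF u.map_cocycle[OF x]] s1 M.dif.hom_closed[OF 2] by simp
    finally show "w (Suc n) (u (Suc n) x) [^]\<^bsub>grp M (Suc n)\<^esub> m = dif M n (s n (u (Suc n) x))" .
  qed
  have \<rho>1_mult: "\<rho>1 (x \<otimes>\<^bsub>grp K (Suc n)\<^esub> x') = \<rho>1 x \<otimes>\<^bsub>quot_by (cohomology M n) m\<^esub> \<rho>1 x'"
    if x: "x \<in> cocycles K (Suc n)" and x': "x' \<in> cocycles K (Suc n)" for x x'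
  proof -
    have c: "x \<in> carrier (grp K (Suc n))" "x' \<in> carrier (grp K (Suc n))" using x x' K.cocycle_carrier by auto
    have "?pr (x \<otimes>\<^bsub>grp K (Suc n)\<^esub> x') = ?pr x \<otimes>\<^bsub>grp M (Suc n) \<times>\<times> grp M n\<^esub> ?pr x'"
      using c hom_mult[OF s_hom] by simp
    moreover have "\<rho>0 (?pr x \<otimes>\<^bsub>grp M (Suc n) \<times>\<times> grp M n\<^esub> ?pr x') = \<rho>1 x \<otimes>\<^bsub>quot_by (cohomology M n) m\<^esub> \<rho>1 x'"
      unfolding \<rho>1_def
      using hom_mult[OF \<rho>0(1), of "?pr x" "?pr x'"] wu_s[OF x] wu_s[OF x'] by (simp del: mult_DirProd)
    ultimately show ?thesis unfolding \<rho>1_def by simp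
  qed
  have \<rho>1_carr: "\<rho>1 x \<in> carrier (quot_by (cohomology M n) m)" if x: "x \<in> cocycles K (Suc n)" for x
    unfolding \<rho>1_def by (rule hom_in_carrier[OF \<rho>0(1)]) (use wu_s[OF x] in simp)
  have \<rho>1_snake: "\<rho>1 x = ?N #>\<^bsub>cohomology M n\<^esub> coh_class M n (v n y)"
    if x: "x \<in> cocycles K (Suc n)" and y: "y \<in> carrier (grp L n)" and vy: "v n y \<in> cocycles M n"
      and xy: "u (Suc n) x = dif L n y" for x y
  proof -
    have wy: "w n y \<in> carrier (grp M n)" using y by simp
    have sdy: "s n (dif L n y) \<in> carrier (grp M n)" using wu_s(3)[OF x] xy by simp
    \<comment> \<open>\<open>b\<close> is the term \<open>d (s y)\<close> of the homotopy; it is missing in degree zero.\<close>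
    obtain b where b: "b \<in> coboundaries M n"
      "w n y [^]\<^bsub>grp M n\<^esub> m = v n y \<otimes>\<^bsub>grp M n\<^esub> (s n (dif L n y) \<otimes>\<^bsub>grp M n\<^esub> b)"
    proof (cases n)
      case 0
      then show ?thesis
        using that[of "\<one>\<^bsub>grp M n\<^esub>"] s y sdy unfolding cochain_homotopy_def by (auto simp: coboundaries_def)
    next
      case (Suc k)
      have "s k y \<in> carrier (grp M k)" using hom_in_carrier[OF s_hom] y Suc by blast
      then show ?thesis
        using that[of "dif M k (s k y)"] s y Suc M.dif_coboundary unfolding cochain_homotopy_def by auto
    qed
    have bZ: "b \<in> cocycles M n" using b(1) M.coboundaries_cocycles by blast
    have bc: "b \<in> carrier (grp M n)" "v n y \<in> carrier (grp M n)" using bZ vy M.cocycle_carrier by auto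
    have eq: "w n y [^]\<^bsub>grp M n\<^esub> m = (b \<otimes>\<^bsub>grp M n\<^esub> v n y) \<otimes>\<^bsub>grp M n\<^esub> s n (dif L n y)"
      unfolding b(2) using bc sdy by (simp add: M.grp.m_ac)
    have "\<rho>1 x = \<rho>0 (dif M n (w n y), s n (dif L n y))"
      unfolding \<rho>1_def xy using w.map_dif[OF y] by simp
    also have "\<dots> = ?N #>\<^bsub>cohomology M n\<^esub> coh_class M n (b \<otimes>\<^bsub>grp M n\<^esub> v n y)"
      using \<rho>0(2)[OF wy sdy _ eq] subgroup.m_closed[OF M.subgroup_cocycles bZ vy] by blast
    also have "coh_class M n (b \<otimes>\<^bsub>grp M n\<^esub> v n y) = coh_class M n (v n y)" by (rule M.coh_class_eqI[OF vy b(1) refl])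
    finally show ?thesis .
  qed
  have \<rho>1_cob: "\<rho>1 x = \<one>\<^bsub>quot_by (cohomology M n) m\<^esub>" if x: "x \<in> coboundaries K (Suc n)" for x
  proof -
    obtain k where k: "k \<in> carrier (grp K n)" "x = dif K n k" using x by (auto simp: coboundaries_def)
    have 1: "\<one>\<^bsub>grp M n\<^esub> \<in> cocycles M n" by (rule subgroup.one_closed[OF M.subgroup_cocycles])
    have "\<rho>1 x = ?N #>\<^bsub>cohomology M n\<^esub> coh_class M n (v n (u n k))"
      by (rule \<rho>1_snake) (use x K.coboundaries_cocycles k u.map_dif v_u 1 in auto)
    also have "coh_class M n (v n (u n k)) = \<one>\<^bsub>cohomology M n\<^esub>"
      using v_u[OF k(1)] M.coh_class_eq_one_iff[OF 1] subgroup.one_closed[OF M.subgroup_coboundaries] by simp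
    finally show ?thesis
      using HG.coset_mult_one subgroup.subset[OF HG.subgroup_pow_image] by (simp add: quot_by_def)
  qed
  define \<rho> where "\<rho> c = \<rho>1 (SOME x. x \<in> c)" for c
  have \<rho>: "\<rho> (coh_class K (Suc n) x) = \<rho>1 x" if x: "x \<in> cocycles K (Suc n)" for x
  proof -
    define x' where "x' = (SOME x'. x' \<in> coh_class K (Suc n) x)"
    have "x' \<in> coh_class K (Suc n) x" unfolding x'_def using K.mem_coh_class[OF x] by (rule someI)
    then obtain b where b: "b \<in> coboundaries K (Suc n)" "x' = b \<otimes>\<^bsub>grp K (Suc n)\<^esub> x"
      using K.coh_class_eqD(3) x by blast
    interpret Q: comm_group "quot_by (cohomology M n) m" by (rule comm_group_quot_by[OF HG.comm_group_axioms])
    have "b \<in> cocycles K (Suc n)" using b(1) K.coboundaries_cocycles by blast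
    then have "\<rho>1 x' = \<rho>1 x"
      unfolding b(2) using \<rho>1_mult[OF _ x] \<rho>1_cob[OF b(1)] Q.l_one[OF \<rho>1_carr[OF x]] by simp
    then show ?thesis by (simp add: \<rho>_def x'_def)
  qed
  show ?thesis
  proof (rule kummer_split_group)
    show "snake K L u v n \<in> hom (cohomology M n) (cohomology K (Suc n))" by (rule snake_hom)
    have "coh_map M v n ` carrier (cohomology L n)
        = (\<lambda>x. x [^]\<^bsub>cohomology M n\<^esub> m) ` (coh_map M w n ` carrier (cohomology L n))"
      unfolding image_image using Hv by (intro image_cong) auto
    then show "kernel (cohomology M n) (cohomology K (Suc n)) (snake K L u v n) = ?N"
      unfolding kernel_snake w_img .
    show "\<beta> \<in> hom (cohomology K (Suc n)) (cohomology M (Suc n))" by (rule \<beta>(1))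
    show "snake K L u v n ` carrier (cohomology M n) = kernel (cohomology K (Suc n)) (cohomology M (Suc n)) \<beta>"
      unfolding image_snake using \<beta>(2) w_one u_carr by (auto simp: kernel_def)
    have "\<beta> ` carrier (cohomology K (Suc n)) = coh_map M w (Suc n) ` (coh_map L u (Suc n) ` carrier (cohomology K (Suc n)))"
      unfolding image_image using \<beta>(2) by (intro image_cong) auto
    also have "\<dots> = coh_map M w (Suc n) ` {c \<in> carrier (cohomology L (Suc n)).
        coh_map M w (Suc n) c [^]\<^bsub>cohomology M (Suc n)\<^esub> m = \<one>\<^bsub>cohomology M (Suc n)\<^esub>}"
      unfolding image_coh_map kernel_def by (rule arg_cong[of _ _ "image _"]) (use Hv in auto)
    also have "\<dots> = {d \<in> coh_map M w (Suc n) ` carrier (cohomology L (Suc n)).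
        d [^]\<^bsub>cohomology M (Suc n)\<^esub> m = \<one>\<^bsub>cohomology M (Suc n)\<^esub>}" by blast
    finally show "\<beta> ` carrier (cohomology K (Suc n)) = kernel (cohomology M (Suc n)) (cohomology M (Suc n))
        (\<lambda>x. x [^]\<^bsub>cohomology M (Suc n)\<^esub> m)"
      unfolding w_img kernel_def .
    show "\<rho> \<in> hom (cohomology K (Suc n)) (quot_by (cohomology M n) m)"
    proof (rule homI)
      show "\<rho> c \<in> carrier (quot_by (cohomology M n) m)" if "c \<in> carrier (cohomology K (Suc n))" for c
        using that \<rho> \<rho>1_carr by (auto simp: K.carrier_cohomology)
      fix c c' assume "c \<in> carrier (cohomology K (Suc n))" "c' \<in> carrier (cohomology K (Suc n))"
      then obtain x x' where x: "x \<in> cocycles K (Suc n)" "c = coh_class K (Suc n) x"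
        "x' \<in> cocycles K (Suc n)" "c' = coh_class K (Suc n) x'" by (auto simp: K.carrier_cohomology)
      then show "\<rho> (c \<otimes>\<^bsub>cohomology K (Suc n)\<^esub> c') = \<rho> c \<otimes>\<^bsub>quot_by (cohomology M n) m\<^esub> \<rho> c'"
        using \<rho>1_mult \<rho> subgroup.m_closed[OF K.subgroup_cocycles x(1,3)] by (simp flip: K.coh_class_mult)
    qed
    fix c assume "c \<in> carrier (cohomology M n)"
    then obtain z where z: "z \<in> cocycles M n" "c = coh_class M n z" by (auto simp: M.carrier_cohomology)
    then obtain y x where y: "y \<in> carrier (grp L n)" "v n y = z" "x \<in> cocycles K (Suc n)" "u (Suc n) x = dif L n y"
      using snake_lift by metis
    have "snake K L u v n c = coh_class K (Suc n) x" using snake_class[OF y(1) _ y(3,4)] y(2) z by simp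
    then show "\<rho> (snake K L u v n c) = ?N #>\<^bsub>cohomology M n\<^esub> c"
      using \<rho>[OF y(3)] \<rho>1_snake[OF y(3,1) _ y(4)] y(2) z by simp
  qed (rule HG.comm_group_axioms HK.comm_group_axioms)+
qed

section \<open>Calculus of arrows in an abelian category\<close>

context abelian_category
begin

abbreviation add_arr :: "'b \<Rightarrow> 'b \<Rightarrow> 'b"  (infixl "+\<^sub>C" 65)
  where "f +\<^sub>C g \<equiv> Plus C f g"

definition neg :: "'b \<Rightarrow> 'b"
  where "neg f = inv\<^bsub>hom_group C (Dom C f) (Cod C f)\<^esub> f"

text \<open>Side conditions of the rewrite rules below are phrased with \<open>Arr\<close>, \<open>Dom\<close> and \<open>Cod\<close>, which the
  simplifier can compute, whereas membership in a hom-set would make it guess the objects in between.\<close>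

lemma in_Hom: "f \<in> Hom C A B \<longleftrightarrow> f \<in> Arr C \<and> Dom C f = A \<and> Cod C f = B"
  by (auto simp: Hom_def)

lemma comm_group_Hom: "f \<in> Arr C \<Longrightarrow> comm_group (hom_group C (Dom C f) (Cod C f))"
  by (rule hom_comm_group) (auto intro: dom_in cod_in)

lemma arr_comp:
  assumes "f \<in> Arr C" "g \<in> Arr C" "Dom C g = Cod C f"
  shows "g \<bullet> f \<in> Arr C" "Dom C (g \<bullet> f) = Dom C f" "Cod C (g \<bullet> f) = Cod C g"
  using comp_in[of f "Dom C f" "Cod C f" g "Cod C g"] assms by (auto simp: in_Hom)

lemma arr_id:
  assumes "A \<in> Ob C"
  shows "Idt C A \<in> Arr C" "Dom C (Idt C A) = A" "Cod C (Idt C A) = A"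
  using id_in[OF assms] by (auto simp: in_Hom)

lemma arr_zero:
  assumes "A \<in> Ob C" "B \<in> Ob C"
  shows "Zer C A B \<in> Arr C" "Dom C (Zer C A B) = A" "Cod C (Zer C A B) = B"
proof -
  interpret comm_group "hom_group C A B" using hom_comm_group assms by blast
  show "Zer C A B \<in> Arr C" "Dom C (Zer C A B) = A" "Cod C (Zer C A B) = B"
    using one_closed by (auto simp: hom_group_def in_Hom)
qed

lemma arr_plus:
  assumes "f \<in> Arr C" "g \<in> Arr C" "Dom C g = Dom C f" "Cod C g = Cod C f"
  shows "f +\<^sub>C g \<in> Arr C" "Dom C (f +\<^sub>C g) = Dom C f" "Cod C (f +\<^sub>C g) = Cod C f"
proof -
  interpret comm_group "hom_group C (Dom C f) (Cod C f)" using comm_group_Hom assms by blast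
  show "f +\<^sub>C g \<in> Arr C" "Dom C (f +\<^sub>C g) = Dom C f" "Cod C (f +\<^sub>C g) = Cod C f"
    using m_closed[of f g] assms by (auto simp: hom_group_def in_Hom)
qed

lemma arr_neg:
  assumes "f \<in> Arr C"
  shows "neg f \<in> Arr C" "Dom C (neg f) = Dom C f" "Cod C (neg f) = Cod C f"
proof -
  interpret comm_group "hom_group C (Dom C f) (Cod C f)" using comm_group_Hom assms by blast
  show "neg f \<in> Arr C" "Dom C (neg f) = Dom C f" "Cod C (neg f) = Cod C f"
    using inv_closed[of f] assms by (auto simp: hom_group_def in_Hom neg_def)
qed

lemmas arr_simps = arr_comp arr_id arr_zero arr_plus arr_neg dom_in cod_in

lemma comp_assoc_arr:
  assumes "f \<in> Arr C" "g \<in> Arr C" "h \<in> Arr C" "Dom C g = Cod C f" "Dom C h = Cod C g"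
  shows "(h \<bullet> g) \<bullet> f = h \<bullet> (g \<bullet> f)"
  using comp_assoc[of f "Dom C f" "Cod C f" g "Cod C g" h "Cod C h"] assms by (auto simp: in_Hom)

lemma id_comp_arr: "f \<in> Arr C \<Longrightarrow> Cod C f = B \<Longrightarrow> Idt C B \<bullet> f = f"
  and comp_id_arr: "f \<in> Arr C \<Longrightarrow> Dom C f = A \<Longrightarrow> f \<bullet> Idt C A = f"
  using id_left[of f "Dom C f" "Cod C f"] id_right[of f "Dom C f" "Cod C f"] by (auto simp: in_Hom)

lemma plus_assoc_arr:
  assumes "f \<in> Arr C" "g \<in> Arr C" "h \<in> Arr C" "Dom C g = Dom C f" "Cod C g = Cod C f"
    "Dom C h = Dom C f" "Cod C h = Cod C f"
  shows "(f +\<^sub>C g) +\<^sub>C h = f +\<^sub>C (g +\<^sub>C h)"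
proof -
  interpret comm_group "hom_group C (Dom C f) (Cod C f)" using comm_group_Hom assms by blast
  show ?thesis using m_assoc[of f g h] assms by (simp add: hom_group_def in_Hom)
qed

lemma plus_left_comm_arr:
  assumes "f \<in> Arr C" "g \<in> Arr C" "h \<in> Arr C" "Dom C g = Dom C f" "Cod C g = Cod C f"
    "Dom C h = Dom C f" "Cod C h = Cod C f"
  shows "f +\<^sub>C (g +\<^sub>C h) = g +\<^sub>C (f +\<^sub>C h)"
proof -
  interpret comm_group "hom_group C (Dom C f) (Cod C f)" using comm_group_Hom assms by blast
  show ?thesis using m_lcomm[of f g h] assms by (simp add: hom_group_def in_Hom)
qed

lemma zero_plus_arr:
  assumes "f \<in> Arr C" "Dom C f = A" "Cod C f = B"
  shows "Zer C A B +\<^sub>C f = f" "f +\<^sub>C Zer C A B = f"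
proof -
  interpret comm_group "hom_group C (Dom C f) (Cod C f)" using comm_group_Hom assms by blast
  show "Zer C A B +\<^sub>C f = f" "f +\<^sub>C Zer C A B = f"
    using l_one[of f] r_one[of f] assms by (auto simp: hom_group_def in_Hom)
qed

lemma neg_plus_arr:
  assumes "f \<in> Arr C"
  shows "neg f +\<^sub>C f = Zer C (Dom C f) (Cod C f)" "f +\<^sub>C neg f = Zer C (Dom C f) (Cod C f)"
proof -
  interpret comm_group "hom_group C (Dom C f) (Cod C f)" using comm_group_Hom assms by blast
  show "neg f +\<^sub>C f = Zer C (Dom C f) (Cod C f)" "f +\<^sub>C neg f = Zer C (Dom C f) (Cod C f)"
    using l_inv[of f] r_inv[of f] assms by (auto simp: hom_group_def in_Hom neg_def)
qed

lemma neg_cancel_arr: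
  assumes "f \<in> Arr C" "g \<in> Arr C" "Dom C g = Dom C f" "Cod C g = Cod C f"
  shows "neg f +\<^sub>C (f +\<^sub>C g) = g" "f +\<^sub>C (neg f +\<^sub>C g) = g"
  using assms plus_assoc_arr[of "neg f" f g] plus_assoc_arr[of f "neg f" g]
  by (auto simp: arr_simps neg_plus_arr zero_plus_arr)

lemma plus_diff_arr:
  assumes "f \<in> Arr C" "g \<in> Arr C" "Dom C g = Dom C f" "Cod C g = Cod C f"
  shows "g +\<^sub>C (f +\<^sub>C neg g) = f"
  using assms plus_left_comm_arr[of g f "neg g"] by (simp add: arr_simps neg_plus_arr zero_plus_arr)

lemma comp_plus_arr:
  assumes "f \<in> Arr C" "g \<in> Arr C" "h \<in> Arr C" "Dom C g = Dom C f" "Cod C g = Cod C f" "Dom C h = Cod C f"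
  shows "h \<bullet> (f +\<^sub>C g) = h \<bullet> f +\<^sub>C h \<bullet> g"
  using comp_plus_right[of f "Dom C f" "Cod C f" g h "Cod C h"] assms by (auto simp: in_Hom)

lemma plus_comp_arr:
  assumes "f \<in> Arr C" "g \<in> Arr C" "h \<in> Arr C" "Dom C g = Dom C f" "Cod C g = Cod C f" "Cod C h = Dom C f"
  shows "(f +\<^sub>C g) \<bullet> h = f \<bullet> h +\<^sub>C g \<bullet> h"
  using comp_plus_left[of h "Dom C h" "Cod C h" f "Cod C f" g] assms by (auto simp: in_Hom)

lemma comp_zero_arr:
  assumes "A \<in> Ob C" "g \<in> Arr C" "Dom C g = B"
  shows "g \<bullet> Zer C A B = Zer C A (Cod C g)"
  using comp_zero[of A g B "Cod C g"] assms by (simp add: in_Hom)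

lemma plus_self_zero:
  assumes "f \<in> Arr C" "f +\<^sub>C f = f"
  shows "f = Zer C (Dom C f) (Cod C f)"
  using neg_cancel_arr(1)[of f f] neg_plus_arr(1)[of f] assms by simp

lemma zero_comp_arr:
  assumes "B \<in> Ob C" "g \<in> Arr C" "Cod C g = A"
  shows "Zer C A B \<bullet> g = Zer C (Dom C g) B"
proof -
  have A: "A \<in> Ob C" using assms cod_in by blast
  have "(Zer C A B +\<^sub>C Zer C A B) \<bullet> g = Zer C A B \<bullet> g" using assms A by (simp add: zero_plus_arr arr_simps)
  then have "Zer C A B \<bullet> g +\<^sub>C Zer C A B \<bullet> g = Zer C A B \<bullet> g"
    using assms A by (simp add: plus_comp_arr arr_simps)
  then show ?thesis using plus_self_zero[of "Zer C A B \<bullet> g"] assms A by (simp add: arr_simps)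
qed

lemma neg_unique:
  assumes "f \<in> Arr C" "g \<in> Arr C" "Dom C g = Dom C f" "Cod C g = Cod C f"
    and "f +\<^sub>C g = Zer C (Dom C f) (Cod C f)"
  shows "g = neg f"
proof -
  have "g = neg f +\<^sub>C (f +\<^sub>C g)" using assms(1-4) by (simp add: neg_cancel_arr)
  also have "\<dots> = neg f" unfolding assms(5) using assms(1) by (simp add: arr_simps zero_plus_arr)
  finally show ?thesis .
qed

lemma comp_neg_arr:
  assumes "f \<in> Arr C" "g \<in> Arr C" "Dom C g = Cod C f"
  shows "g \<bullet> neg f = neg (g \<bullet> f)"
proof (rule neg_unique)
  show "g \<bullet> f +\<^sub>C g \<bullet> neg f = Zer C (Dom C (g \<bullet> f)) (Cod C (g \<bullet> f))"
    using assms comp_plus_arr[of f "neg f" g] by (simp add: arr_simps neg_plus_arr comp_zero_arr)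
qed (use assms in \<open>auto simp: arr_simps\<close>)

lemma neg_comp_arr:
  assumes "f \<in> Arr C" "g \<in> Arr C" "Dom C g = Cod C f"
  shows "neg g \<bullet> f = neg (g \<bullet> f)"
proof (rule neg_unique)
  have "g \<bullet> f +\<^sub>C neg g \<bullet> f = (g +\<^sub>C neg g) \<bullet> f"
    by (rule plus_comp_arr[symmetric]) (use assms in \<open>auto simp: arr_simps\<close>)
  also have "\<dots> = Zer C (Dom C g) (Cod C g) \<bullet> f" using assms(2) by (simp only: neg_plus_arr)
  also have "\<dots> = Zer C (Dom C f) (Cod C g)"
    by (rule zero_comp_arr) (use assms in \<open>auto simp: arr_simps\<close>)
  finally show "g \<bullet> f +\<^sub>C neg g \<bullet> f = Zer C (Dom C (g \<bullet> f)) (Cod C (g \<bullet> f))"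
    using assms by (simp add: arr_simps)
qed (use assms in \<open>auto simp: arr_simps\<close>)

lemma neg_zero_arr:
  assumes "A \<in> Ob C" "B \<in> Ob C"
  shows "neg (Zer C A B) = Zer C A B"
  using neg_unique[of "Zer C A B" "Zer C A B"] assms by (simp add: arr_simps zero_plus_arr)

lemma neg_neg_arr: "f \<in> Arr C \<Longrightarrow> neg (neg f) = f"
  using neg_unique[of "neg f" f] by (simp add: arr_simps neg_plus_arr)

lemma eq_of_diff_zero:
  assumes "f \<in> Arr C" "g \<in> Arr C" "Dom C g = Dom C f" "Cod C g = Cod C f"
    and "f +\<^sub>C neg g = Zer C A B" "Dom C f = A" "Cod C f = B"
  shows "f = g"
proof -
  have "neg g = neg f" by (rule neg_unique) (use assms in \<open>auto simp: arr_simps\<close>)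
  then have "neg (neg g) = neg (neg f)" by (rule arg_cong)
  then show ?thesis using assms(1,2) by (simp only: neg_neg_arr)
qed

text \<open>Composites are normalised to nest to the right, so that an equation between composites
  of two arrows has to be available with a further arrow on the right as well.\<close>

lemma comp_reassoc:
  assumes "g \<bullet> f = k" "f \<in> Arr C" "g \<in> Arr C" "x \<in> Arr C" "Dom C g = Cod C f" "Dom C f = Cod C x"
  shows "g \<bullet> (f \<bullet> x) = k \<bullet> x"
  using comp_assoc_arr[of x f g] assms by simp

lemmas cat_simps = arr_simps comp_assoc_arr id_comp_arr comp_id_arr plus_assoc_arr zero_plus_arr
  neg_plus_arr neg_cancel_arr comp_plus_arr plus_comp_arr comp_zero_arr zero_comp_arr
  comp_neg_arr neg_comp_arr neg_zero_arr neg_neg_arr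

lemma monicI_zero:
  assumes "j \<in> Arr C"
    and "\<And>X x. \<lbrakk>x \<in> Hom C X (Dom C j); j \<bullet> x = Zer C X (Cod C j)\<rbrakk> \<Longrightarrow> x = Zer C X (Dom C j)"
  shows "monic C j"
  unfolding monic_def
proof (intro conjI allI ballI impI)
  fix X g h assume gh: "g \<in> Hom C X (Dom C j)" "h \<in> Hom C X (Dom C j)" "j \<bullet> g = j \<bullet> h"
  have "j \<bullet> (g +\<^sub>C neg h) = Zer C X (Cod C j)"
    using gh assms(1) by (simp add: in_Hom cat_simps)
  then have "g +\<^sub>C neg h = Zer C X (Dom C j)"
    using gh by (intro assms(2)) (auto simp: in_Hom cat_simps)
  then show "g = h" by (rule eq_of_diff_zero[rotated 4]) (use gh(1,2) in \<open>auto simp: in_Hom\<close>)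
qed (rule assms(1))

lemma epicD_zero:
  assumes "epic C e" "g \<in> Arr C" "Dom C g = Cod C e" "g \<bullet> e = Zer C (Dom C e) (Cod C g)"
  shows "g = Zer C (Cod C e) (Cod C g)"
proof -
  have e: "e \<in> Arr C" using assms(1) by (simp add: epic_def)
  have "g \<bullet> e = Zer C (Cod C e) (Cod C g) \<bullet> e" using assms e by (simp add: cat_simps)
  then show ?thesis
    using assms(1-3) e arr_zero[of "Cod C e" "Cod C g"] unfolding epic_def by (auto simp: in_Hom arr_simps)
qed

lemma epicD:
  assumes "epic C e" "g \<in> Arr C" "h \<in> Arr C" "Dom C g = Cod C e" "Dom C h = Cod C e"
    "Cod C g = Cod C h" "g \<bullet> e = h \<bullet> e"
  shows "g = h"
proof -
  have "g \<in> Hom C (Cod C e) (Cod C h)" "h \<in> Hom C (Cod C e) (Cod C h)"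
    using assms(2-6) by (simp_all add: in_Hom)
  then show ?thesis using assms(1,7) unfolding epic_def by blast
qed

lemma monicD:
  assumes "monic C j" "g \<in> Arr C" "h \<in> Arr C" "Cod C g = Dom C j" "Cod C h = Dom C j"
    "Dom C g = Dom C h" "j \<bullet> g = j \<bullet> h"
  shows "g = h"
proof -
  have "g \<in> Hom C (Dom C h) (Dom C j)" "h \<in> Hom C (Dom C h) (Dom C j)"
    using assms(2-6) by (simp_all add: in_Hom)
  then show ?thesis using assms(1,7) unfolding monic_def by blast
qed

lemma cokernel_epic:
  assumes "is_cokernel C c f"
  shows "epic C c"
  unfolding epic_def
proof (intro conjI allI ballI impI)
  show c: "c \<in> Arr C" using assms by (simp add: is_cokernel_def)
  have f: "f \<in> Arr C" "Dom C c = Cod C f" "c \<bullet> f = Zer C (Dom C f) (Cod C c)"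
    using assms by (auto simp: is_cokernel_def)
  fix X g h assume gh: "g \<in> Hom C (Cod C c) X" "h \<in> Hom C (Cod C c) X" "g \<bullet> c = h \<bullet> c"
  have "g \<bullet> c \<in> Hom C (Cod C f) X" "(g \<bullet> c) \<bullet> f = Zer C (Dom C f) X"
    using gh c f by (auto simp: in_Hom cat_simps)
  then have "\<exists>!u. u \<in> Hom C (Cod C c) X \<and> u \<bullet> c = g \<bullet> c" using assms unfolding is_cokernel_def by blast
  then show "g = h" using gh by metis
qed

lemma kernel_monic:
  assumes "is_kernel C k f"
  shows "monic C k"
  unfolding monic_def
proof (intro conjI allI ballI impI)
  show k: "k \<in> Arr C" using assms by (simp add: is_kernel_def)
  have f: "f \<in> Arr C" "Cod C k = Dom C f" "f \<bullet> k = Zer C (Dom C k) (Cod C f)"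
    using assms by (auto simp: is_kernel_def)
  fix X g h assume gh: "g \<in> Hom C X (Dom C k)" "h \<in> Hom C X (Dom C k)" "k \<bullet> g = k \<bullet> h"
  have "k \<bullet> g \<in> Hom C X (Dom C f)" using gh k f by (auto simp: in_Hom cat_simps)
  moreover have "f \<bullet> (k \<bullet> g) = Zer C X (Cod C f)"
    using gh k f comp_reassoc[OF f(3), of g] by (auto simp: in_Hom cat_simps)
  ultimately have "\<exists>!u. u \<in> Hom C X (Dom C k) \<and> k \<bullet> u = k \<bullet> g" using assms unfolding is_kernel_def by blast
  then show "g = h" using gh by metis
qed

lemma kernel_factor:
  assumes "is_kernel C k f" "x \<in> Arr C" "Cod C x = Dom C f" "f \<bullet> x = Zer C (Dom C x) (Cod C f)"
  obtains y where "y \<in> Arr C" "Dom C y = Dom C x" "Cod C y = Dom C k" "k \<bullet> y = x"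
proof -
  have "\<exists>!u. u \<in> Hom C (Dom C x) (Dom C k) \<and> k \<bullet> u = x"
    using assms unfolding is_kernel_def by (auto simp: in_Hom)
  then show thesis using that by (auto simp: in_Hom)
qed

lemma cokernel_factor:
  assumes "is_cokernel C c f" "x \<in> Arr C" "Dom C x = Cod C f" "x \<bullet> f = Zer C (Dom C f) (Cod C x)"
  obtains y where "y \<in> Arr C" "Dom C y = Cod C c" "Cod C y = Cod C x" "y \<bullet> c = x"
proof -
  have "\<exists>!u. u \<in> Hom C (Cod C c) (Cod C x) \<and> u \<bullet> c = x"
    using assms unfolding is_cokernel_def by (auto simp: in_Hom)
  then show thesis using that by (auto simp: in_Hom)
qed

lemma injective_extend:
  assumes "injective_object C E" "monic C f" "g \<in> Arr C" "Dom C g = Dom C f" "Cod C g = E"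
  obtains h where "h \<in> Arr C" "Dom C h = Cod C f" "Cod C h = E" "h \<bullet> f = g"
proof -
  have "g \<in> Hom C (Dom C f) E" using assms(3-5) by (simp add: in_Hom)
  then have "\<exists>h \<in> Hom C (Cod C f) E. h \<bullet> f = g" using assms(1,2) unfolding injective_object_def by blast
  then show thesis using that by (auto simp: in_Hom)
qed

text \<open>The canonical map from the coimage of \<open>g\<close> is monic. If \<open>j\<close> kills \<open>x\<close>, then \<open>j\<close>, and with it \<open>g\<close>,
  factors through the cokernel \<open>q\<close> of \<open>x\<close>. Hence the kernel of \<open>q c\<close> lies in that of \<open>g\<close>, which is
  the kernel of \<open>c\<close>; as the epimorphism \<open>q c\<close> is the cokernel of its kernel, \<open>c\<close> factors through
  \<open>q c\<close>. So \<open>q\<close> is split monic and \<open>x\<close> vanishes.\<close>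

lemma monic_coimage:
  assumes c: "is_cokernel C c f" and kc: "is_kernel C k c" and kg: "is_kernel C k g"
    and j: "j \<in> Arr C" "Dom C j = Cod C c" "j \<bullet> c = g"
  shows "monic C j"
proof (rule monicI_zero[OF j(1)])
  fix X x assume "x \<in> Hom C X (Dom C j)" "j \<bullet> x = Zer C X (Cod C j)"
  then have x: "x \<in> Arr C" "Dom C x = X" "Cod C x = Dom C j" "j \<bullet> x = Zer C X (Cod C j)" by (auto simp: in_Hom)
  have cA: "c \<in> Arr C" using c by (simp add: is_cokernel_def)
  obtain q where q: "is_cokernel C q x" using cokernels x(1) by blast
  have qA: "q \<in> Arr C" "Dom C q = Dom C j" "q \<bullet> x = Zer C X (Cod C q)" using q x by (auto simp: is_cokernel_def)
  obtain j' where j': "j' \<in> Arr C" "Dom C j' = Cod C q" "Cod C j' = Cod C j" "j' \<bullet> q = j"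
    using cokernel_factor[OF q j(1)] x by auto
  have e: "epic C (q \<bullet> c)"
    unfolding epic_def
  proof (intro conjI allI ballI impI)
    show "q \<bullet> c \<in> Arr C" using qA cA j by (simp add: cat_simps)
    fix Y s t assume st: "s \<in> Hom C (Cod C (q \<bullet> c)) Y" "t \<in> Hom C (Cod C (q \<bullet> c)) Y" "s \<bullet> (q \<bullet> c) = t \<bullet> (q \<bullet> c)"
    have s: "s \<in> Arr C" "Dom C s = Cod C q" "t \<in> Arr C" "Dom C t = Cod C q" "Cod C s = Cod C t"
      using st qA cA j by (auto simp: in_Hom cat_simps)
    have "(s \<bullet> q) \<bullet> c = (t \<bullet> q) \<bullet> c" using s st(3) qA cA j by (simp add: cat_simps)
    then have "s \<bullet> q = t \<bullet> q"
      by (rule epicD[OF cokernel_epic[OF c], rotated -1]) (use s qA j in \<open>auto simp: cat_simps\<close>)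
    then show "s = t"
      by (rule epicD[OF cokernel_epic[OF q], rotated -1]) (use s in auto)
  qed
  then have eA: "q \<bullet> c \<in> Arr C" by (simp add: epic_def)
  obtain h where h: "is_kernel C h (q \<bullet> c)" using kernels eA by blast
  have hA: "h \<in> Arr C" "Cod C h = Dom C c" "q \<bullet> (c \<bullet> h) = Zer C (Dom C h) (Cod C q)"
    using h qA cA j by (auto simp: is_kernel_def cat_simps)
  have hc: "is_cokernel C (q \<bullet> c) h" using epic_normal[OF e h] .
  have "g \<bullet> h = j' \<bullet> (q \<bullet> (c \<bullet> h))"
    unfolding j(3)[symmetric] j'(4)[symmetric] using j'(1-3) qA(1,2) cA hA(1,2) j(1,2) by (simp add: cat_simps)
  also have "\<dots> = Zer C (Dom C h) (Cod C j)" unfolding hA(3) using hA(1) j' by (simp add: cat_simps)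
  finally have gh: "g \<bullet> h = Zer C (Dom C h) (Cod C g)" using j cA by (auto simp: cat_simps)
  have "Cod C h = Dom C g" using hA j cA by (auto simp: cat_simps)
  then obtain h' where h': "h' \<in> Arr C" "Dom C h' = Dom C h" "Cod C h' = Dom C k" "k \<bullet> h' = h"
    using kernel_factor[OF kg hA(1) _ gh] by metis
  have k: "k \<in> Arr C" "Cod C k = Dom C c" "c \<bullet> k = Zer C (Dom C k) (Cod C c)" using kc by (auto simp: is_kernel_def)
  have "c \<bullet> h = Zer C (Dom C h) (Cod C c)"
    unfolding h'(4)[symmetric] using comp_reassoc[OF k(3), of h'] h'(1-3) k cA by (simp add: cat_simps)
  then obtain r where r: "r \<in> Arr C" "Dom C r = Cod C (q \<bullet> c)" "Cod C r = Cod C c" "r \<bullet> (q \<bullet> c) = c"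
    using cokernel_factor[OF hc cA] hA by auto
  have rD: "Dom C r = Cod C q" using r(2) qA cA j by (simp add: cat_simps)
  have "(r \<bullet> q) \<bullet> c = Idt C (Cod C c) \<bullet> c" using r rD qA cA j by (simp add: cat_simps)
  then have rq: "r \<bullet> q = Idt C (Cod C c)"
    by (rule epicD[OF cokernel_epic[OF c], rotated -1]) (use r rD qA cA j in \<open>auto simp: cat_simps\<close>)
  have "x = Idt C (Cod C c) \<bullet> x" using x j by (simp add: cat_simps)
  also have "\<dots> = r \<bullet> (q \<bullet> x)" unfolding rq[symmetric] using r rD qA x by (simp add: cat_simps)
  also have "\<dots> = Zer C X (Dom C j)" unfolding qA(3) using r rD x j by (auto simp: cat_simps)
  finally show "x = Zer C X (Dom C j)" .
qed

section \<open>Exactness tested on injective objects\<close>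

text \<open>In a category with enough injectives, \<open>A \<rightarrow> B \<rightarrow> D\<close> is exact if and only if
  \<open>Hom(D, E) \<rightarrow> Hom(B, E) \<rightarrow> Hom(A, E)\<close> is for every injective \<open>E\<close>. This allows chasing arrows
  into injective objects as if they were elements, and the tested property is the very one by which
  maps between resolutions are constructed.\<close>

lemma exact_at_comp:
  assumes "exact_at C f g"
  shows "f \<in> Arr C" "g \<in> Arr C" "Dom C g = Cod C f" "g \<bullet> f = Zer C (Dom C f) (Cod C g)"
proof -
  obtain k c where k: "is_cokernel C c f" "is_kernel C k c" "is_kernel C k g"
    using assms by (auto simp: exact_at_def is_image_def)
  show f: "f \<in> Arr C" using k by (simp add: is_cokernel_def)
  show g: "g \<in> Arr C" using k by (simp add: is_kernel_def)
  show "Dom C g = Cod C f" using k by (simp add: is_kernel_def is_cokernel_def)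
  obtain f' where f': "f' \<in> Arr C" "Dom C f' = Dom C f" "Cod C f' = Dom C k" "k \<bullet> f' = f"
    by (rule kernel_factor[OF k(2) f]) (use k(1) in \<open>auto simp: is_cokernel_def\<close>)
  have kA: "k \<in> Arr C" "Cod C k = Dom C g" "g \<bullet> k = Zer C (Dom C k) (Cod C g)" using k(3) by (auto simp: is_kernel_def)
  have "g \<bullet> (k \<bullet> f') = Zer C (Dom C k) (Cod C g) \<bullet> f'"
    by (rule comp_reassoc[OF kA(3)]) (use kA f' g in auto)
  then show "g \<bullet> f = Zer C (Dom C f) (Cod C g)"
    unfolding f'(4) using kA f'(1-3) g by (simp add: cat_simps)
qed

lemma exact_at_extend:
  assumes ex: "exact_at C f g" and E: "injective_object C E"
    and \<phi>: "\<phi> \<in> Arr C" "Dom C \<phi> = Cod C f" "Cod C \<phi> = E" "\<phi> \<bullet> f = Zer C (Dom C f) E"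
  obtains \<psi> where "\<psi> \<in> Arr C" "Dom C \<psi> = Cod C g" "Cod C \<psi> = E" "\<psi> \<bullet> g = \<phi>"
proof -
  obtain k c where k: "is_cokernel C c f" "is_kernel C k c" "is_kernel C k g"
    using ex by (auto simp: exact_at_def is_image_def)
  note g = exact_at_comp[OF ex]
  have cA: "c \<in> Arr C" "Dom C c = Cod C f" using k by (auto simp: is_cokernel_def)
  obtain j where j: "j \<in> Arr C" "Dom C j = Cod C c" "Cod C j = Cod C g" "j \<bullet> c = g"
    using cokernel_factor[OF k(1) g(2-4)] by metis
  have jm: "monic C j" using monic_coimage[OF k j(1,2,4)] .
  obtain \<phi>' where \<phi>': "\<phi>' \<in> Arr C" "Dom C \<phi>' = Cod C c" "Cod C \<phi>' = E" "\<phi>' \<bullet> c = \<phi>"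
    using cokernel_factor[OF k(1) \<phi>(1,2)] \<phi>(3,4) by auto
  obtain \<psi> where \<psi>: "\<psi> \<in> Arr C" "Dom C \<psi> = Cod C j" "Cod C \<psi> = E" "\<psi> \<bullet> j = \<phi>'"
    using injective_extend[OF E jm \<phi>'(1)] \<phi>' j by auto
  have "\<psi> \<bullet> g = \<phi>"
    unfolding j(4)[symmetric] using comp_assoc_arr[of c j \<psi>] j(1-3) \<psi> cA \<phi>'(4) by simp
  then show thesis using that \<psi> j by auto
qed

lemma monicI_extend:
  assumes enough: "enough_injectives C" and f: "f \<in> Arr C"
    and ext: "\<And>E \<phi>. \<lbrakk>injective_object C E; \<phi> \<in> Arr C; Dom C \<phi> = Dom C f; Cod C \<phi> = E\<rbrakk>
      \<Longrightarrow> \<exists>\<psi> \<in> Arr C. Dom C \<psi> = Cod C f \<and> Cod C \<psi> = E \<and> \<psi> \<bullet> f = \<phi>"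
  shows "monic C f"
proof -
  obtain e where e: "monic C e" "Dom C e = Dom C f" "injective_object C (Cod C e)"
    using enough dom_in[OF f] by (auto simp: enough_injectives_def)
  have eA: "e \<in> Arr C" using e by (simp add: monic_def)
  obtain \<psi> where \<psi>: "\<psi> \<in> Arr C" "Dom C \<psi> = Cod C f" "Cod C \<psi> = Cod C e" "\<psi> \<bullet> f = e"
    using ext[OF e(3) eA e(2) refl] by auto
  show ?thesis
    unfolding monic_def
  proof (intro conjI allI ballI impI f)
    fix X g h assume gh: "g \<in> Hom C X (Dom C f)" "h \<in> Hom C X (Dom C f)" "f \<bullet> g = f \<bullet> h"
    have "(\<psi> \<bullet> f) \<bullet> g = (\<psi> \<bullet> f) \<bullet> h" using gh \<psi>(1,2) f by (simp add: in_Hom comp_assoc_arr)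
    then show "g = h" unfolding \<psi>(4) using monicD[OF e(1)] gh e(2) by (auto simp: in_Hom)
  qed
qed

lemma exact_atI_extend:
  assumes enough: "enough_injectives C" and f: "f \<in> Arr C" and g: "g \<in> Arr C" "Dom C g = Cod C f"
    and gf: "g \<bullet> f = Zer C (Dom C f) (Cod C g)"
    and ext: "\<And>E \<phi>. \<lbrakk>injective_object C E; \<phi> \<in> Arr C; Dom C \<phi> = Cod C f; Cod C \<phi> = E; \<phi> \<bullet> f = Zer C (Dom C f) E\<rbrakk>
      \<Longrightarrow> \<exists>\<psi> \<in> Arr C. Dom C \<psi> = Cod C g \<and> Cod C \<psi> = E \<and> \<psi> \<bullet> g = \<phi>"
  shows "exact_at C f g"
proof -
  obtain c where c: "is_cokernel C c f" using cokernels f by blast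
  have cA: "c \<in> Arr C" "Dom C c = Cod C f" "c \<bullet> f = Zer C (Dom C f) (Cod C c)" using c by (auto simp: is_cokernel_def)
  obtain k where k: "is_kernel C k c" using kernels cA(1) by blast
  have kA: "k \<in> Arr C" "Cod C k = Dom C c" "c \<bullet> k = Zer C (Dom C k) (Cod C c)" using k by (auto simp: is_kernel_def)
  obtain j where j: "j \<in> Arr C" "Dom C j = Cod C c" "Cod C j = Cod C g" "j \<bullet> c = g"
    using cokernel_factor[OF c g gf] by metis
  obtain e where e: "monic C e" "Dom C e = Cod C c" "injective_object C (Cod C e)"
    using enough cod_in[OF cA(1)] by (auto simp: enough_injectives_def)
  have eA: "e \<in> Arr C" using e by (simp add: monic_def)
  have "(e \<bullet> c) \<bullet> f = Zer C (Dom C f) (Cod C e)" using f e eA cA by (simp add: cat_simps)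
  then obtain \<psi> where \<psi>: "\<psi> \<in> Arr C" "Dom C \<psi> = Cod C g" "Cod C \<psi> = Cod C e" "\<psi> \<bullet> g = e \<bullet> c"
    using ext[OF e(3), of "e \<bullet> c"] e eA cA by (auto simp: cat_simps)
  have zero_iff: "c \<bullet> x = Zer C (Dom C x) (Cod C c) \<longleftrightarrow> g \<bullet> x = Zer C (Dom C x) (Cod C g)"
    if x: "x \<in> Arr C" "Cod C x = Dom C g" for x
  proof
    assume "c \<bullet> x = Zer C (Dom C x) (Cod C c)"
    then show "g \<bullet> x = Zer C (Dom C x) (Cod C g)"
      unfolding j(4)[symmetric] using j(1-3) x g cA by (simp add: cat_simps)
  next
    assume 0: "g \<bullet> x = Zer C (Dom C x) (Cod C g)"
    have "e \<bullet> (c \<bullet> x) = \<psi> \<bullet> (g \<bullet> x)"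
      using comp_reassoc[OF \<psi>(4), of x] \<psi> x g cA e eA by (simp add: comp_assoc_arr)
    also have "\<dots> = e \<bullet> Zer C (Dom C x) (Cod C c)"
      unfolding 0 using \<psi> x e eA by (simp add: cat_simps)
    finally show "c \<bullet> x = Zer C (Dom C x) (Cod C c)"
      by (rule monicD[OF e(1), rotated -1]) (use x g cA e in \<open>auto simp: cat_simps\<close>)
  qed
  have "is_kernel C k g"
    unfolding is_kernel_def
  proof (intro conjI allI ballI impI)
    show "Cod C k = Dom C g" using kA cA g by simp
    then show "g \<bullet> k = Zer C (Dom C k) (Cod C g)" using zero_iff[of k] kA(1,3) by simp
    fix X x assume x: "x \<in> Hom C X (Dom C g)" "g \<bullet> x = Zer C X (Cod C g)"
    then have "x \<in> Hom C X (Dom C c)" "c \<bullet> x = Zer C X (Cod C c)"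
      using zero_iff[of x] g cA by (auto simp: in_Hom)
    then show "\<exists>!u. u \<in> Hom C X (Dom C k) \<and> k \<bullet> u = x" using k unfolding is_kernel_def by blast
  qed (use g kA in auto)
  then show ?thesis using c k unfolding exact_at_def is_image_def by blast
qed

section \<open>Exactness of the middle row\<close>

text \<open>Two cases of the three by three lemma, by chasing an arrow \<open>\<phi>\<close> into an injective object: restrict \<open>\<phi>\<close> to
  the subobject row, extend the restriction there, correct \<open>\<phi>\<close> by the extension, and treat the
  remaining map, which comes from the quotient row, in the same way.\<close>

lemma monic_of_short_exact_rows:
  assumes enough: "enough_injectives C"
    and row: "exact_at C i q" and i'': "monic C i''"
    and a: "monic C a" and c: "monic C c"
    and b: "b \<in> Arr C" "b \<bullet> i = i'' \<bullet> a" "q'' \<bullet> b = c \<bullet> q"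
    and types: "Dom C a = Dom C i" "Cod C a = Dom C i''" "Dom C b = Cod C i" "Cod C b = Cod C i''"
      "q'' \<in> Arr C" "Dom C q'' = Cod C b" "Cod C q'' = Cod C c" "Dom C c = Cod C q"
  shows "monic C b"
proof (rule monicI_extend[OF enough b(1)])
  fix E \<phi> assume E: "injective_object C E" and \<phi>: "\<phi> \<in> Arr C" "Dom C \<phi> = Dom C b" "Cod C \<phi> = E"
  note iq = exact_at_comp[OF row]
  have arr: "i'' \<in> Arr C" "a \<in> Arr C" "c \<in> Arr C" using i'' a c by (auto simp: monic_def)
  obtain \<alpha> where \<alpha>: "\<alpha> \<in> Arr C" "Dom C \<alpha> = Cod C a" "Cod C \<alpha> = E" "\<alpha> \<bullet> a = \<phi> \<bullet> i"
    by (rule injective_extend[OF E a, of "\<phi> \<bullet> i"]) (use \<phi> iq types in \<open>auto simp: cat_simps\<close>)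
  obtain \<beta> where \<beta>: "\<beta> \<in> Arr C" "Dom C \<beta> = Cod C i''" "Cod C \<beta> = E" "\<beta> \<bullet> i'' = \<alpha>"
    by (rule injective_extend[OF E i'', of \<alpha>]) (use \<alpha> types in auto)
  let ?\<phi> = "\<phi> +\<^sub>C neg (\<beta> \<bullet> b)"
  have "(\<beta> \<bullet> b) \<bullet> i = \<beta> \<bullet> (i'' \<bullet> a)" using b \<beta>(1,2) iq types by (simp add: comp_assoc_arr)
  also have "\<dots> = \<phi> \<bullet> i" using comp_reassoc[OF \<beta>(4), of a] \<alpha> \<beta>(1,2) arr types by simp
  finally have 1: "\<beta> \<bullet> (b \<bullet> i) = \<phi> \<bullet> i" using b \<beta>(1,2) iq types by (simp add: comp_assoc_arr)
  have "?\<phi> \<bullet> i = \<phi> \<bullet> i +\<^sub>C neg (\<beta> \<bullet> (b \<bullet> i))" using \<phi> \<beta>(1-3) b(1) iq types by (simp add: cat_simps)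
  also have "\<dots> = Zer C (Dom C i) E" unfolding 1 using \<phi> iq types by (simp add: cat_simps)
  finally have 2: "?\<phi> \<bullet> i = Zer C (Dom C i) E" .
  obtain \<chi> where \<chi>: "\<chi> \<in> Arr C" "Dom C \<chi> = Cod C q" "Cod C \<chi> = E" "\<chi> \<bullet> q = ?\<phi>"
    by (rule exact_at_extend[OF row E _ _ _ 2]) (use \<phi> \<beta>(1-3) b(1) types in \<open>auto simp: cat_simps\<close>)
  obtain \<psi> where \<psi>: "\<psi> \<in> Arr C" "Dom C \<psi> = Cod C c" "Cod C \<psi> = E" "\<psi> \<bullet> c = \<chi>"
    by (rule injective_extend[OF E c, of \<chi>]) (use \<chi> types in auto)
  have "(\<psi> \<bullet> q'') \<bullet> b = \<psi> \<bullet> (c \<bullet> q)" using \<psi>(1,2) b types by (simp add: comp_assoc_arr)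
  also have "\<dots> = ?\<phi>" using comp_reassoc[OF \<psi>(4), of q] \<psi>(1,2) \<chi>(4) arr iq types by simp
  finally have "(\<beta> +\<^sub>C \<psi> \<bullet> q'') \<bullet> b = \<beta> \<bullet> b +\<^sub>C ?\<phi>"
    using \<beta>(1-3) \<psi>(1-3) b(1) types by (simp add: arr_simps plus_comp_arr)
  also have "\<dots> = \<phi>"
    using \<phi> \<beta>(1-3) b(1) types by (simp add: plus_diff_arr arr_simps)
  finally show "\<exists>\<psi>\<in>Arr C. Dom C \<psi> = Cod C b \<and> Cod C \<psi> = E \<and> \<psi> \<bullet> b = \<phi>"
    using \<beta>(1-3) \<psi>(1-3) types by (intro bexI[of _ "\<beta> +\<^sub>C \<psi> \<bullet> q''"]) (auto simp: cat_simps)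
qed

lemma exact_at_of_short_exact_rows:
  assumes enough: "enough_injectives C"
    and row: "exact_at C i q" and i'': "monic C i''" and e': "epic C e'"
    and a: "exact_at C a' a" and c: "exact_at C c' c"
    and b: "b \<in> Arr C" "b' \<in> Arr C" "b \<bullet> b' = Zer C (Dom C b') (Cod C b)"
    and comm: "b' \<bullet> i' = i \<bullet> a'" "b \<bullet> i = i'' \<bullet> a" "q \<bullet> b' = c' \<bullet> e'" "q'' \<bullet> b = c \<bullet> q"
    and types: "Cod C b' = Dom C b" "Dom C b = Cod C i" "Cod C b = Cod C i''" "i' \<in> Arr C" "Cod C i' = Dom C b'"
      "Dom C i' = Dom C a'" "Cod C a' = Dom C i" "Cod C a = Dom C i''"
      "Dom C e' = Dom C b'" "Cod C e' = Dom C c'" "Cod C c' = Cod C q"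
      "q'' \<in> Arr C" "Dom C q'' = Cod C b" "Cod C q'' = Cod C c"
  shows "exact_at C b' b"
proof (rule exact_atI_extend[OF enough b(2,1) _ b(3)])
  show "Dom C b = Cod C b'" using types by simp
  fix E \<phi> assume E: "injective_object C E"
    and \<phi>: "\<phi> \<in> Arr C" "Dom C \<phi> = Cod C b'" "Cod C \<phi> = E" "\<phi> \<bullet> b' = Zer C (Dom C b') E"
  note iq = exact_at_comp[OF row] and aa = exact_at_comp[OF a] and cc = exact_at_comp[OF c]
  have arr: "i'' \<in> Arr C" "e' \<in> Arr C" using i'' e' by (auto simp: monic_def epic_def)
  have Eob: "E \<in> Ob C" using \<phi> cod_in by blast
  have "(\<phi> \<bullet> i) \<bullet> a' = \<phi> \<bullet> (b' \<bullet> i')" using \<phi>(1,2) iq(1) aa(1) types comm(1) by (simp add: comp_assoc_arr)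
  also have "\<dots> = Zer C (Dom C b') E \<bullet> i'"
    by (rule comp_reassoc[OF \<phi>(4)]) (use \<phi> b types in auto)
  also have "\<dots> = Zer C (Dom C a') E" using types Eob by (simp add: cat_simps)
  finally have \<phi>ia: "(\<phi> \<bullet> i) \<bullet> a' = Zer C (Dom C a') E" .
  obtain \<alpha> where \<alpha>: "\<alpha> \<in> Arr C" "Dom C \<alpha> = Cod C a" "Cod C \<alpha> = E" "\<alpha> \<bullet> a = \<phi> \<bullet> i"
    by (rule exact_at_extend[OF a E _ _ _ \<phi>ia]) (use \<phi> iq types in \<open>auto simp: cat_simps\<close>)
  obtain \<beta> where \<beta>: "\<beta> \<in> Arr C" "Dom C \<beta> = Cod C i''" "Cod C \<beta> = E" "\<beta> \<bullet> i'' = \<alpha>"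
    by (rule injective_extend[OF E i'', of \<alpha>]) (use \<alpha> types in auto)
  let ?\<phi> = "\<phi> +\<^sub>C neg (\<beta> \<bullet> b)"
  have \<phi>A: "?\<phi> \<in> Arr C" "Dom C ?\<phi> = Cod C i" "Cod C ?\<phi> = E" using \<phi> \<beta>(1-3) b(1) types by (auto simp: cat_simps)
  have "\<beta> \<bullet> (b \<bullet> i) = \<phi> \<bullet> i"
    unfolding comm(2) using comp_reassoc[OF \<beta>(4), of a] \<alpha> \<beta>(1,2) arr aa types by simp
  moreover have "?\<phi> \<bullet> i = \<phi> \<bullet> i +\<^sub>C neg (\<beta> \<bullet> (b \<bullet> i))"
    using \<phi> \<beta>(1-3) b(1) iq types by (simp add: cat_simps)
  ultimately have 2: "?\<phi> \<bullet> i = Zer C (Dom C i) E" using \<phi>(1-3) iq types by (simp add: cat_simps)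
  obtain \<chi> where \<chi>: "\<chi> \<in> Arr C" "Dom C \<chi> = Cod C q" "Cod C \<chi> = E" "\<chi> \<bullet> q = ?\<phi>"
    by (rule exact_at_extend[OF row E \<phi>A 2])
  have "?\<phi> \<bullet> b' = \<phi> \<bullet> b' +\<^sub>C neg (\<beta> \<bullet> (b \<bullet> b'))" using \<phi>(1-3) \<beta>(1-3) b(1,2) types by (simp add: cat_simps)
  also have "\<dots> = Zer C (Dom C b') E" unfolding \<phi>(4) b(3) using \<beta>(1-3) b(1,2) types Eob by (simp add: cat_simps)
  finally have "\<chi> \<bullet> (q \<bullet> b') = Zer C (Dom C b') E"
    using comp_reassoc[OF \<chi>(4), of b'] \<chi>(1,2) iq b(2) types by simp
  then have "(\<chi> \<bullet> c') \<bullet> e' = Zer C (Dom C e') E"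
    using \<chi>(1,2) cc(1) arr types comm(3) by (simp add: comp_assoc_arr)
  then have "\<chi> \<bullet> c' = Zer C (Cod C e') E"
    using epicD_zero[OF e', of "\<chi> \<bullet> c'"] \<chi>(1-3) cc(1) types by (simp add: arr_simps)
  then have \<chi>c: "\<chi> \<bullet> c' = Zer C (Dom C c') E" using types by simp
  obtain \<psi> where \<psi>: "\<psi> \<in> Arr C" "Dom C \<psi> = Cod C c" "Cod C \<psi> = E" "\<psi> \<bullet> c = \<chi>"
    by (rule exact_at_extend[OF c E _ _ _ \<chi>c]) (use \<chi> types in auto)
  have "(\<psi> \<bullet> q'') \<bullet> b = \<psi> \<bullet> (c \<bullet> q)" using \<psi>(1,2) b(1) comm(4) types by (simp add: comp_assoc_arr)
  also have "\<dots> = ?\<phi>" using comp_reassoc[OF \<psi>(4), of q] \<psi>(1,2) \<chi>(4) cc iq types by simp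
  finally have "(\<beta> +\<^sub>C \<psi> \<bullet> q'') \<bullet> b = \<beta> \<bullet> b +\<^sub>C ?\<phi>"
    using \<beta>(1-3) \<psi>(1-3) b(1) types by (simp add: arr_simps plus_comp_arr)
  also have "\<dots> = \<phi>"
    using \<phi>(1-3) \<beta>(1-3) b(1) types by (simp add: plus_diff_arr arr_simps)
  finally show "\<exists>\<psi>\<in>Arr C. Dom C \<psi> = Cod C b \<and> Cod C \<psi> = E \<and> \<psi> \<bullet> b = \<phi>"
    using \<beta>(1-3) \<psi>(1-3) types by (intro bexI[of _ "\<beta> +\<^sub>C \<psi> \<bullet> q''"]) (auto simp: cat_simps)
qed

section \<open>Biproducts\<close>

definition biproduct :: "'a \<Rightarrow> 'a \<Rightarrow> 'b \<Rightarrow> 'b \<Rightarrow> 'b \<Rightarrow> 'b \<Rightarrow> bool"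
  where "biproduct A B i k p q \<longleftrightarrow> (\<exists>P \<in> Ob C. i \<in> Hom C A P \<and> k \<in> Hom C B P \<and> p \<in> Hom C P A \<and> q \<in> Hom C P B \<and>
    p \<bullet> i = Idt C A \<and> q \<bullet> k = Idt C B \<and> p \<bullet> k = Zer C B A \<and> q \<bullet> i = Zer C A B \<and>
    i \<bullet> p +\<^sub>C k \<bullet> q = Idt C P)"

lemma biproduct_exists:
  assumes "A \<in> Ob C" "B \<in> Ob C"
  shows "\<exists>i k p q. biproduct A B i k p q"
proof -
  obtain p q P where pq: "p \<in> Hom C P A" "q \<in> Hom C P B"
    and univ: "\<And>X f g. f \<in> Hom C X A \<Longrightarrow> g \<in> Hom C X B \<Longrightarrow> \<exists>!u. u \<in> Hom C X P \<and> p \<bullet> u = f \<and> q \<bullet> u = g"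
    using products[OF assms] unfolding is_product_def by blast
  have P: "P \<in> Ob C" using pq dom_in by (auto simp: in_Hom)
  have hom: "Idt C A \<in> Hom C A A" "Idt C B \<in> Hom C B B" "Zer C A B \<in> Hom C A B" "Zer C B A \<in> Hom C B A"
    using assms by (auto simp: in_Hom arr_simps)
  obtain i where i: "i \<in> Hom C A P" "p \<bullet> i = Idt C A" "q \<bullet> i = Zer C A B" using univ[OF hom(1,3)] by blast
  obtain k where k: "k \<in> Hom C B P" "p \<bullet> k = Zer C B A" "q \<bullet> k = Idt C B" using univ[OF hom(4,2)] by blast
  let ?u = "i \<bullet> p +\<^sub>C k \<bullet> q"
  have arr: "p \<in> Arr C" "q \<in> Arr C" "i \<in> Arr C" "k \<in> Arr C" "Dom C p = P" "Dom C q = P" "Cod C p = A" "Cod C q = B"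
    "Dom C i = A" "Dom C k = B" "Cod C i = P" "Cod C k = P" using pq i k by (auto simp: in_Hom)
  have "p \<bullet> ?u = (p \<bullet> i) \<bullet> p +\<^sub>C (p \<bullet> k) \<bullet> q" "q \<bullet> ?u = (q \<bullet> i) \<bullet> p +\<^sub>C (q \<bullet> k) \<bullet> q"
    using arr by (simp_all add: cat_simps)
  then have "p \<bullet> ?u = p" "q \<bullet> ?u = q"
    unfolding i k using arr assms P by (simp_all add: id_comp_arr zero_comp_arr zero_plus_arr)
  moreover have "?u \<in> Hom C P P" using arr by (auto simp: in_Hom arr_simps)
  moreover have "Idt C P \<in> Hom C P P" "p \<bullet> Idt C P = p" "q \<bullet> Idt C P = q" using arr P by (auto simp: in_Hom cat_simps)
  ultimately have "?u = Idt C P" using univ[OF pq] by blast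
  then show ?thesis unfolding biproduct_def using P i k pq by blast
qed

lemma biproductD:
  assumes "biproduct A B i k p q"
  shows "i \<in> Arr C" "k \<in> Arr C" "p \<in> Arr C" "q \<in> Arr C"
    "Dom C i = A" "Dom C k = B" "Cod C k = Cod C i" "Dom C p = Cod C i" "Dom C q = Cod C i" "Cod C p = A" "Cod C q = B"
    "p \<bullet> i = Idt C A" "q \<bullet> k = Idt C B" "p \<bullet> k = Zer C B A" "q \<bullet> i = Zer C A B"
    "i \<bullet> p +\<^sub>C k \<bullet> q = Idt C (Cod C i)" "A \<in> Ob C" "B \<in> Ob C" "Cod C i \<in> Ob C"
  using assms dom_in cod_in unfolding biproduct_def in_Hom by auto

lemma biproduct_cancel:
  assumes "biproduct A B i k p q" "x \<in> Arr C"
  shows "Cod C x = A \<Longrightarrow> p \<bullet> (i \<bullet> x) = x" "Cod C x = A \<Longrightarrow> q \<bullet> (i \<bullet> x) = Zer C (Dom C x) B"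
    "Cod C x = B \<Longrightarrow> q \<bullet> (k \<bullet> x) = x" "Cod C x = B \<Longrightarrow> p \<bullet> (k \<bullet> x) = Zer C (Dom C x) A"
proof -
  note b = biproductD[OF assms(1)]
  show "p \<bullet> (i \<bullet> x) = x" if "Cod C x = A" using comp_reassoc[OF b(12), of x] that b(1-11) assms(2) by (simp add: cat_simps)
  show "q \<bullet> (i \<bullet> x) = Zer C (Dom C x) B" if "Cod C x = A"
    using comp_reassoc[OF b(15), of x] that b(1-11,17-) assms(2) by (simp add: cat_simps)
  show "q \<bullet> (k \<bullet> x) = x" if "Cod C x = B" using comp_reassoc[OF b(13), of x] that b(1-11) assms(2) by (simp add: cat_simps)
  show "p \<bullet> (k \<bullet> x) = Zer C (Dom C x) A" if "Cod C x = B"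
    using comp_reassoc[OF b(14), of x] that b(1-11,17-) assms(2) by (simp add: cat_simps)
qed

lemma biproduct_injective:
  assumes b: "biproduct A B i k p q" and A: "injective_object C A" and B: "injective_object C B"
  shows "injective_object C (Cod C i)"
  unfolding injective_object_def
proof (intro conjI allI impI; (elim conjE)?)
  note b = biproductD[OF b]
  show "Cod C i \<in> Ob C" using b by blast
  fix f g assume f: "monic C f" and "g \<in> Hom C (Dom C f) (Cod C i)"
  then have g: "g \<in> Arr C" "Dom C g = Dom C f" "Cod C g = Cod C i" and fA: "f \<in> Arr C" by (auto simp: in_Hom monic_def)
  obtain x where x: "x \<in> Arr C" "Dom C x = Cod C f" "Cod C x = A" "x \<bullet> f = p \<bullet> g"
    by (rule injective_extend[OF A f, of "p \<bullet> g"]) (use g b in \<open>auto simp: arr_simps\<close>)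
  obtain y where y: "y \<in> Arr C" "Dom C y = Cod C f" "Cod C y = B" "y \<bullet> f = q \<bullet> g"
    by (rule injective_extend[OF B f, of "q \<bullet> g"]) (use g b in \<open>auto simp: arr_simps\<close>)
  have "(i \<bullet> x +\<^sub>C k \<bullet> y) \<bullet> f = i \<bullet> (x \<bullet> f) +\<^sub>C k \<bullet> (y \<bullet> f)" using x(1-3) y(1-3) b(1-11) fA by (simp add: cat_simps)
  also have "\<dots> = (i \<bullet> p +\<^sub>C k \<bullet> q) \<bullet> g" unfolding x(4) y(4) using b(1-11) g by (simp add: cat_simps)
  also have "\<dots> = g" unfolding b(16) using g by (simp add: cat_simps)
  finally show "\<exists>h\<in>Hom C (Cod C f) (Cod C i). h \<bullet> f = g"
    using x y b(1-11) by (intro bexI[of _ "i \<bullet> x +\<^sub>C k \<bullet> y"]) (auto simp: in_Hom arr_simps)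
qed

lemma biproduct_short_exact:
  assumes enough: "enough_injectives C" and b: "biproduct A B i k p q"
  shows "short_exact C i q"
  unfolding short_exact_def
proof (intro conjI)
  note b' = biproductD[OF b]
  show "monic C i"
  proof (rule monicI_zero[OF b'(1)])
    fix X x assume x: "x \<in> Hom C X (Dom C i)" "i \<bullet> x = Zer C X (Cod C i)"
    then have "p \<bullet> (i \<bullet> x) = x" using biproduct_cancel(1)[OF b, of x] b' by (auto simp: in_Hom)
    moreover have "X \<in> Ob C" using x dom_in by (auto simp: in_Hom)
    ultimately show "x = Zer C X (Dom C i)" using x b' by (simp add: comp_zero_arr)
  qed
  show "epic C q"
    unfolding epic_def
  proof (intro conjI allI ballI impI)
    fix X g h assume gh: "g \<in> Hom C (Cod C q) X" "h \<in> Hom C (Cod C q) X" "g \<bullet> q = h \<bullet> q"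
    have "(g \<bullet> q) \<bullet> k = (h \<bullet> q) \<bullet> k" unfolding gh(3) ..
    then have "g \<bullet> (q \<bullet> k) = h \<bullet> (q \<bullet> k)" using gh(1,2) b'(1-11) by (simp add: comp_assoc_arr in_Hom)
    then show "g = h" unfolding b'(13) using gh(1,2) b'(1-11) by (simp add: comp_id_arr in_Hom)
  qed (rule b')
  show "exact_at C i q"
  proof (rule exact_atI_extend[OF enough])
    fix E \<phi> assume \<phi>: "\<phi> \<in> Arr C" "Dom C \<phi> = Cod C i" "Cod C \<phi> = E" "\<phi> \<bullet> i = Zer C (Dom C i) E"
    have Eob: "E \<in> Ob C" using \<phi> cod_in by blast
    have "\<phi> = \<phi> \<bullet> (i \<bullet> p +\<^sub>C k \<bullet> q)" unfolding b'(16) using \<phi>(1-3) by (simp add: comp_id_arr)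
    also have "\<dots> = (\<phi> \<bullet> i) \<bullet> p +\<^sub>C (\<phi> \<bullet> k) \<bullet> q" using \<phi>(1-3) b'(1-11) by (simp add: cat_simps)
    also have "\<dots> = (\<phi> \<bullet> k) \<bullet> q" unfolding \<phi>(4) using \<phi>(1-3) b'(1-11) Eob by (simp add: cat_simps)
    finally show "\<exists>\<psi>\<in>Arr C. Dom C \<psi> = Cod C q \<and> Cod C \<psi> = E \<and> \<psi> \<bullet> q = \<phi>"
      using \<phi>(1-3) b'(1-11) by (intro bexI[of _ "\<phi> \<bullet> k"]) (auto simp: arr_simps)
  qed (use b' in auto)
qed

end

section \<open>Injective resolutions\<close>

text \<open>The arrow into \<open>I\<^sup>n\<close>, the augmentation counting as the differential into \<open>I\<^sup>0\<close>. With it the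
  start of a resolution need not be treated apart.\<close>

definition incoming :: "('o, 'm) resolution \<Rightarrow> nat \<Rightarrow> 'm"
  where "incoming I n = (case n of 0 \<Rightarrow> raug I | Suc k \<Rightarrow> rdiff I k)"

lemma incoming_simps [simp]: "incoming I 0 = raug I" "incoming I (Suc n) = rdiff I n"
  by (simp_all add: incoming_def)

context abelian_category
begin

lemma resolutionD:
  assumes "injective_resolution C A I"
  shows "injective_object C (robj I n)" "monic C (raug I)" "Dom C (raug I) = A"
    "incoming I n \<in> Arr C" "Cod C (incoming I n) = robj I n"
    "rdiff I n \<in> Arr C" "Dom C (rdiff I n) = robj I n" "Cod C (rdiff I n) = robj I (Suc n)"
    "robj I n \<in> Ob C" "A \<in> Ob C" "exact_at C (incoming I n) (rdiff I n)"
    "rdiff I n \<bullet> incoming I n = Zer C (Dom C (incoming I n)) (robj I (Suc n))"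
    "rdiff I (Suc n) \<bullet> rdiff I n = Zer C (robj I n) (robj I (Suc (Suc n)))"
proof -
  have a: "raug I \<in> Hom C A (robj I 0)" "\<And>n. rdiff I n \<in> Hom C (robj I n) (robj I (Suc n))"
    "monic C (raug I)" "exact_at C (raug I) (rdiff I 0)" "\<And>n. exact_at C (rdiff I n) (rdiff I (Suc n))"
    "\<And>n. injective_object C (robj I n)"
    using assms unfolding injective_resolution_def by auto
  show "injective_object C (robj I n)" "monic C (raug I)" "Dom C (raug I) = A"
    "rdiff I n \<in> Arr C" "Dom C (rdiff I n) = robj I n" "Cod C (rdiff I n) = robj I (Suc n)"
    "robj I n \<in> Ob C" "A \<in> Ob C"
    using a dom_in by (auto simp: in_Hom injective_object_def)
  show "incoming I n \<in> Arr C" "Cod C (incoming I n) = robj I n" using a by (cases n; simp add: in_Hom)+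
  show ex: "exact_at C (incoming I n) (rdiff I n)" using a by (cases n) auto
  show "rdiff I n \<bullet> incoming I n = Zer C (Dom C (incoming I n)) (robj I (Suc n))"
    using exact_at_comp(4)[OF ex] a(2)[of n] by (simp add: in_Hom)
  show "rdiff I (Suc n) \<bullet> rdiff I n = Zer C (robj I n) (robj I (Suc (Suc n)))"
    using exact_at_comp(4)[OF a(5)[of n]] a(2)[of n] a(2)[of "Suc n"] by (simp add: in_Hom)
qed

lemma resolution_extend:
  assumes I: "injective_resolution C A I" and E: "injective_object C E"
    and \<phi>: "\<phi> \<in> Arr C" "Dom C \<phi> = robj I n" "Cod C \<phi> = E" "\<phi> \<bullet> incoming I n = Zer C (Dom C (incoming I n)) E"
  obtains \<psi> where "\<psi> \<in> Arr C" "Dom C \<psi> = robj I (Suc n)" "Cod C \<psi> = E" "\<psi> \<bullet> rdiff I n = \<phi>"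
  using exact_at_extend[OF resolutionD(11)[OF I] E \<phi>(1) _ \<phi>(3,4)] resolutionD[OF I] \<phi>(2) by metis

lemma liftD:
  assumes "is_lift C I J f \<phi>"
  shows "\<phi> n \<in> Arr C" "Dom C (\<phi> n) = robj I n" "Cod C (\<phi> n) = robj J n"
    "\<phi> 0 \<bullet> raug I = raug J \<bullet> f" "\<phi> (Suc n) \<bullet> rdiff I n = rdiff J n \<bullet> \<phi> n"
  using assms unfolding is_lift_def in_Hom by auto

text \<open>In this and the following constructions the condition that the next extension problem is solvable is
  carried along as part of the invariant \<open>?P\<close>, while \<open>?Q\<close> is the equation that the next arrow solves.\<close>

lemma lift_exists:
  assumes I: "injective_resolution C A I" and J: "injective_resolution C B J" and f: "f \<in> Hom C A B"
  shows "\<exists>\<phi>. is_lift C I J f \<phi>"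
proof -
  note i = resolutionD[OF I] and j = resolutionD[OF J]
  have f: "f \<in> Arr C" "Dom C f = A" "Cod C f = B" using f by (auto simp: in_Hom)
  have raug: "raug I \<in> Arr C" "raug J \<in> Arr C" "Cod C (raug I) = robj I 0" "Cod C (raug J) = robj J 0"
    using i(4,5)[of 0] j(4,5)[of 0] by auto
  let ?P = "\<lambda>n \<phi>. \<phi> \<in> Arr C \<and> Dom C \<phi> = robj I n \<and> Cod C \<phi> = robj J n \<and> (n = 0 \<longrightarrow> \<phi> \<bullet> raug I = raug J \<bullet> f) \<and>
    rdiff J n \<bullet> (\<phi> \<bullet> incoming I n) = Zer C (Dom C (incoming I n)) (robj J (Suc n))"
  let ?Q = "\<lambda>n \<phi> \<phi>'. \<phi>' \<bullet> rdiff I n = rdiff J n \<bullet> \<phi>"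
  obtain \<phi>0 where \<phi>0: "\<phi>0 \<in> Arr C" "Dom C \<phi>0 = robj I 0" "Cod C \<phi>0 = robj J 0" "\<phi>0 \<bullet> raug I = raug J \<bullet> f"
    using injective_extend[OF j(1)[of 0] i(2), of "raug J \<bullet> f"] raug f i(3) j(3) by (auto simp: arr_simps)
  have "rdiff J 0 \<bullet> (raug J \<bullet> f) = Zer C B (robj J 1) \<bullet> f"
    by (rule comp_reassoc) (use j(12)[of 0] j(3,6,7) raug f in auto)
  then have "?P 0 \<phi>0" using \<phi>0 f i(3) j(9) by (simp add: zero_comp_arr)
  then have 1: "\<exists>\<phi>. ?P 0 \<phi>" by blast
  have 2: "\<exists>\<phi>'. ?P (Suc n) \<phi>' \<and> ?Q n \<phi> \<phi>'" if \<phi>: "?P n \<phi>" for n \<phi>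
  proof -
    have "(rdiff J n \<bullet> \<phi>) \<bullet> incoming I n = Zer C (Dom C (incoming I n)) (robj J (Suc n))"
      using \<phi> i(4,5) j(6,7) by (simp add: comp_assoc_arr)
    then obtain \<phi>' where \<phi>': "\<phi>' \<in> Arr C" "Dom C \<phi>' = robj I (Suc n)" "Cod C \<phi>' = robj J (Suc n)"
      "\<phi>' \<bullet> rdiff I n = rdiff J n \<bullet> \<phi>"
      using resolution_extend[OF I j(1), of "rdiff J n \<bullet> \<phi>" n "Suc n"] \<phi> j(6-8) by (auto simp: arr_simps)
    have "rdiff J (Suc n) \<bullet> (rdiff J n \<bullet> \<phi>) = Zer C (robj J n) (robj J (Suc (Suc n))) \<bullet> \<phi>"
      by (rule comp_reassoc[OF j(13)]) (use \<phi> j in auto)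
    also have "\<dots> = Zer C (robj I n) (robj J (Suc (Suc n)))" using \<phi> j(9) by (simp add: zero_comp_arr)
    finally show ?thesis using \<phi>' i(7) by (intro exI[of _ \<phi>']) simp
  qed
  have "\<exists>\<phi>. \<forall>n. ?P n (\<phi> n) \<and> ?Q n (\<phi> n) (\<phi> (Suc n))" using dependent_nat_choice[of ?P ?Q, OF 1 2] by blast
  then obtain \<phi> where \<phi>: "\<And>n. ?P n (\<phi> n)" "\<And>n. ?Q n (\<phi> n) (\<phi> (Suc n))" by blast
  then have "is_lift C I J f \<phi>" unfolding is_lift_def in_Hom using \<phi>(1)[of 0] by simp
  then show ?thesis by blast
qed

lemma lift_homotopy:
  assumes I: "injective_resolution C A I" and J: "injective_resolution C B J"
    and \<phi>: "is_lift C I J f \<phi>" and \<psi>: "is_lift C I J f \<psi>"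
  shows "\<exists>s. (\<forall>n. s n \<in> Hom C (robj I (Suc n)) (robj J n)) \<and> \<phi> 0 = \<psi> 0 +\<^sub>C s 0 \<bullet> rdiff I 0 \<and>
    (\<forall>n. \<phi> (Suc n) = \<psi> (Suc n) +\<^sub>C (s (Suc n) \<bullet> rdiff I (Suc n) +\<^sub>C rdiff J n \<bullet> s n))"
proof -
  note i = resolutionD[OF I] and j = resolutionD[OF J]
  note p = liftD[OF \<phi>] and q = liftD[OF \<psi>]
  have raug: "raug I \<in> Arr C" "raug J \<in> Arr C" "Cod C (raug I) = robj I 0" "Cod C (raug J) = robj J 0"
    using i(4,5)[of 0] j(4,5)[of 0] by auto
  define \<theta> where "\<theta> n = \<phi> n +\<^sub>C neg (\<psi> n)" for n
  have \<theta>: "\<theta> n \<in> Arr C" "Dom C (\<theta> n) = robj I n" "Cod C (\<theta> n) = robj J n" for n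
    unfolding \<theta>_def using p(1-3) q(1-3) by (auto simp: arr_simps)
  have \<theta>_sum: "\<phi> n = \<psi> n +\<^sub>C \<theta> n" for n
    unfolding \<theta>_def using p(1-3) q(1-3) by (simp add: plus_diff_arr)
  have "\<theta> 0 \<bullet> raug I = \<phi> 0 \<bullet> raug I +\<^sub>C neg (\<psi> 0 \<bullet> raug I)"
    unfolding \<theta>_def using p(1-3)[of 0] q(1-3)[of 0] raug by (simp add: plus_comp_arr neg_comp_arr arr_simps)
  also have "\<dots> = \<phi> 0 \<bullet> raug I +\<^sub>C neg (\<phi> 0 \<bullet> raug I)" unfolding p(4) q(4) ..
  also have "\<dots> = Zer C A (robj J 0)" using p(1-3)[of 0] raug i(3) by (simp add: neg_plus_arr arr_simps)
  finally have \<theta>0: "\<theta> 0 \<bullet> incoming I 0 = Zer C (Dom C (incoming I 0)) (robj J 0)" using i(3) by simp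
  have \<theta>d: "\<theta> (Suc n) \<bullet> rdiff I n = rdiff J n \<bullet> \<theta> n" for n
  proof -
    have "\<theta> (Suc n) \<bullet> rdiff I n = \<phi> (Suc n) \<bullet> rdiff I n +\<^sub>C neg (\<psi> (Suc n) \<bullet> rdiff I n)"
      unfolding \<theta>_def using p(1-3) q(1-3) i(6-8) by (simp add: plus_comp_arr neg_comp_arr arr_simps)
    also have "\<dots> = rdiff J n \<bullet> \<theta> n"
      unfolding p(5) q(5) \<theta>_def using p(1-3) q(1-3) j(6-8) by (simp add: comp_plus_arr comp_neg_arr arr_simps)
    finally show ?thesis .
  qed
  let ?P = "\<lambda>n s. s \<in> Arr C \<and> Dom C s = robj I (Suc n) \<and> Cod C s = robj J n \<and> (n = 0 \<longrightarrow> s \<bullet> rdiff I 0 = \<theta> 0) \<and>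
    rdiff J n \<bullet> (s \<bullet> rdiff I n) = rdiff J n \<bullet> \<theta> n"
  let ?Q = "\<lambda>n s s'. s' \<bullet> rdiff I (Suc n) = \<theta> (Suc n) +\<^sub>C neg (rdiff J n \<bullet> s)"
  obtain s0 where s0: "s0 \<in> Arr C" "Dom C s0 = robj I (Suc 0)" "Cod C s0 = robj J 0" "s0 \<bullet> rdiff I 0 = \<theta> 0"
    using resolution_extend[OF I j(1) \<theta>(1,2,3) \<theta>0] by metis
  then have 1: "\<exists>s. ?P 0 s" by (intro exI[of _ s0]) simp
  have 2: "\<exists>s'. ?P (Suc n) s' \<and> ?Q n s s'" if s: "?P n s" for n s
  proof -
    let ?\<chi> = "\<theta> (Suc n) +\<^sub>C neg (rdiff J n \<bullet> s)"
    have \<chi>: "?\<chi> \<in> Arr C" "Dom C ?\<chi> = robj I (Suc n)" "Cod C ?\<chi> = robj J (Suc n)"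
      using s \<theta> j(6-8) by (auto simp: arr_simps)
    have "?\<chi> \<bullet> rdiff I n = \<theta> (Suc n) \<bullet> rdiff I n +\<^sub>C neg (rdiff J n \<bullet> (s \<bullet> rdiff I n))"
      using s \<theta> j(6-8) i(6-8) by (simp add: plus_comp_arr neg_comp_arr comp_assoc_arr arr_simps)
    also have "\<dots> = rdiff J n \<bullet> \<theta> n +\<^sub>C neg (rdiff J n \<bullet> \<theta> n)" using s \<theta>d by simp
    also have "\<dots> = Zer C (robj I n) (robj J (Suc n))" using \<theta> j(6-8) by (simp add: neg_plus_arr arr_simps)
    finally have 0: "?\<chi> \<bullet> incoming I (Suc n) = Zer C (Dom C (incoming I (Suc n))) (robj J (Suc n))" using i(7) by simp
    obtain s' where s': "s' \<in> Arr C" "Dom C s' = robj I (Suc (Suc n))" "Cod C s' = robj J (Suc n)"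
      "s' \<bullet> rdiff I (Suc n) = ?\<chi>"
      using resolution_extend[OF I j(1) \<chi> 0] by metis
    have "rdiff J (Suc n) \<bullet> (rdiff J n \<bullet> s) = Zer C (robj J n) (robj J (Suc (Suc n))) \<bullet> s"
      by (rule comp_reassoc[OF j(13)]) (use s j in auto)
    also have "\<dots> = Zer C (robj I (Suc n)) (robj J (Suc (Suc n)))" using s j(9) by (simp add: zero_comp_arr)
    finally have dd: "rdiff J (Suc n) \<bullet> (rdiff J n \<bullet> s) = Zer C (robj I (Suc n)) (robj J (Suc (Suc n)))" .
    have "rdiff J (Suc n) \<bullet> ?\<chi> = rdiff J (Suc n) \<bullet> \<theta> (Suc n) +\<^sub>C neg (rdiff J (Suc n) \<bullet> (rdiff J n \<bullet> s))"
      using s \<theta> j(6-8) by (simp add: comp_plus_arr comp_neg_arr arr_simps)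
    also have "\<dots> = rdiff J (Suc n) \<bullet> \<theta> (Suc n)"
      unfolding dd using \<theta> i(9) j(6-9) by (simp add: cat_simps)
    finally show ?thesis using s' by (intro exI[of _ s']) simp
  qed
  have "\<exists>s. \<forall>n. ?P n (s n) \<and> ?Q n (s n) (s (Suc n))" using dependent_nat_choice[of ?P ?Q, OF 1 2] by blast
  then obtain s where s: "\<And>n. ?P n (s n)" "\<And>n. ?Q n (s n) (s (Suc n))" by blast
  have "\<theta> (Suc n) = s (Suc n) \<bullet> rdiff I (Suc n) +\<^sub>C rdiff J n \<bullet> s n" for n
    unfolding s(2)[of n] using s(1)[of n] \<theta>[of "Suc n"] j(6-8) by (simp add: cat_simps)
  then show ?thesis
    using s(1) \<theta>_sum s(1)[of 0] by (intro exI[of _ s]) (auto simp: in_Hom)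
qed

lemma lift_id:
  assumes "injective_resolution C A I"
  shows "is_lift C I I (Idt C A) (\<lambda>n. Idt C (robj I n))"
  using resolutionD[OF assms] resolutionD(4,5)[OF assms, of 0]
  unfolding is_lift_def in_Hom by (simp add: cat_simps)

lemma lift_comp:
  assumes I: "injective_resolution C A I" and J: "injective_resolution C B J" and K: "injective_resolution C D K"
    and f: "f \<in> Hom C A B" and g: "g \<in> Hom C B D"
    and \<phi>: "is_lift C I J f \<phi>" and \<psi>: "is_lift C J K g \<psi>"
  shows "is_lift C I K (g \<bullet> f) (\<lambda>n. \<psi> n \<bullet> \<phi> n)"
proof -
  note i = resolutionD[OF I] and j = resolutionD[OF J] and k = resolutionD[OF K]
  note p = liftD[OF \<phi>] and q = liftD[OF \<psi>]
  have raug: "raug I \<in> Arr C" "raug J \<in> Arr C" "Cod C (raug I) = robj I 0" "Cod C (raug J) = robj J 0"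
    "raug K \<in> Arr C" "Cod C (raug K) = robj K 0"
    using i(4,5)[of 0] j(4,5)[of 0] k(4,5)[of 0] by auto
  have fg: "f \<in> Arr C" "Dom C f = A" "Cod C f = B" "g \<in> Arr C" "Dom C g = B" "Cod C g = D"
    using f g by (auto simp: in_Hom)
  have "(\<psi> 0 \<bullet> \<phi> 0) \<bullet> raug I = \<psi> 0 \<bullet> (raug J \<bullet> f)"
    using p(1-3)[of 0] q(1-3)[of 0] raug p(4) by (simp add: comp_assoc_arr)
  also have "\<dots> = (raug K \<bullet> g) \<bullet> f"
    by (rule comp_reassoc[OF q(4)]) (use q(1-3)[of 0] raug fg j(3) in auto)
  also have "\<dots> = raug K \<bullet> (g \<bullet> f)" using raug fg k(3) by (simp add: comp_assoc_arr)
  finally have 1: "(\<psi> 0 \<bullet> \<phi> 0) \<bullet> raug I = raug K \<bullet> (g \<bullet> f)" .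
  have 2: "(\<psi> (Suc n) \<bullet> \<phi> (Suc n)) \<bullet> rdiff I n = rdiff K n \<bullet> (\<psi> n \<bullet> \<phi> n)" for n
  proof -
    have "(\<psi> (Suc n) \<bullet> \<phi> (Suc n)) \<bullet> rdiff I n = \<psi> (Suc n) \<bullet> (rdiff J n \<bullet> \<phi> n)"
      using p(1-3,5) q(1-3) i(6-8) by (simp add: comp_assoc_arr)
    also have "\<dots> = (rdiff K n \<bullet> \<psi> n) \<bullet> \<phi> n"
      by (rule comp_reassoc[OF q(5)]) (use p(1-3) q(1-3) j(6-8) in auto)
    finally show ?thesis using p(1-3) q(1-3) k(6-8) by (simp add: comp_assoc_arr)
  qed
  show ?thesis unfolding is_lift_def in_Hom using 1 2 p(1-3) q(1-3) by (simp add: arr_simps)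
qed

text \<open>The middle resolution has the objects \<open>I\<^sup>n \<oplus> K\<^sup>n\<close> and the differentials of \<open>I\<close> and \<open>K\<close> on the
  diagonal, together with a twist \<open>t n : K\<^sup>n \<rightarrow> I\<^sup>n\<^sup>+\<^sup>1\<close>. The augmentation is an extension \<open>\<alpha>\<close> of that of \<open>I\<close>
  in the first component. That consecutive maps compose to zero means \<open>t 0 \<bullet> raug K \<bullet> g = - d \<bullet> \<alpha>\<close> and
  \<open>t (n + 1) \<bullet> d = - d \<bullet> t n\<close>, which are extension problems along \<open>K\<close>. Exactness follows from that of
  \<open>I\<close> and \<open>K\<close> row by row.\<close>

lemma horseshoe:
  assumes enough: "enough_injectives C" and ses: "short_exact C f g"
    and f: "f \<in> Hom C A B" and g: "g \<in> Hom C B D"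
    and I: "injective_resolution C A I" and K: "injective_resolution C D K"
  shows "\<exists>J u v. injective_resolution C B J \<and> is_lift C I J f u \<and> is_lift C J K g v \<and> (\<forall>n. short_exact C (u n) (v n))"
proof -
  note i = resolutionD[OF I] and k = resolutionD[OF K]
  have fg: "f \<in> Arr C" "Dom C f = A" "Cod C f = B" "g \<in> Arr C" "Dom C g = B" "Cod C g = D"
    using f g by (auto simp: in_Hom)
  have fm: "monic C f" and ge: "epic C g" and fgx: "exact_at C f g" using ses by (auto simp: short_exact_def)
  have gf: "g \<bullet> f = Zer C A D" using exact_at_comp(4)[OF fgx] fg by simp
  have raug: "raug I \<in> Arr C" "raug K \<in> Arr C" "Cod C (raug I) = robj I 0" "Cod C (raug K) = robj K 0"
    using i(4,5)[of 0] k(4,5)[of 0] by auto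
  have "\<forall>n. \<exists>i k p q. biproduct (robj I n) (robj K n) i k p q" using biproduct_exists i(9) k(9) by blast
  then obtain a b p q where bip: "\<And>n. biproduct (robj I n) (robj K n) (a n) (b n) (p n) (q n)" by metis
  note bp = biproductD[OF bip]
  obtain \<alpha> where \<alpha>: "\<alpha> \<in> Arr C" "Dom C \<alpha> = B" "Cod C \<alpha> = robj I 0" "\<alpha> \<bullet> f = raug I"
    using injective_extend[OF i(1) fm raug(1)] raug fg i(3) by metis
  have "neg (rdiff I 0 \<bullet> \<alpha>) \<bullet> f = neg (rdiff I 0 \<bullet> (\<alpha> \<bullet> f))"
    using \<alpha>(1-3) fg i(6-8) by (simp add: neg_comp_arr comp_assoc_arr arr_simps)
  also have "\<dots> = Zer C A (robj I 1)" unfolding \<alpha>(4) using i(12)[of 0] i(3,9,10) by (simp add: neg_zero_arr)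
  finally have 0: "neg (rdiff I 0 \<bullet> \<alpha>) \<bullet> f = Zer C (Dom C f) (robj I 1)" using fg by simp
  obtain \<sigma> where \<sigma>: "\<sigma> \<in> Arr C" "Dom C \<sigma> = D" "Cod C \<sigma> = robj I 1" "\<sigma> \<bullet> g = neg (rdiff I 0 \<bullet> \<alpha>)"
    using exact_at_extend[OF fgx i(1) _ _ _ 0] \<alpha>(1-3) fg i(6-8) by (auto simp: arr_simps)
  have "(rdiff I 1 \<bullet> \<sigma>) \<bullet> g = neg ((rdiff I 1 \<bullet> rdiff I 0) \<bullet> \<alpha>)"
    using \<sigma> \<alpha>(1-3) i(6-8) fg by (simp add: comp_assoc_arr comp_neg_arr arr_simps)
  also have "\<dots> = Zer C B (robj I 2)" using i(13)[of 0] \<alpha>(1-3) i(9) fg dom_in[OF \<alpha>(1)]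
    by (simp add: zero_comp_arr neg_zero_arr numeral_2_eq_2)
  finally have "rdiff I 1 \<bullet> \<sigma> = Zer C (Cod C g) (Cod C (rdiff I 1 \<bullet> \<sigma>))"
    using \<sigma>(1-3) i(6-8) fg by (intro epicD_zero[OF ge]) (auto simp: arr_simps numeral_2_eq_2)
  then have d\<sigma>: "rdiff I 1 \<bullet> \<sigma> = Zer C D (robj I 2)"
    using \<sigma>(1-3) i(6-8) fg by (simp add: arr_simps numeral_2_eq_2)
  let ?P = "\<lambda>n t. t \<in> Arr C \<and> Dom C t = robj K n \<and> Cod C t = robj I (Suc n) \<and> (n = 0 \<longrightarrow> t \<bullet> raug K = \<sigma>) \<and>
    rdiff I (Suc n) \<bullet> (t \<bullet> incoming K n) = Zer C (Dom C (incoming K n)) (robj I (Suc (Suc n)))"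
  let ?Q = "\<lambda>n t t'. t' \<bullet> rdiff K n = neg (rdiff I (Suc n) \<bullet> t)"
  obtain t0 where t0: "t0 \<in> Arr C" "Dom C t0 = robj K 0" "Cod C t0 = robj I 1" "t0 \<bullet> raug K = \<sigma>"
    using injective_extend[OF i(1) k(2) \<sigma>(1)] \<sigma>(2,3) k(3) raug(4) by metis
  have 1: "\<exists>t. ?P 0 t" using t0 d\<sigma> k(3) by (intro exI[of _ t0]) (simp add: numeral_2_eq_2)
  have 2: "\<exists>t'. ?P (Suc n) t' \<and> ?Q n t t'" if t: "?P n t" for n t
  proof -
    let ?\<chi> = "neg (rdiff I (Suc n) \<bullet> t)"
    have \<chi>: "?\<chi> \<in> Arr C" "Dom C ?\<chi> = robj K n" "Cod C ?\<chi> = robj I (Suc (Suc n))" using t i(6-8) by (auto simp: arr_simps)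
    have "?\<chi> \<bullet> incoming K n = neg (rdiff I (Suc n) \<bullet> (t \<bullet> incoming K n))"
      using t i(6-8) k(4,5) by (simp add: neg_comp_arr comp_assoc_arr arr_simps)
    also have "\<dots> = Zer C (Dom C (incoming K n)) (robj I (Suc (Suc n)))"
      using t i(9) dom_in[OF k(4)] by (simp add: neg_zero_arr)
    finally obtain t' where t': "t' \<in> Arr C" "Dom C t' = robj K (Suc n)" "Cod C t' = robj I (Suc (Suc n))" "t' \<bullet> rdiff K n = ?\<chi>"
      using resolution_extend[OF K i(1) \<chi>] by metis
    have "rdiff I (Suc (Suc n)) \<bullet> (rdiff I (Suc n) \<bullet> t) = Zer C (robj I (Suc n)) (robj I (Suc (Suc (Suc n)))) \<bullet> t"
      by (rule comp_reassoc[OF i(13)]) (use t i in auto)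
    then have "rdiff I (Suc (Suc n)) \<bullet> ?\<chi> = Zer C (robj K n) (robj I (Suc (Suc (Suc n))))"
      using t i(6-9) k(9) by (simp add: comp_neg_arr zero_comp_arr neg_zero_arr arr_simps)
    then show ?thesis using t' k(7) by (intro exI[of _ t']) simp
  qed
  have "\<exists>t. \<forall>n. ?P n (t n) \<and> ?Q n (t n) (t (Suc n))" using dependent_nat_choice[of ?P ?Q, OF 1 2] by blast
  then obtain t where tP: "\<And>n. ?P n (t n)" and tQ: "\<And>n. ?Q n (t n) (t (Suc n))" by blast
  have t: "t n \<in> Arr C" "Dom C (t n) = robj K n" "Cod C (t n) = robj I (Suc n)" "t 0 \<bullet> raug K = \<sigma>" for n
    using tP[of n] tP[of 0] by auto
  define e where "e = a 0 \<bullet> \<alpha> +\<^sub>C b 0 \<bullet> (raug K \<bullet> g)"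
  define \<delta> where "\<delta> n = a (Suc n) \<bullet> (rdiff I n \<bullet> p n) +\<^sub>C (a (Suc n) \<bullet> (t n \<bullet> q n) +\<^sub>C b (Suc n) \<bullet> (rdiff K n \<bullet> q n))" for n
  define J where "J = \<lparr>robj = (\<lambda>n. Cod C (a n)), rdiff = \<delta>, raug = e\<rparr>"
  note arrs = bp(1-11,17-) \<alpha>(1-3) fg raug i(3,6-10) k(3,6-10) t(1-3)
  have e: "e \<in> Arr C" "Dom C e = B" "Cod C e = Cod C (a 0)"
    unfolding e_def using arrs by (simp_all add: arr_simps)
  have \<delta>: "\<delta> n \<in> Arr C" "Dom C (\<delta> n) = Cod C (a n)" "Cod C (\<delta> n) = Cod C (a (Suc n))" for n
    unfolding \<delta>_def using arrs by (simp_all add: arr_simps)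
  have e_f: "e \<bullet> f = a 0 \<bullet> raug I"
  proof -
    have "e \<bullet> f = a 0 \<bullet> (\<alpha> \<bullet> f) +\<^sub>C b 0 \<bullet> (raug K \<bullet> (g \<bullet> f))" unfolding e_def using arrs by (simp add: cat_simps)
    then show ?thesis unfolding \<alpha>(4) gf using arrs by (simp add: cat_simps)
  qed
  have q_e: "q 0 \<bullet> e = raug K \<bullet> g"
    unfolding e_def using arrs by (simp add: comp_plus_arr arr_simps biproduct_cancel[OF bip] zero_plus_arr)
  have \<delta>_a: "\<delta> n \<bullet> a n = a (Suc n) \<bullet> rdiff I n" for n
    unfolding \<delta>_def using arrs by (simp add: cat_simps bp(12,15))
  have q_\<delta>: "q (Suc n) \<bullet> \<delta> n = rdiff K n \<bullet> q n" for n
    unfolding \<delta>_def using arrs by (simp add: comp_plus_arr arr_simps biproduct_cancel[OF bip] zero_plus_arr)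
  have p_\<delta>: "p (Suc n) \<bullet> \<delta> n = rdiff I n \<bullet> p n +\<^sub>C t n \<bullet> q n" for n
    unfolding \<delta>_def using arrs by (simp add: comp_plus_arr arr_simps biproduct_cancel[OF bip] zero_plus_arr)
  have p_e: "p 0 \<bullet> e = \<alpha>"
    unfolding e_def using arrs by (simp add: comp_plus_arr arr_simps biproduct_cancel[OF bip] zero_plus_arr)
  have zeroI: "x = Zer C (Dom C x) (Cod C (a n))"
    if x: "x \<in> Arr C" "Cod C x = Cod C (a n)" "p n \<bullet> x = Zer C (Dom C x) (robj I n)" "q n \<bullet> x = Zer C (Dom C x) (robj K n)" for x n
  proof -
    have "x = (a n \<bullet> p n +\<^sub>C b n \<bullet> q n) \<bullet> x" unfolding bp(16) using x(1,2) by (simp add: id_comp_arr)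
    also have "\<dots> = a n \<bullet> (p n \<bullet> x) +\<^sub>C b n \<bullet> (q n \<bullet> x)" using x(1,2) bp(1-11) by (simp add: plus_comp_arr comp_assoc_arr arr_simps)
    also have "\<dots> = Zer C (Dom C x) (Cod C (a n))" unfolding x(3,4) using dom_in[OF x(1)] bp(1-11,19) by (simp add: cat_simps)
    finally show ?thesis .
  qed
  have \<delta>_e: "\<delta> 0 \<bullet> e = Zer C B (Cod C (a 1))"
  proof -
    have "p 1 \<bullet> (\<delta> 0 \<bullet> e) = (rdiff I 0 \<bullet> p 0 +\<^sub>C t 0 \<bullet> q 0) \<bullet> e"
      by (rule comp_reassoc) (use p_\<delta>[of 0] \<delta> e arrs in auto)
    also have "\<dots> = rdiff I 0 \<bullet> (p 0 \<bullet> e) +\<^sub>C t 0 \<bullet> (q 0 \<bullet> e)" using e arrs by (simp add: plus_comp_arr comp_assoc_arr arr_simps)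
    also have "\<dots> = rdiff I 0 \<bullet> \<alpha> +\<^sub>C (t 0 \<bullet> raug K) \<bullet> g" unfolding p_e q_e using arrs by (simp add: comp_assoc_arr)
    also have "\<dots> = Zer C B (robj I 1)" unfolding t(4) \<sigma>(4) using arrs by (simp add: neg_plus_arr arr_simps)
    finally have 1: "p 1 \<bullet> (\<delta> 0 \<bullet> e) = Zer C (Dom C (\<delta> 0 \<bullet> e)) (robj I 1)" using \<delta> e by (simp add: arr_simps)
    have "q 1 \<bullet> (\<delta> 0 \<bullet> e) = (rdiff K 0 \<bullet> q 0) \<bullet> e" by (rule comp_reassoc) (use q_\<delta>[of 0] \<delta> e arrs in auto)
    also have "\<dots> = (rdiff K 0 \<bullet> raug K) \<bullet> g" using q_e e arrs by (simp add: comp_assoc_arr)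
    also have "\<dots> = Zer C B (robj K 1)" using k(12)[of 0] arrs by (simp add: zero_comp_arr)
    finally have 2: "q 1 \<bullet> (\<delta> 0 \<bullet> e) = Zer C (Dom C (\<delta> 0 \<bullet> e)) (robj K 1)" using \<delta> e by (simp add: arr_simps)
    show ?thesis using zeroI[OF _ _ 1 2] \<delta> e by (simp add: arr_simps)
  qed
  have \<delta>_\<delta>: "\<delta> (Suc n) \<bullet> \<delta> n = Zer C (Cod C (a n)) (Cod C (a (Suc (Suc n))))" for n
  proof -
    have "p (Suc (Suc n)) \<bullet> (\<delta> (Suc n) \<bullet> \<delta> n) = (rdiff I (Suc n) \<bullet> p (Suc n) +\<^sub>C t (Suc n) \<bullet> q (Suc n)) \<bullet> \<delta> n"
      by (rule comp_reassoc[OF p_\<delta>]) (use \<delta> arrs in auto)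
    also have "\<dots> = rdiff I (Suc n) \<bullet> (p (Suc n) \<bullet> \<delta> n) +\<^sub>C t (Suc n) \<bullet> (q (Suc n) \<bullet> \<delta> n)"
      using \<delta> arrs by (simp add: plus_comp_arr comp_assoc_arr arr_simps)
    also have "\<dots> = (rdiff I (Suc n) \<bullet> rdiff I n) \<bullet> p n +\<^sub>C (rdiff I (Suc n) \<bullet> (t n \<bullet> q n) +\<^sub>C (t (Suc n) \<bullet> rdiff K n) \<bullet> q n)"
      unfolding p_\<delta> q_\<delta> using arrs by (simp add: comp_plus_arr plus_assoc_arr comp_assoc_arr arr_simps)
    also have "\<dots> = Zer C (Cod C (a n)) (robj I (Suc (Suc n)))"
      unfolding tQ i(13) using arrs by (simp add: cat_simps)
    finally have 1: "p (Suc (Suc n)) \<bullet> (\<delta> (Suc n) \<bullet> \<delta> n) = Zer C (Dom C (\<delta> (Suc n) \<bullet> \<delta> n)) (robj I (Suc (Suc n)))"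
      using \<delta> by (simp add: arr_simps)
    have "q (Suc (Suc n)) \<bullet> (\<delta> (Suc n) \<bullet> \<delta> n) = (rdiff K (Suc n) \<bullet> q (Suc n)) \<bullet> \<delta> n"
      by (rule comp_reassoc[OF q_\<delta>]) (use \<delta> arrs in auto)
    also have "\<dots> = (rdiff K (Suc n) \<bullet> rdiff K n) \<bullet> q n" using q_\<delta> \<delta> arrs by (simp add: comp_assoc_arr)
    also have "\<dots> = Zer C (Cod C (a n)) (robj K (Suc (Suc n)))" unfolding k(13) using arrs by (simp add: zero_comp_arr)
    finally have 2: "q (Suc (Suc n)) \<bullet> (\<delta> (Suc n) \<bullet> \<delta> n) = Zer C (Dom C (\<delta> (Suc n) \<bullet> \<delta> n)) (robj K (Suc (Suc n)))"
      using \<delta> by (simp add: arr_simps)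
    show ?thesis using zeroI[OF _ _ 1 2] \<delta> by (simp add: arr_simps)
  qed
  have se: "short_exact C (a n) (q n)" for n using biproduct_short_exact[OF enough bip] .
  then have am: "monic C (a n)" and qe: "epic C (q n)" and aq: "exact_at C (a n) (q n)" for n by (auto simp: short_exact_def)
  have e_monic: "monic C e"
    by (rule monic_of_short_exact_rows[OF enough fgx am i(2) k(2) e(1) e_f q_e]) (use e arrs in auto)
  have ex0: "exact_at C e (\<delta> 0)"
    by (rule exact_at_of_short_exact_rows[OF enough aq am ge i(11)[of 0] k(11)[of 0] \<delta>(1) e(1), where q'' = "q 1" and i' = f])
      (use e \<delta> \<delta>_e e_f \<delta>_a q_e q_\<delta>[of 0] arrs in auto)
  have exS: "exact_at C (\<delta> n) (\<delta> (Suc n))" for n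
    by (rule exact_at_of_short_exact_rows[OF enough aq am qe[of n] i(11)[of "Suc n"] k(11)[of "Suc n"] \<delta>(1) \<delta>(1),
          where q'' = "q (Suc (Suc n))" and i' = "a n"])
      (use \<delta> \<delta>_\<delta> \<delta>_a q_\<delta> arrs in auto)
  have "injective_resolution C B J"
    unfolding injective_resolution_def J_def in_Hom
    using biproduct_injective[OF bip i(1) k(1)] e \<delta> e_monic ex0 exS by simp
  moreover have "is_lift C I J f a"
    unfolding is_lift_def J_def in_Hom using bp(1,5) e_f \<delta>_a by simp
  moreover have "is_lift C J K g q"
    unfolding is_lift_def J_def in_Hom using bp(4,9,11) q_e q_\<delta> by simp
  ultimately show ?thesis using se by blast
qed

end

section \<open>Multiples of arrows and split sequences\<close>

context abelian_category
begin

lemma pow_in_Hom: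
  assumes "f \<in> Hom C A B"
  shows "f [^]\<^bsub>hom_group C A B\<^esub> (m::nat) \<in> Hom C A B"
proof -
  interpret comm_group "hom_group C A B" using assms comm_group_Hom by (auto simp: in_Hom)
  show ?thesis using nat_pow_closed[of f m] assms by (simp add: hom_group_def)
qed

lemma pow_comp:
  assumes "f \<in> Hom C A B" "g \<in> Hom C X A"
  shows "f [^]\<^bsub>hom_group C A B\<^esub> (m::nat) \<bullet> g = (f \<bullet> g) [^]\<^bsub>hom_group C X B\<^esub> m"
proof (induction m)
  case 0
  show ?case using assms dom_in cod_in by (auto simp: hom_group_def in_Hom zero_comp_arr)
next
  case (Suc m)
  have "f [^]\<^bsub>hom_group C A B\<^esub> Suc m \<bullet> g = (f [^]\<^bsub>hom_group C A B\<^esub> m +\<^sub>C f) \<bullet> g" by (simp add: hom_group_def)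
  also have "\<dots> = f [^]\<^bsub>hom_group C A B\<^esub> m \<bullet> g +\<^sub>C f \<bullet> g"
    using pow_in_Hom[OF assms(1), of m] assms by (intro plus_comp_arr) (auto simp: in_Hom)
  finally show ?case unfolding Suc.IH by (simp add: hom_group_def)
qed

lemma comp_pow:
  assumes "f \<in> Hom C A B" "g \<in> Hom C B D"
  shows "g \<bullet> f [^]\<^bsub>hom_group C A B\<^esub> (m::nat) = (g \<bullet> f) [^]\<^bsub>hom_group C A D\<^esub> m"
proof (induction m)
  case 0
  show ?case using assms dom_in cod_in by (auto simp: hom_group_def in_Hom comp_zero_arr)
next
  case (Suc m)
  have "g \<bullet> f [^]\<^bsub>hom_group C A B\<^esub> Suc m = g \<bullet> (f [^]\<^bsub>hom_group C A B\<^esub> m +\<^sub>C f)" by (simp add: hom_group_def)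
  also have "\<dots> = g \<bullet> f [^]\<^bsub>hom_group C A B\<^esub> m +\<^sub>C g \<bullet> f"
    using pow_in_Hom[OF assms(1), of m] assms by (intro comp_plus_arr) (auto simp: in_Hom)
  finally show ?case unfolding Suc.IH by (simp add: hom_group_def)
qed

lemma mult_by_in: "A \<in> Ob C \<Longrightarrow> mult_by C m A \<in> Hom C A A"
  unfolding mult_by_def by (rule pow_in_Hom[OF id_in])

text \<open>As lifts are unique up to homotopy, this identifies every lift of multiplication by \<open>m\<close> with the
  \<open>m\<close>-fold sum of a lift of the identity.\<close>

lemma lift_mult_by:
  assumes I: "injective_resolution C A I" and J: "injective_resolution C A J"
    and w: "is_lift C I J (Idt C A) w"
  shows "is_lift C I J (mult_by C m A) (\<lambda>n. w n [^]\<^bsub>hom_group C (robj I n) (robj J n)\<^esub> m)"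
proof -
  note i = resolutionD[OF I] and j = resolutionD[OF J]
  have wH: "w n \<in> Hom C (robj I n) (robj J n)" for n using liftD[OF w] by (auto simp: in_Hom)
  have dI: "rdiff I n \<in> Hom C (robj I n) (robj I (Suc n))" "rdiff J n \<in> Hom C (robj J n) (robj J (Suc n))" for n
    using i j by (auto simp: in_Hom)
  have raug: "raug I \<in> Hom C A (robj I 0)" "raug J \<in> Hom C A (robj J 0)"
    using i(3) i(4,5)[of 0] j(3) j(4,5)[of 0] by (auto simp: in_Hom)
  show ?thesis
    unfolding is_lift_def mult_by_def
    using pow_in_Hom[OF wH] pow_comp[OF wH raug(1)] comp_pow[OF id_in[OF i(10)] raug(2)]
      pow_comp[OF wH dI(1)] comp_pow[OF wH dI(2)] liftD(4,5)[OF w] by simp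
qed

lemma kernel_short_exact:
  assumes k: "is_kernel C k g" and g: "epic C g"
  shows "short_exact C k g"
proof -
  have km: "monic C k" using kernel_monic[OF k] .
  then have "k \<in> Arr C" by (simp add: monic_def)
  then obtain c where c: "is_cokernel C c k" using cokernels by blast
  then have "is_kernel C k c" using monic_normal[OF km] by blast
  then show ?thesis using km g c k unfolding short_exact_def exact_at_def is_image_def by blast
qed

text \<open>A retraction \<open>\<rho>\<close> of \<open>u\<close> exists by injectivity, and \<open>1 - u \<rho>\<close> vanishes on \<open>u\<close>. As its target
  is injective too, it factors through \<open>v\<close>; the factor is a section.\<close>

lemma short_exact_injective_section:
  assumes ses: "short_exact C u v" and I: "injective_object C (Dom C u)" "injective_object C (Cod C u)"
  obtains \<sigma> where "\<sigma> \<in> Hom C (Cod C v) (Dom C v)" "v \<bullet> \<sigma> = Idt C (Cod C v)"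
proof -
  have um: "monic C u" and ve: "epic C v" and ex: "exact_at C u v" using ses by (auto simp: short_exact_def)
  note uv = exact_at_comp[OF ex]
  obtain \<rho> where \<rho>: "\<rho> \<in> Arr C" "Dom C \<rho> = Cod C u" "Cod C \<rho> = Dom C u" "\<rho> \<bullet> u = Idt C (Dom C u)"
    by (rule injective_extend[OF I(1) um, of "Idt C (Dom C u)"]) (use uv in \<open>auto simp: arr_simps\<close>)
  let ?e = "Idt C (Cod C u) +\<^sub>C neg (u \<bullet> \<rho>)"
  have "?e \<bullet> u = u +\<^sub>C neg (u \<bullet> (\<rho> \<bullet> u))" using \<rho>(1-3) uv by (simp add: cat_simps)
  also have "\<dots> = Zer C (Dom C u) (Cod C u)" unfolding \<rho>(4) using uv by (simp add: cat_simps)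
  finally have eu: "?e \<bullet> u = Zer C (Dom C u) (Cod C u)" .
  obtain \<sigma> where \<sigma>: "\<sigma> \<in> Arr C" "Dom C \<sigma> = Cod C v" "Cod C \<sigma> = Cod C u" "\<sigma> \<bullet> v = ?e"
    by (rule exact_at_extend[OF ex I(2) _ _ _ eu]) (use \<rho>(1-3) uv in \<open>auto simp: arr_simps\<close>)
  have "(v \<bullet> \<sigma>) \<bullet> v = v \<bullet> ?e" using \<sigma> uv by (simp add: comp_assoc_arr)
  also have "\<dots> = v +\<^sub>C neg ((v \<bullet> u) \<bullet> \<rho>)" using \<rho>(1-3) uv(1-3) by (simp add: cat_simps)
  also have "\<dots> = Idt C (Cod C v) \<bullet> v" unfolding uv(4) using \<rho>(1-3) uv by (simp add: cat_simps)
  finally have "v \<bullet> \<sigma> = Idt C (Cod C v)"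
    by (rule epicD[OF ve, rotated -1]) (use \<sigma>(1-3) uv in \<open>auto simp: arr_simps\<close>)
  then show thesis using that[of \<sigma>] \<sigma> uv by (simp add: in_Hom)
qed

end

section \<open>Applying a left exact functor\<close>

context left_exact_functor
begin

lemma Fmap_in: "f \<in> Hom C A B \<Longrightarrow> x \<in> carrier (Fob F A) \<Longrightarrow> Fmap F f x \<in> carrier (Fob F B)"
  using Fmap_hom by (rule hom_in_carrier)

lemma Fmap_zero:
  assumes A: "A \<in> Ob C" and B: "B \<in> Ob C" and x: "x \<in> carrier (Fob F A)"
  shows "Fmap F (Zer C A B) x = \<one>\<^bsub>Fob F B\<^esub>"
proof -
  interpret B: comm_group "Fob F B" using Fob_comm_group[OF B] .
  have z: "Zer C A B \<in> Hom C A B" using A B by (simp add: in_Hom arr_simps)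
  have "Zer C A B +\<^sub>C Zer C A B = Zer C A B" using A B by (simp add: zero_plus_arr arr_simps)
  then have "Fmap F (Zer C A B) x \<otimes>\<^bsub>Fob F B\<^esub> Fmap F (Zer C A B) x = Fmap F (Zer C A B) x"
    using Fmap_plus[OF z z x] by simp
  then show ?thesis using Fmap_in[OF z x] by simp
qed

lemma Fmap_pow:
  assumes f: "f \<in> Hom C A B" and x: "x \<in> carrier (Fob F A)"
  shows "Fmap F (f [^]\<^bsub>hom_group C A B\<^esub> (m::nat)) x = Fmap F f x [^]\<^bsub>Fob F B\<^esub> m"
proof (induction m)
  case 0
  show ?case using f x dom_in cod_in Fmap_zero[of A B x] by (auto simp: hom_group_def in_Hom)
next
  case (Suc m)
  have "Fmap F (f [^]\<^bsub>hom_group C A B\<^esub> Suc m) x = Fmap F (f [^]\<^bsub>hom_group C A B\<^esub> m +\<^sub>C f) x" by (simp add: hom_group_def)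
  also have "\<dots> = Fmap F (f [^]\<^bsub>hom_group C A B\<^esub> m) x \<otimes>\<^bsub>Fob F B\<^esub> Fmap F f x"
    by (rule Fmap_plus[OF pow_in_Hom[OF f] f x])
  finally show ?case unfolding Suc.IH by simp
qed

lemma apply_functor_simps [simp]:
  "grp (apply_functor F I) n = Fob F (robj I n)" "dif (apply_functor F I) n = Fmap F (rdiff I n)"
  by (simp_all add: apply_functor_def)

lemma rdiff_in: "injective_resolution C A I \<Longrightarrow> rdiff I n \<in> Hom C (robj I n) (robj I (Suc n))"
  using resolutionD by (simp add: in_Hom)

lemma lift_in: "is_lift C I J f \<phi> \<Longrightarrow> \<phi> n \<in> Hom C (robj I n) (robj J n)"
  by (simp add: is_lift_def)

lemma cochain_complex_apply:
  assumes I: "injective_resolution C A I"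
  shows "cochain_complex (apply_functor F I)"
  using Fob_comm_group[OF resolutionD(9)[OF I]] Fmap_hom[OF rdiff_in[OF I]]
    Fmap_zero[OF resolutionD(9)[OF I] resolutionD(9)[OF I]] resolutionD(13)[OF I]
  by (intro cochain_complex.intro) (simp_all flip: Fmap_comp[OF rdiff_in[OF I] rdiff_in[OF I]])

lemma cochain_map_apply:
  assumes I: "injective_resolution C A I" and J: "injective_resolution C B J" and \<phi>: "is_lift C I J f \<phi>"
  shows "cochain_map (apply_functor F I) (apply_functor F J) (\<lambda>n. Fmap F (\<phi> n))"
  using Fmap_hom[OF lift_in[OF \<phi>]] Fmap_comp[OF rdiff_in[OF I] lift_in[OF \<phi>]]
    Fmap_comp[OF lift_in[OF \<phi>] rdiff_in[OF J]] liftD(5)[OF \<phi>]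
  by (intro cochain_map.intro cochain_complex_apply[OF I] cochain_complex_apply[OF J] cochain_map_axioms.intro)
    simp_all

text \<open>\<open>F\<close> is functorial only on the carriers, so the two cochain maps are required to agree with the
  values of \<open>F\<close> there.\<close>

lemma cochain_homotopy_apply:
  assumes I: "injective_resolution C A I" and J: "injective_resolution C B J"
    and \<phi>: "is_lift C I J f \<phi>" and \<psi>: "is_lift C I J f \<psi>"
    and \<Phi>: "\<And>n x. x \<in> carrier (Fob F (robj I n)) \<Longrightarrow> \<Phi> n x = Fmap F (\<phi> n) x"
    and \<Psi>: "\<And>n x. x \<in> carrier (Fob F (robj I n)) \<Longrightarrow> \<Psi> n x = Fmap F (\<psi> n) x"
  shows "\<exists>s. cochain_homotopy (apply_functor F I) (apply_functor F J) \<Phi> \<Psi> s"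
proof -
  obtain s where s: "\<And>n. s n \<in> Hom C (robj I (Suc n)) (robj J n)" "\<phi> 0 = \<psi> 0 +\<^sub>C s 0 \<bullet> rdiff I 0"
    "\<And>n. \<phi> (Suc n) = \<psi> (Suc n) +\<^sub>C (s (Suc n) \<bullet> rdiff I (Suc n) +\<^sub>C rdiff J n \<bullet> s n)"
    using lift_homotopy[OF I J \<phi> \<psi>] by blast
  note dI = rdiff_in[OF I] and dJ = rdiff_in[OF J] and p = lift_in[OF \<psi>]
  have sd: "s n \<bullet> rdiff I n \<in> Hom C (robj I n) (robj J n)" "rdiff J n \<bullet> s n \<in> Hom C (robj I (Suc n)) (robj J (Suc n))" for n
    using comp_in[OF dI s(1)] comp_in[OF s(1) dJ] by auto
  have sum: "s (Suc n) \<bullet> rdiff I (Suc n) +\<^sub>C rdiff J n \<bullet> s n \<in> Hom C (robj I (Suc n)) (robj J (Suc n))" for n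
    using sd[of n] sd[of "Suc n"] by (simp add: in_Hom arr_plus)
  have "cochain_homotopy (apply_functor F I) (apply_functor F J) \<Phi> \<Psi> (\<lambda>n. Fmap F (s n))"
    unfolding cochain_homotopy_def
    using Fmap_hom[OF s(1)] Fmap_plus[OF p sd(1)] Fmap_plus[OF p sum] Fmap_plus[OF sd(1) sd(2)]
      Fmap_comp[OF dI s(1)] Fmap_comp[OF s(1) dJ] s(2,3)
    by (simp add: \<Phi> \<Psi>)
  then show ?thesis by blast
qed

text \<open>\<open>F\<close> is left exact only, but it also preserves surjectivity of \<open>v n\<close>, which has a section because
  resolutions consist of injective objects.\<close>

lemma cochain_ses_apply:
  assumes I: "injective_resolution C A I" and J: "injective_resolution C B J" and K: "injective_resolution C D K"
    and u: "is_lift C I J f u" and v: "is_lift C J K g v" and ses: "\<And>n. short_exact C (u n) (v n)"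
  shows "cochain_ses (apply_functor F I) (apply_functor F J) (apply_functor F K)
    (\<lambda>n. Fmap F (u n)) (\<lambda>n. Fmap F (v n))"
proof (intro cochain_ses.intro cochain_complex_apply[OF I] cochain_complex_apply[OF J] cochain_complex_apply[OF K]
    cochain_map_apply[OF I J u] cochain_map_apply[OF J K v] cochain_ses_axioms.intro)
  fix n
  note le = left_exact[OF lift_in[OF u] lift_in[OF v] ses, of n]
  show "inj_on (Fmap F (u n)) (carrier (grp (apply_functor F I) n))" using le by simp
  show "Fmap F (u n) ` carrier (grp (apply_functor F I) n)
    = kernel (grp (apply_functor F J) n) (grp (apply_functor F K) n) (Fmap F (v n))" using le by simp
  obtain \<sigma> where \<sigma>: "\<sigma> \<in> Hom C (robj K n) (robj J n)" "v n \<bullet> \<sigma> = Idt C (robj K n)"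
    using short_exact_injective_section[OF ses[of n]] liftD(1-3)[OF u, of n] liftD(1-3)[OF v, of n] resolutionD(1)[OF I, of n]
      resolutionD(1)[OF J, of n]
    by metis
  show "Fmap F (v n) ` carrier (grp (apply_functor F J) n) = carrier (grp (apply_functor F K) n)"
  proof (intro equalityI subsetI)
    fix x assume "x \<in> carrier (grp (apply_functor F K) n)"
    then have x: "x \<in> carrier (Fob F (robj K n))" by simp
    have "Fmap F (v n) (Fmap F \<sigma> x) = x"
      using Fmap_comp[OF \<sigma>(1) lift_in[OF v] x] \<sigma>(2) Fmap_id[OF resolutionD(9)[OF K] x] by simp
    then show "x \<in> Fmap F (v n) ` carrier (grp (apply_functor F J) n)"
      using Fmap_in[OF \<sigma>(1) x] by (auto intro!: image_eqI[of _ _ "Fmap F \<sigma> x"])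
  qed (use Fmap_in[OF lift_in[OF v]] in auto)
qed

end

theorem theorem1p1:
  fixes C :: "('o, 'm) ab_category"
    and F :: "('o, 'm, 'g) ab_functor"
    and R :: "'o \<Rightarrow> ('o, 'm) resolution"
    and N :: 'o and \<iota> :: 'm and m i :: nat
  assumes "abelian_category C"
    and "enough_injectives C"
    and "left_exact_functor C F"
    and "resolution_choice C R"
    and "N \<in> Ob C"
    and "m > 0"
    and "epic C (mult_by C m N)"
    and "is_kernel C \<iota> (mult_by C m N)"
    and "i > 0"
  shows "split_short_exact_groups
           (quot_by (derived_ob R F (i - 1) N) m)
           (derived_ob R F i (Dom C \<iota>))
           (torsion (derived_ob R F i N) m)
           (kummer_left C R F m \<iota> (i - 1))
           (derived_map C R F i \<iota>)"
proof -
  interpret left_exact_functor C F by fact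
  obtain n where n: "i = Suc n" using \<open>i > 0\<close> by (cases i) auto
  let ?g = "mult_by C m N"
  have g: "?g \<in> Hom C N N" using mult_by_in \<open>N \<in> Ob C\<close> .
  have \<iota>A: "\<iota> \<in> Arr C" "Cod C \<iota> = N" using assms(8) g by (auto simp: is_kernel_def in_Hom)
  define A where "A = Dom C \<iota>"
  have \<iota>: "\<iota> \<in> Hom C A N" and A: "A \<in> Ob C" using \<iota>A dom_in by (auto simp: A_def in_Hom)
  have ses: "short_exact C \<iota> ?g" using kernel_short_exact assms(7,8) by blast
  have RA: "injective_resolution C A (R A)" and RN: "injective_resolution C N (R N)"
    using assms(4) A \<open>N \<in> Ob C\<close> by (auto simp: resolution_choice_def)
  \<comment> \<open>The connecting map is defined by some horseshoe; \<open>J\<close> is its middle resolution.\<close>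
  have "\<exists>x. case x of (J, u, v) \<Rightarrow> is_resolution_ses C R \<iota> ?g J u v"
    using horseshoe[OF assms(2) ses \<iota> g RA RN] \<iota> g unfolding is_resolution_ses_def by (simp add: in_Hom)
  then have "case (SOME (J, u, v). is_resolution_ses C R \<iota> ?g J u v) of (J, u, v) \<Rightarrow> is_resolution_ses C R \<iota> ?g J u v"
    by (rule someI_ex)
  then obtain J u v where Juv: "(SOME (J, u, v). is_resolution_ses C R \<iota> ?g J u v) = (J, u, v)"
    "is_resolution_ses C R \<iota> ?g J u v" by (auto split: prod.splits)
  have J: "injective_resolution C N J" and u: "is_lift C (R A) J \<iota> u" and v: "is_lift C J (R N) ?g v"
    and uv: "\<And>k. short_exact C (u k) (v k)"
    using Juv(2) \<iota> g by (auto simp: is_resolution_ses_def in_Hom)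
  let ?K = "apply_functor F (R A)" and ?L = "apply_functor F J" and ?M = "apply_functor F (R N)"
  let ?u = "\<lambda>k. Fmap F (u k)" and ?v = "\<lambda>k. Fmap F (v k)"
  have conn: "connecting C R F \<iota> ?g n = snake ?K ?L ?u ?v n"
    unfolding connecting_def Juv(1) A_def by simp
  have idN: "Idt C N \<in> Hom C N N" "Idt C N \<bullet>\<^bsub>C\<^esub> Idt C N = Idt C N" "Idt C N \<bullet>\<^bsub>C\<^esub> \<iota> = \<iota>"
    using id_in \<open>N \<in> Ob C\<close> id_left \<iota> by auto
  \<comment> \<open>\<open>J\<close> and \<open>R N\<close> both resolve \<open>N\<close>, so they are homotopy equivalent.\<close>
  obtain w where w: "is_lift C J (R N) (Idt C N) w" using lift_exists[OF J RN idN(1)] by blast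
  obtain w' where w': "is_lift C (R N) J (Idt C N) w'" using lift_exists[OF RN J idN(1)] by blast
  let ?w = "\<lambda>k. Fmap F (w k)" and ?w' = "\<lambda>k. Fmap F (w' k)"
  have w'w: "is_lift C J J (Idt C N) (\<lambda>k. w' k \<bullet>\<^bsub>C\<^esub> w k)" using lift_comp[OF J RN J idN(1) idN(1) w w'] idN(2) by simp
  have ww': "is_lift C (R N) (R N) (Idt C N) (\<lambda>k. w k \<bullet>\<^bsub>C\<^esub> w' k)" using lift_comp[OF RN J RN idN(1) idN(1) w' w] idN(2) by simp
  have "\<exists>s. cochain_homotopy ?L ?L (\<lambda>k x. ?w' k (?w k x)) (\<lambda>k x. x) s"
    by (rule cochain_homotopy_apply[OF J J w'w lift_id[OF J]])
      (simp_all add: Fmap_comp[OF lift_in[OF w] lift_in[OF w']] Fmap_id resolutionD(9)[OF J])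
  moreover have "\<exists>t. cochain_homotopy ?M ?M (\<lambda>k x. ?w k (?w' k x)) (\<lambda>k x. x) t"
    by (rule cochain_homotopy_apply[OF RN RN ww' lift_id[OF RN]])
      (simp_all add: Fmap_comp[OF lift_in[OF w'] lift_in[OF w]] Fmap_id resolutionD(9)[OF RN])
  ultimately have bij: "bij_betw (coh_map ?M ?w k) (carrier (cohomology ?L k)) (carrier (cohomology ?M k))" for k
    using homotopy_equivalence_bij[OF cochain_map_apply[OF J RN w] cochain_map_apply[OF RN J w']] by blast
  \<comment> \<open>Both \<open>v\<close> and \<open>m w\<close> lift multiplication by \<open>m\<close>, hence they are homotopic.\<close>
  have "\<exists>s. cochain_homotopy ?L ?M (\<lambda>k y. ?w k y [^]\<^bsub>grp ?M k\<^esub> m) ?v s"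
    by (rule cochain_homotopy_apply[OF J RN lift_mult_by[OF J RN w] v])
      (simp_all add: Fmap_pow[OF lift_in[OF w]])
  then obtain s where s: "cochain_homotopy ?L ?M (\<lambda>k y. ?w k y [^]\<^bsub>grp ?M k\<^esub> m) ?v s" by blast
  define \<phi> where "\<phi> = (SOME \<phi>. is_lift C (R A) (R N) \<iota> \<phi>)"
  have \<phi>: "is_lift C (R A) (R N) \<iota> \<phi>" unfolding \<phi>_def using lift_exists[OF RA RN \<iota>] by (rule someI_ex)
  have \<beta>: "derived_map C R F i \<iota> = coh_map ?M (\<lambda>k. Fmap F (\<phi> k)) i"
    unfolding derived_map_def \<phi>_def A_def \<iota>A(2) by simp
  \<comment> \<open>The lift chosen for \<open>\<iota>\<close> agrees with \<open>w u\<close> up to homotopy.\<close>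
  have wu: "is_lift C (R A) (R N) \<iota> (\<lambda>k. w k \<bullet>\<^bsub>C\<^esub> u k)" using lift_comp[OF RA J RN \<iota> idN(1) u w] idN(3) by simp
  have "\<exists>s. cochain_homotopy ?K ?M (\<lambda>k. Fmap F (\<phi> k)) (\<lambda>k x. ?w k (?u k x)) s"
    by (rule cochain_homotopy_apply[OF RA RN \<phi> wu]) (simp_all add: Fmap_comp[OF lift_in[OF u] lift_in[OF w]])
  then obtain s' where s': "cochain_homotopy ?K ?M (\<lambda>k. Fmap F (\<phi> k)) (\<lambda>k x. ?w k (?u k x)) s'" by blast
  note Fu = cochain_map_apply[OF RA J u] and Fw = cochain_map_apply[OF J RN w] and F\<phi> = cochain_map_apply[OF RA RN \<phi>]
  have \<beta>_wu: "derived_map C R F i \<iota> c = coh_map ?M ?w i (coh_map ?L ?u i c)" if "c \<in> carrier (cohomology ?K i)" for c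
    unfolding \<beta> using homotopic_coh_map[OF F\<phi> cochain_map_comp[OF Fu Fw] s' that] coh_map_comp[OF Fu Fw that] by simp
  have "kummer_left C R F m \<iota> n = (\<lambda>c. the_elem (snake ?K ?L ?u ?v n ` c))"
    unfolding kummer_left_def[abs_def] \<iota>A(2) conn ..
  moreover have "split_short_exact_groups (quot_by (cohomology ?M n) m) (cohomology ?K (Suc n))
    (torsion (cohomology ?M (Suc n)) m) (\<lambda>c. the_elem (snake ?K ?L ?u ?v n ` c)) (derived_map C R F (Suc n) \<iota>)"
    using kummer_split_complexes[OF cochain_ses_apply[OF RA J RN u v uv] Fw s bij] \<beta>_wu
      cochain_map.coh_map_hom[OF F\<phi>, of i] \<beta> n by metis
  ultimately show ?thesis by (simp add: derived_ob_def n A_def)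
qed

end
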